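(* Let $0<\Lambda<1$ and let $f\in C^{1,1}_{loc}[0,+\infty)$ satisfy $f(0)=0$, $-\frac1\Lambda\le f'(t)\le-\Lambda$ for all $t\ge0$, and $f'(0)=-1$. Let $R>0$ and let $u,\tilde u$ be $C^2$ functions on $B_R^c\subset\mathbb{R}^2$ with $u,\tilde u>0$, whose upward-oriented graphs both satisfy $\kappa_2=f(\kappa_1)$ (where $\kappa_1\ge\kappa_2$ are the principal curvatures) and both have limit unit normal $N_\infty=(0,0,1)$ at infinity. Assume $$u\ge\tilde u\quad\text{in }B_R^c$$ and that there exists a sequence of points $\{x_n\}\subset B_R^c$ with $x_n\to\infty$ such that $$u(x_n)-\tilde u(x_n)\to0\quad\text{as }n\to\infty.$$ Then $u\equiv\tilde u$ in $B_R^c$.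
   Context: $B_R=\{x\in\mathbb{R}^2:|x|<R\}$ and $B_R^c=\mathbb{R}^2\setminus B_R$. For a $C^2$ function $u$ on a planar region, its graph $\{(x,u(x))\}\subset\mathbb{R}^3$ is oriented by the upward unit normal $N=(-Du,1)/\sqrt{1+|Du|^2}$. Its principal curvatures $\kappa_1\ge\kappa_2$ are determined by $$\frac{\kappa_1+\kappa_2}{2}=\frac{(1+u_2^2)u_{11}-2u_1u_2u_{12}+(1+u_1^2)u_{22}}{2(1+|Du|^2)^{3/2}},\qquad \kappa_1\kappa_2=\frac{\det D^2u}{(1+|Du|^2)^2}.$$ Limit unit normal $N_\infty=(0,0,1)$ means $N(x)\to(0,0,1)$ as $x\to\infty$; equivalently $\lim_{x\to\infty}|Du(x)|=0$. *)

theory Defs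
  imports "HOL-Analysis.Analysis"
begin

abbreviation ball_compl :: "real \<Rightarrow> (real^2) set" where
  "ball_compl R \<equiv> - ball 0 R"

text \<open>Derivatives are taken within the domain, so at boundary points of a closed domain
  they are one-sided. On the complement of a ball they are unique (lemma pderiv_on_eqI below),
  although \<^term>\<open>frechet_derivative\<close> is a choice on a general set.\<close>

definition pderiv_on :: "(real^2) set \<Rightarrow> 2 \<Rightarrow> (real^2 \<Rightarrow> real) \<Rightarrow> real^2 \<Rightarrow> real" where
  "pderiv_on S i u x = frechet_derivative u (at x within S) (axis i 1)"

definition grad_on :: "(real^2) set \<Rightarrow> (real^2 \<Rightarrow> real) \<Rightarrow> real^2 \<Rightarrow> real^2" where
  "grad_on S u x = (\<chi> i. pderiv_on S i u x)"

definition hess_on :: "(real^2) set \<Rightarrow> (real^2 \<Rightarrow> real) \<Rightarrow> real^2 \<Rightarrow> real^2^2" where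
  "hess_on S u x = (\<chi> i j. pderiv_on S j (pderiv_on S i u) x)"

text \<open>On a closed domain this is regularity up to the boundary.\<close>

definition C2_on :: "(real^2) set \<Rightarrow> (real^2 \<Rightarrow> real) \<Rightarrow> bool" where
  "C2_on S u \<longleftrightarrow> u differentiable_on S \<and>
     (\<forall>i. pderiv_on S i u differentiable_on S) \<and>
     continuous_on S (hess_on S u)"

definition upward_normal :: "(real^2) set \<Rightarrow> (real^2 \<Rightarrow> real) \<Rightarrow> real^2 \<Rightarrow> real^3" where
  "upward_normal S u x =
     (1 / sqrt (1 + (norm (grad_on S u x))\<^sup>2)) *\<^sub>R
       vector [- grad_on S u x $ 1, - grad_on S u x $ 2, 1]"

definition mean_curvature :: "(real^2) set \<Rightarrow> (real^2 \<Rightarrow> real) \<Rightarrow> real^2 \<Rightarrow> real" where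
  "mean_curvature S u x =
     (let p = grad_on S u x; M = hess_on S u x in
       ((1 + (p$2)\<^sup>2) * M$1$1 - 2 * p$1 * p$2 * M$1$2 + (1 + (p$1)\<^sup>2) * M$2$2)
         / (2 * (1 + (norm p)\<^sup>2) powr (3/2)))"

definition gauss_curvature :: "(real^2) set \<Rightarrow> (real^2 \<Rightarrow> real) \<Rightarrow> real^2 \<Rightarrow> real" where
  "gauss_curvature S u x = det (hess_on S u x) / (1 + (norm (grad_on S u x))\<^sup>2)\<^sup>2"

definition principal_curvatures ::
    "(real^2) set \<Rightarrow> (real^2 \<Rightarrow> real) \<Rightarrow> real^2 \<Rightarrow> real \<Rightarrow> real \<Rightarrow> bool" where
  "principal_curvatures S u x \<kappa>\<^sub>1 \<kappa>\<^sub>2 \<longleftrightarrow>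
     \<kappa>\<^sub>1 \<ge> \<kappa>\<^sub>2 \<and> (\<kappa>\<^sub>1 + \<kappa>\<^sub>2) / 2 = mean_curvature S u x \<and> \<kappa>\<^sub>1 * \<kappa>\<^sub>2 = gauss_curvature S u x"

text \<open>The function \<open>f\<close> lives on \<open>[0,\<infinity>)\<close>, so the equation \<open>\<kappa>\<^sub>2 = f(\<kappa>\<^sub>1)\<close>
  includes \<open>\<kappa>\<^sub>1 \<ge> 0\<close>; this has to be said because HOL functions are total.\<close>

definition weingarten_graph :: "(real \<Rightarrow> real) \<Rightarrow> (real^2) set \<Rightarrow> (real^2 \<Rightarrow> real) \<Rightarrow> bool" where
  "weingarten_graph f S u \<longleftrightarrow>
     (\<forall>x\<in>S. \<exists>\<kappa>\<^sub>1 \<kappa>\<^sub>2. principal_curvatures S u x \<kappa>\<^sub>1 \<kappa>\<^sub>2 \<and> \<kappa>\<^sub>1 \<ge> 0 \<and> \<kappa>\<^sub>2 = f \<kappa>\<^sub>1)"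

lemma principal_curvatures_unique:
  assumes "principal_curvatures S u x a b" "principal_curvatures S u x c d"
  shows "a = c \<and> b = d"
proof -
  have s: "a + b = c + d" and p: "a * b = c * d" and o: "a \<ge> b" "c \<ge> d"
    using assms by (auto simp: principal_curvatures_def)
  have "(a - b)\<^sup>2 = (a + b)\<^sup>2 - 4 * (a * b)" by (simp add: power2_eq_square algebra_simps)
  also have "\<dots> = (c - d)\<^sup>2" unfolding s p by (simp add: power2_eq_square algebra_simps)
  finally have "a - b = c - d" using o by (simp add: power2_eq_iff_nonneg)
  with s show ?thesis by linarith
qed

lemma pderiv_on_eqI:
  assumes x: "x \<in> ball_compl R" and D: "(u has_derivative D) (at x within ball_compl R)"
  shows "pderiv_on (ball_compl R) i u x = D (axis i 1)"
proof -
  have F: "(u has_derivative frechet_derivative u (at x within ball_compl R)) (at x within ball_compl R)"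
    using D frechet_derivative_works differentiable_def by blast
  have "\<exists>d. 0 < \<bar>d\<bar> \<and> \<bar>d\<bar> < e \<and> x + d *\<^sub>R b \<in> ball_compl R"
    if "b \<in> Basis" "e > 0" for b :: "real^2" and e :: real
  proof -
    define d where "d = (if x \<bullet> b \<ge> 0 then e/2 else - (e/2))"
    have nn: "d * (x \<bullet> b) \<ge> 0" using that by (auto simp: d_def mult_nonneg_nonpos)
    have "(norm (x + d *\<^sub>R b))\<^sup>2 = (norm x)\<^sup>2 + 2 * (d * (x \<bullet> b)) + (norm (d *\<^sub>R b))\<^sup>2"
      by (simp only: power2_norm_eq_inner) (simp add: inner_simps inner_commute algebra_simps)
    hence "(norm x)\<^sup>2 \<le> (norm (x + d *\<^sub>R b))\<^sup>2" using nn by simp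
    hence "norm x \<le> norm (x + d *\<^sub>R b)" by (rule power2_le_imp_le) simp
    hence "x + d *\<^sub>R b \<in> ball_compl R" using x by simp
    moreover have "0 < \<bar>d\<bar>" "\<bar>d\<bar> < e" using that by (auto simp: d_def)
    ultimately show ?thesis by blast
  qed
  from frechet_derivative_unique_within[OF F D this] show ?thesis
    by (simp add: pderiv_on_def)
qed

end

theory Submission
  imports Defs
begin

text \<open>Outside a large disc the Weingarten equation is a small perturbation of the Laplace equation,
  provided the Hessians decay. This decay comes from quasiregularity: the shape operators of two
  solutions differ by a matrix \<open>B\<close> with \<open>|tr B| \<le> k |B - (tr B / 2) I|\<close>, \<open>k < 1\<close>, so up to lower-order
  terms \<open>det (D\<^sup>2u - D\<^sup>2v) \<le> - c |D\<^sup>2u - D\<^sup>2v|\<^sup>2\<close>. Applied to \<open>u\<close> and \<open>0\<close> this makes \<open>Du\<close> quasiregular, hence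
  \<open>Du = O(|x| powr (- \<gamma>))\<close>; applied to \<open>u\<close> and a translate of \<open>u\<close> it makes the difference quotients of
  \<open>Du\<close> quasiregular, which bounds \<open>D\<^sup>2u\<close> at the centre of a disc by the size of \<open>Du\<close> over the radius. With
  both, \<open>ln |x|\<^sup>2 - |x|\<^sup>2 powr (- a)\<close> is a barrier for \<open>w = u - v\<close>, and since it tends to infinity, \<open>w\<close> is
  bounded below outside a disc by its minimum on the bounding circle. That minimum must be \<open>0\<close> because
  \<open>w (x n)\<close> tends to \<open>0\<close>, so \<open>w\<close> vanishes at an interior point and the strong maximum principle applies.

  The quasiregular estimates only use the integrals \<open>I r\<close> of the form \<open>a db\<close> over the circles of radius \<open>r\<close>,
  whose derivative \<open>I'\<close> is the circle integral of the Jacobian: each estimate is an ordinary differential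
  inequality for \<open>I\<close>, and no integration over plane domains is needed.\<close>

section \<open>Integrals over circles\<close>

text \<open>Two obstacles shape the argument. First, \<open>f'\<close> is only Lipschitz and the
  solutions are only twice continuously differentiable, so the equation cannot be differentiated.
  Every estimate therefore compares two exact solutions, and difference quotients, with bounds
  independent of their step, take the place of third derivatives. Second, ln |x| is exactly
  harmonic, so the barrier has no Laplacian to spare. A correction of power type is what can be
  afforded without losing the growth to infinity, and it needs errors that decay like a power as
  well. The quasiregular inequality is pure algebra: a symmetric matrix with trace t and difference
  of eigenvalues x has 4 det = t^2 - x^2 and 2 |M|^2 = t^2 + x^2, so |t| <= k x with k < 1 is a
  negative upper bound for det, which is the Jacobian of Du. The Laplacian appears because of
  \<open>f' 0 = -1\<close>: for small curvatures the sum of the principal curvatures is of second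
  order in their difference.\<close>

lemma integral_Cauchy_Schwarz:
  fixes f g :: "real \<Rightarrow> real"
  assumes f: "continuous_on {a..b} f" and g: "continuous_on {a..b} g"
  shows "(integral {a..b} (\<lambda>t. f t * g t))\<^sup>2
       \<le> integral {a..b} (\<lambda>t. (f t)\<^sup>2) * integral {a..b} (\<lambda>t. (g t)\<^sup>2)"
proof -
  define A B C where "A = integral {a..b} (\<lambda>t. (f t)\<^sup>2)" and "B = integral {a..b} (\<lambda>t. (g t)\<^sup>2)"
    and "C = integral {a..b} (\<lambda>t. f t * g t)"
  note [continuous_intros] = f g
  have iA: "(\<lambda>t. (f t)\<^sup>2) integrable_on {a..b}" and iB: "(\<lambda>t. (g t)\<^sup>2) integrable_on {a..b}"
    and iC: "(\<lambda>t. f t * g t) integrable_on {a..b}"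
    by (intro integrable_continuous_real continuous_intros)+
  have A0: "A \<ge> 0" and B0: "B \<ge> 0"
    unfolding A_def B_def by (intro integral_nonneg iA iB, simp)+
  have *: "0 \<le> x\<^sup>2 * A + 2 * x * y * C + y\<^sup>2 * B" for x y
  proof -
    have "0 \<le> integral {a..b} (\<lambda>t. (x * f t + y * g t)\<^sup>2)"
      by (intro integral_nonneg integrable_continuous_real continuous_intros) simp
    also have "(\<lambda>t. (x * f t + y * g t)\<^sup>2) = (\<lambda>t. x\<^sup>2 * (f t)\<^sup>2 + 2 * x * y * (f t * g t) + y\<^sup>2 * (g t)\<^sup>2)"
      by (simp add: power2_eq_square algebra_simps)
    also have "integral {a..b} \<dots> = x\<^sup>2 * A + 2 * x * y * C + y\<^sup>2 * B"
      unfolding A_def B_def C_def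
      using has_integral_add[OF has_integral_add[OF has_integral_mult_right[OF integrable_integral[OF iA], of "x\<^sup>2"]
          has_integral_mult_right[OF integrable_integral[OF iC], of "2 * x * y"]]
          has_integral_mult_right[OF integrable_integral[OF iB], of "y\<^sup>2"]]
      by (rule integral_unique)
    finally show ?thesis .
  qed
  have "C\<^sup>2 \<le> A * B"
  proof (cases "B = 0")
    case True
    have "C = 0"
    proof (rule ccontr)
      assume "C \<noteq> 0"
      \<comment> \<open>With \<open>B = 0\<close> the quadratic form is linear in its second
        argument; this argument makes it \<open>-1\<close>.\<close>
      have "0 \<le> A + 2 * (-(A + 1) / (2 * C)) * C" using *[of 1 "-(A + 1) / (2 * C)"] True by (simp add: algebra_simps)
      also have "\<dots> = -1" using \<open>C \<noteq> 0\<close> by (simp add: field_simps)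
      finally show False by simp
    qed
    then show ?thesis using True by simp
  next
    case False
    then have B: "B > 0" using B0 by simp
    have "0 \<le> B\<^sup>2 * A + 2 * B * (- C) * C + (- C)\<^sup>2 * B" by (rule *)
    also have "\<dots> = B * (A * B - C\<^sup>2)" by (simp add: power2_eq_square algebra_simps)
    finally show ?thesis using B by (simp add: zero_le_mult_iff)
  qed
  then show ?thesis by (simp add: A_def B_def C_def)
qed

text \<open>The second factor is only differentiable once, so the integrand itself need not be
  differentiable in \<open>s\<close>; integration by parts in \<open>t\<close> moves the increment of \<open>Q t\<close> onto \<open>P\<close>.\<close>

lemma deriv_integral_wedge:
  fixes P Q Pr Pt Qr Qt :: "real \<Rightarrow> real \<Rightarrow> real"
  assumes r: "r \<in> {lo<..<hi}" and ab: "a \<le> b"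
    and dPr: "\<And>s t. s \<in> {lo<..<hi} \<Longrightarrow> ((\<lambda>s. P s t) has_real_derivative Pr s t) (at s)"
    and dPt: "\<And>s t. s \<in> {lo<..<hi} \<Longrightarrow> (P s has_real_derivative Pt s t) (at t)"
    and dQr: "\<And>s t. s \<in> {lo<..<hi} \<Longrightarrow> ((\<lambda>s. Q s t) has_real_derivative Qr s t) (at s)"
    and dQt: "\<And>s t. s \<in> {lo<..<hi} \<Longrightarrow> (Q s has_real_derivative Qt s t) (at t)"
    and cPr: "continuous_on ({lo<..<hi} \<times> {a..b}) (\<lambda>(s, t). Pr s t)"
    and cPt: "continuous_on ({lo<..<hi} \<times> {a..b}) (\<lambda>(s, t). Pt s t)"
    and cQr: "continuous_on ({lo<..<hi} \<times> {a..b}) (\<lambda>(s, t). Qr s t)"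
    and cQt: "continuous_on ({lo<..<hi} \<times> {a..b}) (\<lambda>(s, t). Qt s t)"
    and per: "\<And>s. P s a = P s b" "\<And>s. Q s a = Q s b"
  shows "((\<lambda>s. integral {a..b} (\<lambda>t. P s t * Qt s t)) has_real_derivative
          integral {a..b} (\<lambda>t. Pr r t * Qt r t - Pt r t * Qr r t)) (at r)"
proof -
  let ?U = "{lo<..<hi}"
  have sec: "continuous_on {a..b} (G s)" if "s \<in> ?U" "continuous_on (?U \<times> {a..b}) (\<lambda>(s, t). G s t)"
    for s and G :: "real \<Rightarrow> real \<Rightarrow> real"
  proof -
    have "continuous_on {a..b} (Pair s)" "Pair s ` {a..b} \<subseteq> ?U \<times> {a..b}"
      using that(1) by (auto intro!: continuous_intros)
    from continuous_on_compose2[OF that(2) this] show ?thesis by simp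
  qed
  have cP: "continuous_on {a..b} (P s)" if "s \<in> ?U" for s
    using dPt[OF that] by (meson DERIV_isCont continuous_at_imp_continuous_on)
  have cQ: "continuous_on {a..b} (Q s)" if "s \<in> ?U" for s
    using dQt[OF that] by (meson DERIV_isCont continuous_at_imp_continuous_on)
  note secs [continuous_intros] = sec[OF _ cPr] sec[OF _ cPt] sec[OF _ cQr] sec[OF _ cQt] cP cQ
  have snd: "continuous_on (?U \<times> {a..b}) (\<lambda>x. G r (snd x))"
    if "continuous_on {a..b} (G r)" for G :: "real \<Rightarrow> real \<Rightarrow> real"
    by (rule continuous_on_compose2[OF that continuous_on_snd[OF continuous_on_id]]) auto
  have der: "((\<lambda>s. integral {a..b} (\<lambda>t. F s t * g t)) has_real_derivative
       integral {a..b} (\<lambda>t. Fr r t * g t)) (at r)"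
    if F: "\<And>s t. s \<in> ?U \<Longrightarrow> ((\<lambda>s. F s t) has_real_derivative Fr s t) (at s)"
      and cF: "\<And>s. s \<in> ?U \<Longrightarrow> continuous_on {a..b} (F s)"
      and cFr: "continuous_on (?U \<times> {a..b}) (\<lambda>(s, t). Fr s t)"
      and g: "continuous_on {a..b} g" for F Fr :: "real \<Rightarrow> real \<Rightarrow> real" and g
  proof -
    have "((\<lambda>s. integral (cbox a b) (\<lambda>t. F s t * g t)) has_real_derivative
       integral (cbox a b) (\<lambda>t. Fr r t * g t)) (at r within ?U)"
    proof (rule leibniz_rule_field_derivative)
      show "((\<lambda>s. F s t * g t) has_real_derivative Fr s t * g t) (at s within ?U)" if "s \<in> ?U" for s t
        by (rule has_field_derivative_at_within[OF DERIV_cmult_right[OF F[OF that]]])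
      show "(\<lambda>t. F s t * g t) integrable_on cbox a b" if "s \<in> ?U" for s
        unfolding cbox_interval using that by (intro integrable_continuous_real continuous_intros cF g)
      have "continuous_on (?U \<times> {a..b}) (\<lambda>x. g (snd x))"
        by (rule continuous_on_compose2[OF g continuous_on_snd[OF continuous_on_id]]) auto
      then show "continuous_on (?U \<times> cbox a b) (\<lambda>(s, t). Fr s t * g t)"
        using cFr unfolding cbox_interval case_prod_unfold by (intro continuous_intros)
    qed (use r in auto)
    then show ?thesis using r by (simp add: at_within_open[of r ?U])
  qed
  \<comment> \<open>The product is expanded around \<open>r\<close>. \<open>X\<close> and
    \<open>Y\<close> keep one factor frozen at \<open>r\<close> and are differentiated under the
    integral sign, while \<open>rest\<close> contains two increments. \<open>P\<close> is Lipschitz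
    in the radius and \<open>Qt\<close> is continuous, so \<open>rest\<close> is o(s - r).\<close>
  define rest where "rest s = integral {a..b} (\<lambda>t. (P s t - P r t) * (Qt s t - Qt r t))" for s
  define X where "X s = integral {a..b} (\<lambda>t. P s t * Qt r t)" for s
  define Y where "Y s = integral {a..b} (\<lambda>t. Q s t * Pt r t)" for s
  have X: "(X has_real_derivative integral {a..b} (\<lambda>t. Pr r t * Qt r t)) (at r)"
    unfolding X_def using r by (intro der dPr cP cPr secs)
  have Y: "(Y has_real_derivative integral {a..b} (\<lambda>t. Qr r t * Pt r t)) (at r)"
    unfolding Y_def using r by (intro der dQr cQ cQr secs)
  have parts: "integral {a..b} (\<lambda>t. P r t * Qt s t) = - Y s" if s: "s \<in> ?U" for s
  proof -
    have "((\<lambda>t. Pt r t * Q s t + P r t * Qt s t) has_integral (P r b * Q s b - P r a * Q s a)) {a..b}"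
    proof (rule fundamental_theorem_of_calculus[OF ab])
      fix t assume "t \<in> {a..b}"
      have "((\<lambda>t. P r t * Q s t) has_real_derivative Pt r t * Q s t + P r t * Qt s t) (at t)"
        using DERIV_mult'[OF dPt[OF r] dQt[OF s]] by (simp add: add.commute)
      then show "((\<lambda>t. P r t * Q s t) has_vector_derivative Pt r t * Q s t + P r t * Qt s t) (at t within {a..b})"
        using has_vector_derivative_at_within has_real_derivative_iff_has_vector_derivative by blast
    qed
    then have "integral {a..b} (\<lambda>t. Pt r t * Q s t + P r t * Qt s t) = 0"
      using per by (simp add: integral_unique)
    moreover have "integral {a..b} (\<lambda>t. Pt r t * Q s t + P r t * Qt s t)
       = integral {a..b} (\<lambda>t. Pt r t * Q s t) + integral {a..b} (\<lambda>t. P r t * Qt s t)"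
      using r s by (intro integral_add integrable_continuous_real continuous_intros)
    ultimately show ?thesis by (simp add: Y_def mult.commute)
  qed
  have split: "integral {a..b} (\<lambda>t. P s t * Qt s t) = rest s + X s - Y s - X r" if s: "s \<in> ?U" for s
  proof -
    have "((\<lambda>t. ((P s t - P r t) * (Qt s t - Qt r t) + P s t * Qt r t)
        + (P r t * Qt s t - P r t * Qt r t)) has_integral (rest s + X s) +
        (integral {a..b} (\<lambda>t. P r t * Qt s t) - X r)) {a..b}"
      unfolding rest_def X_def using r s
      by (intro has_integral_add has_integral_diff integrable_integral integrable_continuous_real secs continuous_intros)
    moreover have "((P s t - P r t) * (Qt s t - Qt r t) + P s t * Qt r t)
        + (P r t * Qt s t - P r t * Qt r t) = P s t * Qt s t" for t by (simp add: algebra_simps)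
    ultimately have "integral {a..b} (\<lambda>t. P s t * Qt s t) = (rest s + X s) +
        (integral {a..b} (\<lambda>t. P r t * Qt s t) - X r)" by (simp add: integral_unique)
    then show ?thesis using parts[OF s] by simp
  qed
  obtain d where d: "d > 0" "cball r d \<subseteq> ?U"
    using r open_contains_cball[of ?U] open_greaterThanLessThan by blast
  have cd: "cball r d = {r-d..r+d}" by (auto simp: dist_real_def)
  have K: "compact ({r-d..r+d} \<times> {a..b})" by (intro compact_Times) auto
  have "continuous_on ({r-d..r+d} \<times> {a..b}) (\<lambda>(s, t). Pr s t)"
    by (rule continuous_on_subset[OF cPr]) (use d cd in auto)
  then have "bounded ((\<lambda>(s, t). Pr s t) ` ({r-d..r+d} \<times> {a..b}))"
    by (intro compact_imp_bounded compact_continuous_image K)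
  then obtain B where B: "B > 0" "\<And>s t. s \<in> {r-d..r+d} \<Longrightarrow> t \<in> {a..b} \<Longrightarrow> \<bar>Pr s t\<bar> \<le> B"
    unfolding bounded_pos by force
  have PL: "\<bar>P s t - P r t\<bar> \<le> B * \<bar>s - r\<bar>" if "s \<in> {r-d..r+d}" "t \<in> {a..b}" for s t
  proof -
    have "norm (P s t - P r t) \<le> B * norm (s - r)"
    proof (rule field_differentiable_bound[of "{r-d..r+d}" "\<lambda>s. P s t" "\<lambda>s. Pr s t"])
      show "((\<lambda>s. P s t) has_real_derivative Pr z t) (at z within {r-d..r+d})" if "z \<in> {r-d..r+d}" for z
        by (rule has_field_derivative_at_within[OF dPr]) (use that d cd in blast)
    qed (use that B d in auto)
    then show ?thesis by simp
  qed
  define w where "w s = integral {a..b} (\<lambda>t. \<bar>Qt s t - Qt r t\<bar>)" for s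
  have "continuous_on ?U (\<lambda>s. integral (cbox a b) (\<lambda>t. \<bar>Qt s t - Qt r t\<bar>))"
  proof (rule integral_continuous_on_param)
    have "continuous_on (?U \<times> {a..b}) (\<lambda>x. \<bar>Qt (fst x) (snd x) - Qt r (snd x)\<bar>)"
      using cQt snd[of Qt, OF secs(4)[OF r]] unfolding case_prod_unfold by (intro continuous_intros)
    then show "continuous_on (?U \<times> cbox a b) (\<lambda>(s, t). \<bar>Qt s t - Qt r t\<bar>)"
      by (simp add: case_prod_unfold)
  qed
  then have cw: "isCont w r"
    using r by (simp add: w_def[abs_def] continuous_on_eq_continuous_at)
  then have w0: "(w \<longlongrightarrow> 0) (at r)" by (simp add: isCont_def w_def)
  have restb: "\<bar>rest s\<bar> \<le> B * \<bar>s - r\<bar> * w s" if s: "s \<in> {r-d..r+d}" for s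
  proof -
    have sU: "s \<in> ?U" using s d cd by auto
    have "\<bar>rest s\<bar> \<le> integral {a..b} (\<lambda>t. B * \<bar>s - r\<bar> * \<bar>Qt s t - Qt r t\<bar>)"
      unfolding rest_def real_norm_def[symmetric]
    proof (rule integral_norm_bound_integral)
      show "norm ((P s t - P r t) * (Qt s t - Qt r t)) \<le> B * norm (s - r) * norm (Qt s t - Qt r t)"
        if "t \<in> {a..b}" for t
        using PL[OF s that] by (simp add: abs_mult mult_right_mono)
    qed (use r sU in \<open>intro integrable_continuous_real continuous_intros; simp\<close>)+
    then show ?thesis by (simp add: w_def)
  qed
  have "(rest has_real_derivative 0) (at r)"
    unfolding has_field_derivative_iff
  proof (rule Lim_null_comparison)
    show "\<forall>\<^sub>F s in at r. norm ((rest s - rest r) / (s - r)) \<le> B * w s"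
      unfolding eventually_at
    proof (intro exI[of _ d] conjI ballI impI)
      fix s assume "s \<in> UNIV" and s: "s \<noteq> r \<and> dist s r < d"
      then have "\<bar>rest s\<bar> \<le> B * \<bar>s - r\<bar> * w s" by (intro restb) (auto simp: dist_real_def)
      moreover have "rest r = 0" by (simp add: rest_def)
      ultimately show "norm ((rest s - rest r) / (s - r)) \<le> B * w s"
        using s by (simp add: divide_simps mult_ac)
    qed (use d in auto)
    show "((\<lambda>s. B * w s) \<longlongrightarrow> 0) (at r)" using tendsto_mult_right_zero[OF w0] by simp
  qed
  then have "((\<lambda>s. rest s + X s - Y s - X r) has_real_derivative
     0 + integral {a..b} (\<lambda>t. Pr r t * Qt r t) - integral {a..b} (\<lambda>t. Qr r t * Pt r t) - 0) (at r)"
    by (intro derivative_intros X Y)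
  moreover have "0 + integral {a..b} (\<lambda>t. Pr r t * Qt r t) - integral {a..b} (\<lambda>t. Qr r t * Pt r t) - 0
      = integral {a..b} (\<lambda>t. Pr r t * Qt r t - Pt r t * Qr r t)"
    using r by (subst integral_diff; (intro integrable_continuous_real continuous_intros)?) (simp_all add: mult.commute)
  ultimately have "((\<lambda>s. rest s + X s - Y s - X r) has_real_derivative
     integral {a..b} (\<lambda>t. Pr r t * Qt r t - Pt r t * Qr r t)) (at r)" by simp
  then show ?thesis
    by (rule has_field_derivative_transform_within_open[of _ _ _ ?U]) (use r split in auto)
qed

section \<open>Polar coordinates and integrals of forms over circles\<close>

definition dir :: "real \<Rightarrow> real^2" where "dir t = vector [cos t, sin t]"
definition nor :: "real \<Rightarrow> real^2" where "nor t = vector [- sin t, cos t]"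
definition circ :: "real^2 \<Rightarrow> real \<Rightarrow> real \<Rightarrow> real^2" where "circ c r t = c + r *\<^sub>R dir t"
text \<open>For gradients of \<open>a\<close> and \<open>b\<close> this is the Jacobian determinant
  of the pair, the coefficient of the form da ^ db.\<close>

definition cross2 :: "real^2 \<Rightarrow> real^2 \<Rightarrow> real" where "cross2 x y = x$1 * y$2 - x$2 * y$1"

lemma inner_R2: "x \<bullet> y = x$1 * y$1 + x$2 * y$2" for x y :: "real^2"
  by (simp add: inner_vec_def sum_2)

lemma norm_R2: "(norm x)\<^sup>2 = (x$1)\<^sup>2 + (x$2)\<^sup>2" for x :: "real^2"
  unfolding power2_norm_eq_inner inner_R2 by (simp add: power2_eq_square)

lemma dir_component [simp]: "dir t $ 1 = cos t" "dir t $ 2 = sin t" "nor t $ 1 = - sin t" "nor t $ 2 = cos t"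
  by (simp_all add: dir_def nor_def)

lemma dir_altdef: "dir t = cos t *\<^sub>R axis 1 1 + sin t *\<^sub>R axis 2 1"
  and nor_altdef: "nor t = - sin t *\<^sub>R axis 1 1 + cos t *\<^sub>R axis 2 1"
  by (simp_all add: vec_eq_iff forall_2 axis_def)

lemma norm_dir [simp]: "norm (dir t) = 1" "norm (nor t) = 1"
proof -
  have "(norm (dir t))\<^sup>2 = 1\<^sup>2" "(norm (nor t))\<^sup>2 = 1\<^sup>2" by (simp_all add: norm_R2)
  then show "norm (dir t) = 1" "norm (nor t) = 1" by (simp_all only: power2_eq_iff_nonneg norm_ge_zero zero_le_one)
qed

lemma continuous_dir [continuous_intros]:
  fixes S :: "'a::t2_space set"
  shows
  "continuous_on S f \<Longrightarrow> continuous_on S (\<lambda>x. dir (f x))"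
  "continuous_on S f \<Longrightarrow> continuous_on S (\<lambda>x. nor (f x))"
proof -
  assume f: "continuous_on S f"
  show "continuous_on S (\<lambda>x. dir (f x))"
    unfolding dir_altdef by (intro continuous_on_add continuous_on_scaleR continuous_on_cos continuous_on_sin continuous_on_const f)
next
  assume f: "continuous_on S f"
  show "continuous_on S (\<lambda>x. nor (f x))"
    unfolding nor_altdef by (intro continuous_on_add continuous_on_scaleR continuous_on_minus continuous_on_cos continuous_on_sin continuous_on_const f)
qed

lemma continuous_circ [continuous_intros]:
  fixes S :: "'a::t2_space set"
  shows
  "continuous_on S f \<Longrightarrow> continuous_on S g \<Longrightarrow> continuous_on S (\<lambda>x. circ c (f x) (g x))"
  unfolding circ_def by (intro continuous_intros)

lemma dist_circ [simp]: "dist c (circ c r t) = \<bar>r\<bar>" "dist (circ c r t) c = \<bar>r\<bar>"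
  by (simp_all add: circ_def dist_norm)

lemma circ_periodic: "circ c r 0 = circ c r (2 * pi)"
  by (simp add: circ_def dir_def)

lemma circ_0 [simp]: "circ c 0 t = c"
  by (simp add: circ_def)

lemma polar_R2: "\<exists>t\<in>{0..2*pi}. x = circ c (dist c x) t"
proof (cases "x = c")
  case False
  define y where "y = x - c"
  have y: "norm y > 0" using False by (simp add: y_def)
  have "(y$1 / norm y)\<^sup>2 + (y$2 / norm y)\<^sup>2 = 1"
    unfolding power_divide add_divide_distrib[symmetric] norm_R2[symmetric] using y by simp
  then obtain t where t: "0 \<le> t" "t < 2 * pi" "y$1 / norm y = cos t" "y$2 / norm y = sin t"
    using sincos_total_2pi by metis
  have "y$1 = norm y * cos t" "y$2 = norm y * sin t"
    using t(3,4) y by (metis less_irrefl nonzero_mult_div_cancel_left times_divide_eq_right)+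
  then have "y = norm y *\<^sub>R dir t" by (simp add: vec_eq_iff forall_2)
  moreover have "x = c + y" "dist c x = norm y" by (simp_all add: y_def dist_norm norm_minus_commute)
  ultimately have "x = circ c (dist c x) t" by (simp add: circ_def)
  then show ?thesis using t by auto
qed (auto simp: circ_def intro!: bexI[of _ 0])

lemma inner_dir_nor: "(x \<bullet> dir t)\<^sup>2 + (x \<bullet> nor t)\<^sup>2 = (norm x)\<^sup>2"
proof -
  have "(x \<bullet> dir t)\<^sup>2 + (x \<bullet> nor t)\<^sup>2 = ((x$1)\<^sup>2 + (x$2)\<^sup>2) * ((cos t)\<^sup>2 + (sin t)\<^sup>2)"
    unfolding inner_R2 dir_component by algebra
  then show ?thesis by (simp add: norm_R2)
qed

lemma cross2_dir_nor: "(x \<bullet> dir t) * (y \<bullet> nor t) - (x \<bullet> nor t) * (y \<bullet> dir t) = cross2 x y"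
proof -
  have "(x \<bullet> dir t) * (y \<bullet> nor t) - (x \<bullet> nor t) * (y \<bullet> dir t) = cross2 x y * ((cos t)\<^sup>2 + (sin t)\<^sup>2)"
    unfolding inner_R2 cross2_def dir_component by algebra
  then show ?thesis by simp
qed

text \<open>The gradient is a separate function, so that a row of a Hessian, or a difference
  quotient of such rows, can serve as the gradient of a component of \<open>Du\<close> or of its
  difference quotient.\<close>

definition C1_grad :: "(real^2 \<Rightarrow> real) \<Rightarrow> (real^2 \<Rightarrow> real^2) \<Rightarrow> (real^2) set \<Rightarrow> bool" where
  "C1_grad a ga \<Omega> \<longleftrightarrow> continuous_on \<Omega> ga \<and> (\<forall>x\<in>\<Omega>. (a has_derivative (\<lambda>h. ga x \<bullet> h)) (at x))"

lemma C1_grad_continuous: "C1_grad a ga \<Omega> \<Longrightarrow> continuous_on \<Omega> a"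
  unfolding C1_grad_def by (meson continuous_at_imp_continuous_on has_derivative_continuous)

lemma C1_grad_subset: "C1_grad a ga \<Omega> \<Longrightarrow> S \<subseteq> \<Omega> \<Longrightarrow> C1_grad a ga S"
  unfolding C1_grad_def using continuous_on_subset by blast

lemma C1_grad_minus: "C1_grad a ga \<Omega> \<Longrightarrow> C1_grad (\<lambda>x. - a x) (\<lambda>x. - ga x) \<Omega>"
  unfolding C1_grad_def by (auto intro!: continuous_intros derivative_eq_intros)

lemma has_real_derivative_along:
  assumes "(a has_derivative (\<lambda>h. g \<bullet> h)) (at (\<gamma> s))" "(\<gamma> has_vector_derivative v) (at s)"
  shows "((\<lambda>s. a (\<gamma> s)) has_real_derivative g \<bullet> v) (at s)"
proof -
  have "((\<lambda>s. a (\<gamma> s)) has_derivative (\<lambda>h. g \<bullet> (h *\<^sub>R v))) (at s)"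
    using assms(2) unfolding has_vector_derivative_def
    by (rule has_derivative_compose[of \<gamma> _ s UNIV a "\<lambda>h. g \<bullet> h"]) (rule assms(1))
  then show ?thesis by (simp add: has_field_derivative_def mult_commute_abs )
qed

lemma has_vector_derivative_dir: "(dir has_vector_derivative nor t) (at t)"
  unfolding dir_altdef[abs_def] nor_altdef
  by (auto intro!: derivative_eq_intros simp: has_real_derivative_iff_has_vector_derivative[symmetric])

lemma has_vector_derivative_circ:
  "((\<lambda>r. circ c r t) has_vector_derivative dir t) (at r)"
  "(circ c r has_vector_derivative r *\<^sub>R nor t) (at t)"
proof -
  show "((\<lambda>r. circ c r t) has_vector_derivative dir t) (at r)"
    unfolding circ_def by (auto intro!: derivative_eq_intros)
  show "(circ c r has_vector_derivative r *\<^sub>R nor t) (at t)"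
    unfolding circ_def[abs_def] 
    using has_vector_derivative_add[OF has_vector_derivative_const
        bounded_linear.has_vector_derivative[OF bounded_linear_scaleR_right has_vector_derivative_dir]]
    by simp
qed

text \<open>The measure is dt, not arc length. At \<open>r = 0\<close> the integral is
  \<open>2 * pi\<close> times the value at the centre, which is how the interior estimate reaches
  that value.\<close>

definition circ_int :: "real^2 \<Rightarrow> real \<Rightarrow> (real^2 \<Rightarrow> real) \<Rightarrow> real" where
  "circ_int c r g = integral {0..2*pi} (\<lambda>t. g (circ c r t))"

definition circ_energy :: "(real^2 \<Rightarrow> real^2) \<Rightarrow> (real^2 \<Rightarrow> real^2) \<Rightarrow> real^2 \<Rightarrow> real \<Rightarrow> real" where
  "circ_energy ga gb c r = circ_int c r (\<lambda>x. (norm (ga x))\<^sup>2 + (norm (gb x))\<^sup>2)"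

text \<open>The second factor is the angular derivative of \<open>b\<close>, so this is the line
  integral of a db over the circle. It vanishes at \<open>r = 0\<close>.\<close>

definition wedge_int :: "(real^2 \<Rightarrow> real) \<Rightarrow> (real^2 \<Rightarrow> real^2) \<Rightarrow> real^2 \<Rightarrow> real \<Rightarrow> real" where
  "wedge_int a gb c r = integral {0..2*pi} (\<lambda>t. a (circ c r t) * (r * (gb (circ c r t) \<bullet> nor t)))"

lemma continuous_on_circ_comp:
  "continuous_on \<Omega> g \<Longrightarrow> (\<And>t. circ c r t \<in> \<Omega>) \<Longrightarrow> continuous_on S (\<lambda>t. g (circ c r t))"
  by (rule continuous_on_compose2[of \<Omega> g]) (auto intro!: continuous_intros)

lemma circ_int_mono:
  assumes "continuous_on \<Omega> g" "continuous_on \<Omega> h" "\<And>t. circ c r t \<in> \<Omega>" "\<And>x. x \<in> \<Omega> \<Longrightarrow> dist c x = \<bar>r\<bar> \<Longrightarrow> g x \<le> h x"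
  shows "circ_int c r g \<le> circ_int c r h"
  unfolding circ_int_def using assms
  by (intro integral_le integrable_continuous_real continuous_on_circ_comp) auto

text \<open>In the exterior estimates \<open>lo\<close> is nonnegative. In the interior ones it is
  negative, which makes radius 0 an interior point of the range, so that derivatives in
  \<open>r\<close> are available at the centre too.\<close>

locale C1_pair_on_circles =
  fixes c :: "real^2" and lo hi :: real and \<Omega> :: "(real^2) set"
    and a b :: "real^2 \<Rightarrow> real" and ga gb :: "real^2 \<Rightarrow> real^2"
  assumes a: "C1_grad a ga \<Omega>" and b: "C1_grad b gb \<Omega>"
    and circ_in: "\<And>r t. r \<in> {lo<..<hi} \<Longrightarrow> circ c r t \<in> \<Omega>"
begin

lemma der_r:
  assumes "r \<in> {lo<..<hi}"
  shows "((\<lambda>r. a (circ c r t)) has_real_derivative ga (circ c r t) \<bullet> dir t) (at r)"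
    and "((\<lambda>r. b (circ c r t)) has_real_derivative gb (circ c r t) \<bullet> dir t) (at r)"
  using a b circ_in[OF assms] has_vector_derivative_circ
  by (auto simp: C1_grad_def intro!: has_real_derivative_along)

lemma der_t:
  assumes "r \<in> {lo<..<hi}"
  shows "((\<lambda>t. a (circ c r t)) has_real_derivative r * (ga (circ c r t) \<bullet> nor t)) (at t)"
    and "((\<lambda>t. b (circ c r t)) has_real_derivative r * (gb (circ c r t) \<bullet> nor t)) (at t)"
  using has_real_derivative_along[OF _ has_vector_derivative_circ(2), of a _ c r t]
    has_real_derivative_along[OF _ has_vector_derivative_circ(2), of b _ c r t] a b circ_in[OF assms]
  by (auto simp: C1_grad_def)

lemma cont: "continuous_on \<Omega> a" "continuous_on \<Omega> b" "continuous_on \<Omega> ga" "continuous_on \<Omega> gb"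
  using a b C1_grad_continuous C1_grad_def by auto

lemma cont2:
  "continuous_on ({lo<..<hi} \<times> T) (\<lambda>x. ga (circ c (fst x) (snd x)))"
  "continuous_on ({lo<..<hi} \<times> T) (\<lambda>x. gb (circ c (fst x) (snd x)))"
  by (rule continuous_on_compose2[OF cont(3)] continuous_on_compose2[OF cont(4)];
      use circ_in in \<open>force intro!: continuous_intros\<close>)+

text \<open>Green's formula in differentiated form: \<open>dir t\<close> and \<open>nor t\<close>
  form a positively oriented orthonormal frame, so the radial and angular derivatives combine to
  \<open>r\<close> times the Jacobian.\<close>

lemma wedge_int_deriv:
  assumes "r \<in> {lo<..<hi}"
  shows "(wedge_int a gb c has_real_derivative r * circ_int c r (\<lambda>x. cross2 (ga x) (gb x))) (at r)"
proof -
  have "((\<lambda>s. integral {0..2*pi} (\<lambda>t. a (circ c s t) * (s * (gb (circ c s t) \<bullet> nor t)))) has_real_derivative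
      integral {0..2*pi} (\<lambda>t. (ga (circ c r t) \<bullet> dir t) * (r * (gb (circ c r t) \<bullet> nor t))
         - (r * (ga (circ c r t) \<bullet> nor t)) * (gb (circ c r t) \<bullet> dir t))) (at r)"
  proof (rule deriv_integral_wedge[OF assms, where Q = "\<lambda>s t. b (circ c s t)" and P = "\<lambda>s t. a (circ c s t)"])
    show "continuous_on ({lo<..<hi} \<times> {0..2*pi}) (\<lambda>(s, t). ga (circ c s t) \<bullet> dir t)"
      "continuous_on ({lo<..<hi} \<times> {0..2*pi}) (\<lambda>(s, t). gb (circ c s t) \<bullet> dir t)"
      "continuous_on ({lo<..<hi} \<times> {0..2*pi}) (\<lambda>(s, t). s * (ga (circ c s t) \<bullet> nor t))"
      "continuous_on ({lo<..<hi} \<times> {0..2*pi}) (\<lambda>(s, t). s * (gb (circ c s t) \<bullet> nor t))"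
      unfolding case_prod_unfold by (intro continuous_intros cont2)+
  qed (use der_r der_t circ_periodic[of c] in auto)
  also have "(\<lambda>t. (ga (circ c r t) \<bullet> dir t) * (r * (gb (circ c r t) \<bullet> nor t))
         - (r * (ga (circ c r t) \<bullet> nor t)) * (gb (circ c r t) \<bullet> dir t))
     = (\<lambda>t. r * cross2 (ga (circ c r t)) (gb (circ c r t)))"
  proof
    fix t
    show "(ga (circ c r t) \<bullet> dir t) * (r * (gb (circ c r t) \<bullet> nor t))
         - (r * (ga (circ c r t) \<bullet> nor t)) * (gb (circ c r t) \<bullet> dir t) = r * cross2 (ga (circ c r t)) (gb (circ c r t))"
      unfolding cross2_dir_nor[of "ga (circ c r t)" t "gb (circ c r t)", symmetric] by algebra
  qed
  finally show ?thesis
    by (simp add: wedge_int_def[abs_def] circ_int_def)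
qed

lemma mean_deriv:
  assumes r: "r \<in> {lo<..<hi}"
  shows "((\<lambda>r. circ_int c r a) has_real_derivative integral {0..2*pi} (\<lambda>t. ga (circ c r t) \<bullet> dir t)) (at r)"
proof -
  have "((\<lambda>r. integral (cbox 0 (2*pi)) (\<lambda>t. a (circ c r t))) has_real_derivative
     integral (cbox 0 (2*pi)) (\<lambda>t. ga (circ c r t) \<bullet> dir t)) (at r within {lo<..<hi})"
  proof (rule leibniz_rule_field_derivative)
    show "((\<lambda>r. a (circ c r t)) has_real_derivative ga (circ c r t) \<bullet> dir t) (at r within {lo<..<hi})"
      if "r \<in> {lo<..<hi}" for r t
      by (rule has_field_derivative_at_within[OF der_r(1)[OF that]])
    show "(\<lambda>t. a (circ c r t)) integrable_on cbox 0 (2*pi)" if "r \<in> {lo<..<hi}" for r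
      unfolding cbox_interval
      by (intro integrable_continuous_real continuous_on_circ_comp[OF cont(1)] circ_in that)
    show "continuous_on ({lo<..<hi} \<times> cbox 0 (2*pi)) (\<lambda>(r, t). ga (circ c r t) \<bullet> dir t)"
      unfolding case_prod_unfold by (intro continuous_intros cont2)
  qed (use r in auto)
  then show ?thesis using r by (simp add: circ_int_def at_within_open[of r "{lo<..<hi}"])
qed

lemma circle_estimates:
  assumes r: "r \<in> {lo<..<hi}"
  shows mean_deriv_le: "(integral {0..2*pi} (\<lambda>t. ga (circ c r t) \<bullet> dir t))\<^sup>2 \<le> 2 * pi * circ_energy ga gb c r"
    and length_le: "(integral {0..2*pi} (\<lambda>t. \<bar>r * (ga (circ c r t) \<bullet> nor t)\<bar>))\<^sup>2 
        + (integral {0..2*pi} (\<lambda>t. \<bar>r * (gb (circ c r t) \<bullet> nor t)\<bar>))\<^sup>2 \<le> 2 * pi * (r\<^sup>2 * circ_energy ga gb c r)"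
    and tangential_le: "integral {0..2*pi} (\<lambda>t. (r * (gb (circ c r t) \<bullet> nor t))\<^sup>2) \<le> r\<^sup>2 * circ_energy ga gb c r"
    and energy_nonneg: "circ_energy ga gb c r \<ge> 0"
proof -
  note [continuous_intros] = continuous_on_circ_comp[OF cont(3) circ_in[OF r]] continuous_on_circ_comp[OF cont(4) circ_in[OF r]]
  have int: "F integrable_on {0..2*pi}" if "continuous_on {0..2*pi} F" for F :: "real \<Rightarrow> real"
    using that by (rule integrable_continuous_real)
  have CS1: "(integral {0..2*pi} F)\<^sup>2 \<le> 2 * pi * integral {0..2*pi} (\<lambda>t. (F t)\<^sup>2)"
    if "continuous_on {0..2*pi} F" for F :: "real \<Rightarrow> real"
    using integral_Cauchy_Schwarz[of 0 "2*pi" "\<lambda>_. 1" F] that by simp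
  have "(integral {0..2*pi} (\<lambda>t. ga (circ c r t) \<bullet> dir t))\<^sup>2
      \<le> 2 * pi * integral {0..2*pi} (\<lambda>t. (ga (circ c r t) \<bullet> dir t)\<^sup>2)"
    by (intro CS1 continuous_intros)
  also have "\<dots> \<le> 2 * pi * circ_energy ga gb c r"
    unfolding circ_energy_def circ_int_def
  proof (intro mult_left_mono integral_le int continuous_intros)
    show "(ga (circ c r t) \<bullet> dir t)\<^sup>2 \<le> (norm (ga (circ c r t)))\<^sup>2 + (norm (gb (circ c r t)))\<^sup>2" for t
      using inner_dir_nor[of "ga (circ c r t)" t] by (smt (verit) zero_le_power2)
  qed auto
  finally show "(integral {0..2*pi} (\<lambda>t. ga (circ c r t) \<bullet> dir t))\<^sup>2 \<le> 2 * pi * circ_energy ga gb c r" .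
  have "(integral {0..2*pi} (\<lambda>t. \<bar>r * (ga (circ c r t) \<bullet> nor t)\<bar>))\<^sup>2 
        + (integral {0..2*pi} (\<lambda>t. \<bar>r * (gb (circ c r t) \<bullet> nor t)\<bar>))\<^sup>2
     \<le> 2 * pi * integral {0..2*pi} (\<lambda>t. (\<bar>r * (ga (circ c r t) \<bullet> nor t)\<bar>)\<^sup>2)
      + 2 * pi * integral {0..2*pi} (\<lambda>t. (\<bar>r * (gb (circ c r t) \<bullet> nor t)\<bar>)\<^sup>2)"
    by (intro CS1 add_mono continuous_intros)
  also have "\<dots> = 2 * pi * integral {0..2*pi} (\<lambda>t. (r * (ga (circ c r t) \<bullet> nor t))\<^sup>2 + (r * (gb (circ c r t) \<bullet> nor t))\<^sup>2)"
    by (subst integral_add; (intro int continuous_intros)?) (simp_all add: algebra_simps)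
  also have "integral {0..2*pi} (\<lambda>t. (r * (ga (circ c r t) \<bullet> nor t))\<^sup>2 + (r * (gb (circ c r t) \<bullet> nor t))\<^sup>2)
      \<le> integral {0..2*pi} (\<lambda>t. r\<^sup>2 * ((norm (ga (circ c r t)))\<^sup>2 + (norm (gb (circ c r t)))\<^sup>2))"
  proof (intro integral_le int continuous_intros)
    fix t
    have "(ga (circ c r t) \<bullet> nor t)\<^sup>2 \<le> (norm (ga (circ c r t)))\<^sup>2" "(gb (circ c r t) \<bullet> nor t)\<^sup>2 \<le> (norm (gb (circ c r t)))\<^sup>2"
      using inner_dir_nor[of "ga (circ c r t)" t] inner_dir_nor[of "gb (circ c r t)" t] by (smt (verit) zero_le_power2)+
    then show "(r * (ga (circ c r t) \<bullet> nor t))\<^sup>2 + (r * (gb (circ c r t) \<bullet> nor t))\<^sup>2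
       \<le> r\<^sup>2 * ((norm (ga (circ c r t)))\<^sup>2 + (norm (gb (circ c r t)))\<^sup>2)"
      by (simp add: power_mult_distrib mult_left_mono flip: distrib_left)
  qed
  finally show "(integral {0..2*pi} (\<lambda>t. \<bar>r * (ga (circ c r t) \<bullet> nor t)\<bar>))\<^sup>2 
        + (integral {0..2*pi} (\<lambda>t. \<bar>r * (gb (circ c r t) \<bullet> nor t)\<bar>))\<^sup>2 \<le> 2 * pi * (r\<^sup>2 * circ_energy ga gb c r)"
    by (simp add: circ_energy_def circ_int_def)
  have "integral {0..2*pi} (\<lambda>t. (r * (gb (circ c r t) \<bullet> nor t))\<^sup>2)
      \<le> integral {0..2*pi} (\<lambda>t. r\<^sup>2 * ((norm (ga (circ c r t)))\<^sup>2 + (norm (gb (circ c r t)))\<^sup>2))"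
  proof (intro integral_le int continuous_intros)
    fix t
    have "(gb (circ c r t) \<bullet> nor t)\<^sup>2 \<le> (norm (ga (circ c r t)))\<^sup>2 + (norm (gb (circ c r t)))\<^sup>2"
      using inner_dir_nor[of "gb (circ c r t)" t] by (smt (verit) zero_le_power2)
    then show "(r * (gb (circ c r t) \<bullet> nor t))\<^sup>2
       \<le> r\<^sup>2 * ((norm (ga (circ c r t)))\<^sup>2 + (norm (gb (circ c r t)))\<^sup>2)"
      by (simp add: power_mult_distrib mult_left_mono)
  qed
  then show "integral {0..2*pi} (\<lambda>t. (r * (gb (circ c r t) \<bullet> nor t))\<^sup>2) \<le> r\<^sup>2 * circ_energy ga gb c r"
    by (simp add: circ_energy_def circ_int_def)
  show "circ_energy ga gb c r \<ge> 0"
    unfolding circ_energy_def circ_int_def by (intro integral_nonneg int continuous_intros) simp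
qed

text \<open>Cauchy-Schwarz. For a quasiregular pair with bounded \<open>a\<close> it makes the
  square of the wedge integral at most a multiple of its derivative, up to sign, and such an
  inequality forces blow-up at a finite radius. \<open>wedge_int_le\<close> is the linear
  counterpart.\<close>

lemma wedge_int_sq_le:
  assumes r: "r \<in> {lo<..<hi}"
  shows "(wedge_int a gb c r)\<^sup>2 \<le> circ_int c r (\<lambda>x. (a x)\<^sup>2) * (r\<^sup>2 * circ_energy ga gb c r)"
proof -
  note [continuous_intros] = continuous_on_circ_comp[OF cont(1) circ_in[OF r]] continuous_on_circ_comp[OF cont(4) circ_in[OF r]]
  have "(wedge_int a gb c r)\<^sup>2 \<le> circ_int c r (\<lambda>x. (a x)\<^sup>2) * integral {0..2*pi} (\<lambda>t. (r * (gb (circ c r t) \<bullet> nor t))\<^sup>2)"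
    unfolding wedge_int_def circ_int_def by (intro integral_Cauchy_Schwarz continuous_intros)
  also have "\<dots> \<le> circ_int c r (\<lambda>x. (a x)\<^sup>2) * (r\<^sup>2 * circ_energy ga gb c r)"
    unfolding circ_int_def
    by (intro mult_left_mono tangential_le r integral_nonneg integrable_continuous_real continuous_intros) simp
  finally show ?thesis .
qed

lemma osc_le:
  assumes r: "r \<in> {lo<..<hi}" and t: "t \<in> {0..2*pi}" "t' \<in> {0..2*pi}"
  shows "\<bar>a (circ c r t) - a (circ c r t')\<bar> \<le> integral {0..2*pi} (\<lambda>t. \<bar>r * (ga (circ c r t) \<bullet> nor t)\<bar>)"
  using t
proof (induction t t' rule: linorder_wlog)
  case (le t t')
  note [continuous_intros] = continuous_on_circ_comp[OF cont(3) circ_in[OF r]]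
  have "((\<lambda>t. r * (ga (circ c r t) \<bullet> nor t)) has_integral (a (circ c r t') - a (circ c r t))) {t..t'}"
  proof (rule fundamental_theorem_of_calculus[OF le(1)])
    fix s
    show "((\<lambda>t. a (circ c r t)) has_vector_derivative r * (ga (circ c r s) \<bullet> nor s)) (at s within {t..t'})"
      by (rule has_vector_derivative_at_within[OF der_t(1)[OF r, unfolded has_real_derivative_iff_has_vector_derivative]])
  qed
  then have "\<bar>a (circ c r t) - a (circ c r t')\<bar> = norm (integral {t..t'} (\<lambda>t. r * (ga (circ c r t) \<bullet> nor t)))"
    by (simp only: integral_unique real_norm_def abs_minus_commute)
  also have "\<dots> \<le> integral {t..t'} (\<lambda>t. \<bar>r * (ga (circ c r t) \<bullet> nor t)\<bar>)"
    by (intro integral_norm_bound_integral integrable_continuous_real continuous_intros) auto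
  also have "\<dots> \<le> integral {0..2*pi} (\<lambda>t. \<bar>r * (ga (circ c r t) \<bullet> nor t)\<bar>)"
    using le by (intro integral_subset_le integrable_continuous_real continuous_intros) auto
  finally show ?case .
next
  case (sym t t')
  then show ?case by (simp add: abs_minus_commute)
qed

text \<open>The Courant-Lebesgue idea: on a circle of small energy \<open>a\<close> stays close to
  its mean, so a supremum bound needs only the mean and one good circle.\<close>

lemma sup_le_mean:
  assumes r: "r \<in> {lo<..<hi}" and t: "t \<in> {0..2*pi}"
  shows "\<bar>a (circ c r t)\<bar> \<le> \<bar>circ_int c r a\<bar> / (2*pi) + sqrt (2 * pi * (r\<^sup>2 * circ_energy ga gb c r))"
proof -
  define L where "L = integral {0..2*pi} (\<lambda>t. \<bar>r * (ga (circ c r t) \<bullet> nor t)\<bar>)"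
  have "L\<^sup>2 \<le> 2 * pi * (r\<^sup>2 * circ_energy ga gb c r)"
    using length_le[OF r] unfolding L_def by (smt (verit) zero_le_power2)
  then have L: "L \<le> sqrt (2 * pi * (r\<^sup>2 * circ_energy ga gb c r))" by (rule real_le_rsqrt)
  note [continuous_intros] = continuous_on_circ_comp[OF cont(1) circ_in[OF r]]
  have "\<bar>2 * pi * a (circ c r t) - circ_int c r a\<bar> = norm (integral {0..2*pi} (\<lambda>s. a (circ c r t) - a (circ c r s)))"
    unfolding circ_int_def
    by (subst integral_diff; (intro integrable_continuous_real continuous_intros)?) simp
  also have "\<dots> \<le> integral {0..2*pi} (\<lambda>s. L)"
    using osc_le[OF r t] unfolding L_def
    by (intro integral_norm_bound_integral integrable_continuous_real continuous_intros) auto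
  finally have "\<bar>2 * pi * a (circ c r t) - circ_int c r a\<bar> \<le> 2 * pi * L" by simp
  then have "2 * pi * \<bar>a (circ c r t)\<bar> \<le> \<bar>circ_int c r a\<bar> + 2 * pi * L"
    using abs_mult[of "2*pi" "a (circ c r t)"] by auto
  then have "\<bar>a (circ c r t)\<bar> \<le> (\<bar>circ_int c r a\<bar> + 2 * pi * L) / (2 * pi)"
    by (simp add: pos_le_divide_eq mult.commute)
  also have "\<dots> = \<bar>circ_int c r a\<bar> / (2*pi) + L" by (simp add: add_divide_distrib)
  finally show ?thesis using L by simp
qed

text \<open>An isoperimetric inequality for the image curve. The integral of db over a closed curve
  is 0, so \<open>a\<close> may be replaced by its deviation from one of its values, which the
  length integral \<open>A\<close> bounds. The constant \<open>pi\<close> is not sharp.\<close>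

lemma wedge_int_le:
  assumes r: "r \<in> {lo<..<hi}"
  shows "\<bar>wedge_int a gb c r\<bar> \<le> pi * (r\<^sup>2 * circ_energy ga gb c r)"
proof -
  define A B where "A = integral {0..2*pi} (\<lambda>t. \<bar>r * (ga (circ c r t) \<bullet> nor t)\<bar>)"
    and "B = integral {0..2*pi} (\<lambda>t. \<bar>r * (gb (circ c r t) \<bullet> nor t)\<bar>)"
  note [continuous_intros] = continuous_on_circ_comp[OF cont(1) circ_in[OF r]]
    continuous_on_circ_comp[OF cont(3) circ_in[OF r]] continuous_on_circ_comp[OF cont(4) circ_in[OF r]]
  have "((\<lambda>t. r * (gb (circ c r t) \<bullet> nor t)) has_integral (b (circ c r (2*pi)) - b (circ c r 0))) {0..2*pi}"
  proof (rule fundamental_theorem_of_calculus)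
    fix s
    show "((\<lambda>t. b (circ c r t)) has_vector_derivative r * (gb (circ c r s) \<bullet> nor s)) (at s within {0..2*pi})"
      by (rule has_vector_derivative_at_within[OF der_t(2)[OF r, unfolded has_real_derivative_iff_has_vector_derivative]])
  qed simp
  then have 0: "integral {0..2*pi} (\<lambda>t. r * (gb (circ c r t) \<bullet> nor t)) = 0"
    unfolding circ_periodic[of c r] by (metis diff_self integral_unique)
  have "integral {0..2*pi} (\<lambda>t. (a (circ c r t) - a (circ c r 0)) * (r * (gb (circ c r t) \<bullet> nor t)))
     = wedge_int a gb c r - a (circ c r 0) * integral {0..2*pi} (\<lambda>t. r * (gb (circ c r t) \<bullet> nor t))"
    unfolding wedge_int_def left_diff_distrib
    by (subst integral_diff; (intro integrable_continuous_real continuous_intros)?) simp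
  then have "\<bar>wedge_int a gb c r\<bar> = norm (integral {0..2*pi} (\<lambda>t. (a (circ c r t) - a (circ c r 0)) * (r * (gb (circ c r t) \<bullet> nor t))))"
    by (simp only: 0) simp
  also have "\<dots> \<le> integral {0..2*pi} (\<lambda>t. A * \<bar>r * (gb (circ c r t) \<bullet> nor t)\<bar>)"
    using osc_le[OF r, of _ 0] unfolding A_def abs_mult
    by (intro integral_norm_bound_integral integrable_continuous_real continuous_intros)
       (auto simp: abs_mult intro!: mult_right_mono)
  also have "\<dots> = A * B" by (simp add: B_def)
  also have "\<dots> \<le> (A\<^sup>2 + B\<^sup>2) / 2" using sum_squares_bound[of A B] by simp
  also have "\<dots> \<le> (2 * pi * (r\<^sup>2 * circ_energy ga gb c r)) / 2"
    using length_le[OF r] unfolding A_def B_def by (intro divide_right_mono) auto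
  finally show ?thesis by simp
qed

end

section \<open>The shape operator of a graph\<close>

text \<open>For a graph with gradient \<open>p\<close> and Hessian \<open>M\<close>, these are the entries of the shape operator in the
  orthonormal frame that Gram-Schmidt produces from the coordinate frame of the tangent plane.\<close>

definition shape11 :: "real^2 \<Rightarrow> real^2^2 \<Rightarrow> real" where
  "shape11 p M = inverse (1 + (p$1)\<^sup>2) * inverse (sqrt (1 + (norm p)\<^sup>2)) * M$1$1"

definition shape12 :: "real^2 \<Rightarrow> real^2^2 \<Rightarrow> real" where
  "shape12 p M = inverse (1 + (norm p)\<^sup>2) * M$1$2
     - p$1 * p$2 * inverse (1 + (p$1)\<^sup>2) * inverse (1 + (norm p)\<^sup>2) * M$1$1"

definition shape22 :: "real^2 \<Rightarrow> real^2^2 \<Rightarrow> real" where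
  "shape22 p M = (p$1 * p$2) * (p$1 * p$2) * inverse (1 + (p$1)\<^sup>2) * inverse (1 + (norm p)\<^sup>2) * inverse (sqrt (1 + (norm p)\<^sup>2)) * M$1$1
     - 2 * (p$1 * p$2) * inverse (1 + (norm p)\<^sup>2) * inverse (sqrt (1 + (norm p)\<^sup>2)) * M$1$2
     + (1 + (p$1)\<^sup>2) * inverse (1 + (norm p)\<^sup>2) * inverse (sqrt (1 + (norm p)\<^sup>2)) * M$2$2"

text \<open>With \<open>\<kappa>\<^sub>1 \<ge> \<kappa>\<^sub>2\<close> the principal curvatures, \<open>shape_trace = \<kappa>\<^sub>1 + \<kappa>\<^sub>2\<close> and \<open>cmod shape_dev = \<kappa>\<^sub>1 - \<kappa>\<^sub>2\<close>.\<close>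

definition shape_trace :: "real^2 \<Rightarrow> real^2^2 \<Rightarrow> real" where
  "shape_trace p M = shape11 p M + shape22 p M"

definition shape_dev :: "real^2 \<Rightarrow> real^2^2 \<Rightarrow> complex" where
  "shape_dev p M = Complex (shape11 p M - shape22 p M) (2 * shape12 p M)"

lemma shape_trace_eq:
  "shape_trace p M * ((1 + (norm p)\<^sup>2) * sqrt (1 + (norm p)\<^sup>2))
     = (1 + (p$2)\<^sup>2) * M$1$1 - 2 * p$1 * p$2 * M$1$2 + (1 + (p$1)\<^sup>2) * M$2$2"
proof -
  \<comment> \<open>The square root and the inverses enter only through \<open>w * w\<close>,
    \<open>w * inverse w = 1\<close> and \<open>s * inverse s = 1\<close>, so that
    \<open>algebra\<close> can decide the identity over these polynomial relations.\<close>
  define w s where "w = sqrt (1 + (norm p)\<^sup>2)" and "s = 1 + (p$1)\<^sup>2"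
  have "w > 0" by (simp add: w_def add_pos_nonneg)
  then have w: "w * inverse w = 1" "1 + (norm p)\<^sup>2 = w * w"
    by (simp_all add: w_def)
  have "s > 0" by (simp add: s_def add_pos_nonneg)
  then have s: "s * inverse s = 1" by simp
  have p: "w * w = 1 + p$1 * p$1 + p$2 * p$2" "s = 1 + p$1 * p$1"
    by (simp_all add: s_def w(2)[symmetric] norm_R2) (simp_all add: power2_eq_square)
  show ?thesis
    unfolding shape_trace_def shape11_def shape22_def
    unfolding w_def[symmetric] s_def[symmetric] unfolding w(2) inverse_mult_distrib
    using w(1) s p unfolding power2_eq_square by algebra
qed

text \<open>A symmetric 2 by 2 matrix satisfies trace^2 - (difference of eigenvalues)^2 = 4 det.
  This is the bridge from a bound of the trace by the deviation to the sign of a Jacobian.\<close>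

lemma shape_det_eq:
  assumes "M$2$1 = M$1$2"
  shows "(shape_trace p M)\<^sup>2 - (cmod (shape_dev p M))\<^sup>2 = 4 * det M / (1 + (norm p)\<^sup>2)\<^sup>2"
proof -
  define w s where "w = sqrt (1 + (norm p)\<^sup>2)" and "s = 1 + (p$1)\<^sup>2"
  have "w > 0" by (simp add: w_def add_pos_nonneg)
  then have w: "w * inverse w = 1" "1 + (norm p)\<^sup>2 = w * w"
    by (simp_all add: w_def)
  have "s > 0" by (simp add: s_def add_pos_nonneg)
  then have s: "s * inverse s = 1" by simp
  have "(shape_trace p M)\<^sup>2 - (cmod (shape_dev p M))\<^sup>2 = 4 * (shape11 p M * shape22 p M - (shape12 p M)\<^sup>2)"
    unfolding shape_trace_def shape_dev_def cmod_power2 by (simp add: power2_eq_square algebra_simps)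
  also have "shape11 p M * shape22 p M - (shape12 p M)\<^sup>2 = det M / (1 + (norm p)\<^sup>2)\<^sup>2"
    unfolding shape11_def shape22_def shape12_def
    unfolding w_def[symmetric] s_def[symmetric] det_2 assms unfolding w(2) divide_inverse unfolding power2_eq_square inverse_mult_distrib
    using w(1) s by algebra
  finally show ?thesis by simp
qed

lemma shape_0: "shape_trace 0 M = M$1$1 + M$2$2" "shape_dev 0 M = Complex (M$1$1 - M$2$2) (2 * M$1$2)"
  by (simp_all add: shape_trace_def shape_dev_def shape11_def shape12_def shape22_def)

lemma shape_diff: "shape_trace p (M - N) = shape_trace p M - shape_trace p N"
   "shape_dev p (M - N) = shape_dev p M - shape_dev p N"
  by (simp_all add: shape_trace_def shape_dev_def shape11_def shape12_def shape22_def complex_eq_iff algebra_simps)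

lemma shape_add: "shape_trace p (M + N) = shape_trace p M + shape_trace p N"
   "shape_dev p (M + N) = shape_dev p M + shape_dev p N"
  by (simp_all add: shape_trace_def shape_dev_def shape11_def shape12_def shape22_def complex_eq_iff algebra_simps)

section \<open>Dependence of the shape operator on the gradient\<close>

lemma norm_R22: "(norm M)\<^sup>2 = (M$1$1)\<^sup>2 + (M$1$2)\<^sup>2 + (M$2$1)\<^sup>2 + (M$2$2)\<^sup>2" for M :: "real^2^2"
proof -
  have "(norm M)\<^sup>2 = (norm (M$1))\<^sup>2 + (norm (M$2))\<^sup>2"
    by (simp add: power2_norm_eq_inner inner_vec_def sum_2)
  then show ?thesis by (simp add: norm_R2)
qed

lemma entry_le_norm: "\<bar>M$i$j\<bar> \<le> norm M" for M :: "real^2^2"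
  using component_le_norm_cart[of "M$i" j] Finite_Cartesian_Product.norm_nth_le[of M i] by linarith

text \<open>The coefficients are even in \<open>p\<close>, hence the factor \<open>norm p + norm q\<close>. It makes the dependence on
  the gradient a term of higher order where gradients are small.\<close>

definition quad_lip :: "real \<Rightarrow> (real^2 \<Rightarrow> real) \<Rightarrow> bool" where
  "quad_lip P c \<longleftrightarrow> (\<exists>C\<ge>0. \<forall>p q. norm p \<le> P \<longrightarrow> norm q \<le> P \<longrightarrow>
     \<bar>c p\<bar> \<le> C \<and> \<bar>c p - c q\<bar> \<le> C * ((norm p + norm q) * norm (p - q)))"

lemma quad_lipI:
  assumes "\<And>p. norm p \<le> P \<Longrightarrow> \<bar>c p\<bar> \<le> B"
    "\<And>p q. norm p \<le> P \<Longrightarrow> norm q \<le> P \<Longrightarrow> \<bar>c p - c q\<bar> \<le> C * ((norm p + norm q) * norm (p - q))"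
  shows "quad_lip P c"
  unfolding quad_lip_def
proof (intro exI[of _ "max 0 (max B C)"] conjI allI impI)
  fix p q :: "real^2" assume pq: "norm p \<le> P" "norm q \<le> P"
  show "\<bar>c p\<bar> \<le> max 0 (max B C)" using assms(1)[OF pq(1)] by simp
  have "C * ((norm p + norm q) * norm (p - q)) \<le> max 0 (max B C) * ((norm p + norm q) * norm (p - q))"
    by (intro mult_right_mono) auto
  then show "\<bar>c p - c q\<bar> \<le> max 0 (max B C) * ((norm p + norm q) * norm (p - q))"
    using assms(2)[OF pq] by linarith
qed simp

lemma quad_lipE:
  assumes "quad_lip P c"
  obtains C where "C \<ge> 0" "\<And>p. norm p \<le> P \<Longrightarrow> \<bar>c p\<bar> \<le> C"
    "\<And>p q. norm p \<le> P \<Longrightarrow> norm q \<le> P \<Longrightarrow> \<bar>c p - c q\<bar> \<le> C * ((norm p + norm q) * norm (p - q))"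
  using assms unfolding quad_lip_def by blast

lemma quad_lip_const: "quad_lip P (\<lambda>_. a)"
  by (rule quad_lipI[of _ _ "\<bar>a\<bar>" 0]) auto

text \<open>The degree two provides the factor \<open>norm p + norm q\<close>; a single coordinate
  would not have it near 0. All coefficients arise from these monomials and constants by sums,
  products, inverses and roots.\<close>

lemma quad_lip_monomial: "quad_lip P (\<lambda>p. p$i * p$j)"
proof (rule quad_lipI[of _ _ "P * P" 1])
  fix p q :: "real^2"
  have le: "\<bar>x$i\<bar> \<le> norm x" for x :: "real^2" and i by (rule component_le_norm_cart)
  show "\<bar>p$i * p$j\<bar> \<le> P * P" if "norm p \<le> P"
    unfolding abs_mult using le[of p] that order_trans[OF norm_ge_zero that] by (intro mult_mono) (auto intro: order_trans)
  have "p$i * p$j - q$i * q$j = p$i * (p - q)$j + q$j * (p - q)$i" by (simp add: algebra_simps)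
  also have "\<bar>\<dots>\<bar> \<le> norm p * norm (p - q) + norm q * norm (p - q)"
    by (rule order_trans[OF abs_triangle_ineq]) (unfold abs_mult, intro add_mono mult_mono le; simp)
  finally show "\<bar>p$i * p$j - q$i * q$j\<bar> \<le> 1 * ((norm p + norm q) * norm (p - q))" by (simp add: algebra_simps)
qed

lemma quad_lip_add:
  assumes "quad_lip P c" "quad_lip P d" shows "quad_lip P (\<lambda>p. c p + d p)"
proof -
  obtain C where C: "C \<ge> 0" "\<And>p. norm p \<le> P \<Longrightarrow> \<bar>c p\<bar> \<le> C"
    "\<And>p q. norm p \<le> P \<Longrightarrow> norm q \<le> P \<Longrightarrow> \<bar>c p - c q\<bar> \<le> C * ((norm p + norm q) * norm (p - q))"
    using quad_lipE[OF assms(1)] by blast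
  obtain D where D: "D \<ge> 0" "\<And>p. norm p \<le> P \<Longrightarrow> \<bar>d p\<bar> \<le> D"
    "\<And>p q. norm p \<le> P \<Longrightarrow> norm q \<le> P \<Longrightarrow> \<bar>d p - d q\<bar> \<le> D * ((norm p + norm q) * norm (p - q))"
    using quad_lipE[OF assms(2)] by blast
  show ?thesis
  proof (rule quad_lipI[of _ _ "C + D" "C + D"])
    show "\<bar>c p + d p\<bar> \<le> C + D" if "norm p \<le> P" for p using C(2)[OF that] D(2)[OF that] by linarith
    show "\<bar>c p + d p - (c q + d q)\<bar> \<le> (C + D) * ((norm p + norm q) * norm (p - q))"
      if "norm p \<le> P" "norm q \<le> P" for p q
      using C(3)[OF that] D(3)[OF that] unfolding distrib_right[of C D] by linarith
  qed
qed

lemma quad_lip_mult: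
  assumes "quad_lip P c" "quad_lip P d" shows "quad_lip P (\<lambda>p. c p * d p)"
proof -
  obtain C where C: "C \<ge> 0" "\<And>p. norm p \<le> P \<Longrightarrow> \<bar>c p\<bar> \<le> C"
    "\<And>p q. norm p \<le> P \<Longrightarrow> norm q \<le> P \<Longrightarrow> \<bar>c p - c q\<bar> \<le> C * ((norm p + norm q) * norm (p - q))"
    using quad_lipE[OF assms(1)] by blast
  obtain D where D: "D \<ge> 0" "\<And>p. norm p \<le> P \<Longrightarrow> \<bar>d p\<bar> \<le> D"
    "\<And>p q. norm p \<le> P \<Longrightarrow> norm q \<le> P \<Longrightarrow> \<bar>d p - d q\<bar> \<le> D * ((norm p + norm q) * norm (p - q))"
    using quad_lipE[OF assms(2)] by blast
  show ?thesis
  proof (rule quad_lipI[of _ _ "C * D" "2 * C * D"])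
    show "\<bar>c p * d p\<bar> \<le> C * D" if "norm p \<le> P" for p 
      unfolding abs_mult using C D that by (intro mult_mono) auto
    fix p q :: "real^2" assume pq: "norm p \<le> P" "norm q \<le> P"
    have "c p * d p - c q * d q = c p * (d p - d q) + (c p - c q) * d q" by (simp add: algebra_simps)
    also have "\<bar>\<dots>\<bar> \<le> C * (D * ((norm p + norm q) * norm (p - q))) + (C * ((norm p + norm q) * norm (p - q))) * D"
      by (rule order_trans[OF abs_triangle_ineq]) (unfold abs_mult, intro add_mono mult_mono; use C D pq in simp)
    finally show "\<bar>c p * d p - c q * d q\<bar> \<le> 2 * C * D * ((norm p + norm q) * norm (p - q))" by (simp add: algebra_simps)
  qed
qed

lemma quad_lip_inverse:
  assumes "quad_lip P c" "\<And>p. c p \<ge> 1" shows "quad_lip P (\<lambda>p. inverse (c p))"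
proof -
  obtain C where C: "C \<ge> 0" "\<And>p. norm p \<le> P \<Longrightarrow> \<bar>c p\<bar> \<le> C"
    "\<And>p q. norm p \<le> P \<Longrightarrow> norm q \<le> P \<Longrightarrow> \<bar>c p - c q\<bar> \<le> C * ((norm p + norm q) * norm (p - q))"
    using quad_lipE[OF assms(1)] by blast
  show ?thesis
  proof (rule quad_lipI[of _ _ 1 C])
    show "\<bar>inverse (c p)\<bar> \<le> 1" for p 
      using assms(2)[of p] le_imp_inverse_le[of 1 "c p"] by simp
    fix p q :: "real^2" assume pq: "norm p \<le> P" "norm q \<le> P"
    have c: "c p \<ge> 1" "c q \<ge> 1" using assms(2) by auto
    then have "c p * c q \<ge> 1 * 1" by (intro mult_mono) auto
    have "\<bar>inverse (c p) - inverse (c q)\<bar> = \<bar>c p - c q\<bar> / (c p * c q)"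
    proof -
      have "inverse (c p) - inverse (c q) = (c q - c p) / (c p * c q)" using c by (simp add: diff_frac_eq inverse_eq_divide)
      then show ?thesis using c by (simp add: abs_minus_commute)
    qed
    also have "\<dots> \<le> \<bar>c p - c q\<bar> / 1" using \<open>c p * c q \<ge> 1 * 1\<close> by (intro divide_left_mono) auto
    finally show "\<bar>inverse (c p) - inverse (c q)\<bar> \<le> C * ((norm p + norm q) * norm (p - q))"
      using C(3)[OF pq] by simp
  qed
qed

lemma quad_lip_sqrt:
  assumes "quad_lip P c" "\<And>p. c p \<ge> 1" shows "quad_lip P (\<lambda>p. sqrt (c p))"
proof -
  obtain C where C: "C \<ge> 0" "\<And>p. norm p \<le> P \<Longrightarrow> \<bar>c p\<bar> \<le> C"
    "\<And>p q. norm p \<le> P \<Longrightarrow> norm q \<le> P \<Longrightarrow> \<bar>c p - c q\<bar> \<le> C * ((norm p + norm q) * norm (p - q))"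
    using quad_lipE[OF assms(1)] by blast
  show ?thesis
  proof (rule quad_lipI[of _ _ "sqrt C" C])
    show "\<bar>sqrt (c p)\<bar> \<le> sqrt C" if "norm p \<le> P" for p using C(2)[OF that] assms(2)[of p] by simp
    fix p q :: "real^2" assume pq: "norm p \<le> P" "norm q \<le> P"
    have c: "c p \<ge> 1" "c q \<ge> 1" using assms(2) by auto
    then have s: "sqrt (c p) + sqrt (c q) \<ge> 1" by (smt (verit) real_sqrt_ge_one)
    have "c p - c q = (sqrt (c p) - sqrt (c q)) * (sqrt (c p) + sqrt (c q))"
    proof -
      have "x * x - y * y = (x - y) * (x + y)" for x y :: real by algebra
      from this[of "sqrt (c p)" "sqrt (c q)"] show ?thesis using c by simp
    qed
    then have "\<bar>c p - c q\<bar> = \<bar>sqrt (c p) - sqrt (c q)\<bar> * (sqrt (c p) + sqrt (c q))"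
      using s by (simp add: abs_mult)
    then have "\<bar>sqrt (c p) - sqrt (c q)\<bar> \<le> \<bar>c p - c q\<bar>" using s by (simp add: mult_le_cancel_left1)
    then show "\<bar>sqrt (c p) - sqrt (c q)\<bar> \<le> C * ((norm p + norm q) * norm (p - q))"
      using C(3)[OF pq] by simp
  qed
qed

lemma quad_lip_entries:
  "quad_lip P (\<lambda>p. p$1 * p$2)" "quad_lip P (\<lambda>p. 1 + (p$1)\<^sup>2)" "quad_lip P (\<lambda>p. inverse (1 + (p$1)\<^sup>2))"
  "quad_lip P (\<lambda>p. inverse (1 + (norm p)\<^sup>2))" "quad_lip P (\<lambda>p. inverse (sqrt (1 + (norm p)\<^sup>2)))"
proof -
  show 1: "quad_lip P (\<lambda>p. p$1 * p$2)" by (rule quad_lip_monomial)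
  show 2: "quad_lip P (\<lambda>p. 1 + (p$1)\<^sup>2)"
    unfolding power2_eq_square by (intro quad_lip_add quad_lip_const quad_lip_monomial)
  show "quad_lip P (\<lambda>p. inverse (1 + (p$1)\<^sup>2))" by (intro quad_lip_inverse 2) simp
  have 3: "quad_lip P (\<lambda>p. 1 + (norm p)\<^sup>2)"
    unfolding norm_R2 unfolding power2_eq_square by (intro quad_lip_add quad_lip_const quad_lip_monomial)
  show "quad_lip P (\<lambda>p. inverse (1 + (norm p)\<^sup>2))" by (intro quad_lip_inverse 3) simp
  show "quad_lip P (\<lambda>p. inverse (sqrt (1 + (norm p)\<^sup>2)))"
    by (intro quad_lip_inverse quad_lip_sqrt 3) auto
qed

definition quad_lip_mat :: "real \<Rightarrow> (real^2 \<Rightarrow> real^2^2 \<Rightarrow> real) \<Rightarrow> bool" where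
  "quad_lip_mat P F \<longleftrightarrow> (\<exists>C\<ge>0. \<forall>p q M. norm p \<le> P \<longrightarrow> norm q \<le> P \<longrightarrow>
     \<bar>F p M\<bar> \<le> C * norm M \<and> \<bar>F p M - F q M\<bar> \<le> C * ((norm p + norm q) * norm (p - q) * norm M))"

lemma quad_lip_mat_entry:
  assumes "quad_lip P c" shows "quad_lip_mat P (\<lambda>p M. c p * M$i$j)"
proof -
  obtain C where C: "C \<ge> 0" "\<And>p. norm p \<le> P \<Longrightarrow> \<bar>c p\<bar> \<le> C"
    "\<And>p q. norm p \<le> P \<Longrightarrow> norm q \<le> P \<Longrightarrow> \<bar>c p - c q\<bar> \<le> C * ((norm p + norm q) * norm (p - q))"
    using quad_lipE[OF assms(1)] by blast
  show ?thesis unfolding quad_lip_mat_def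
  proof (intro exI[of _ C] conjI allI impI)
    fix p q :: "real^2" and M :: "real^2^2" assume pq: "norm p \<le> P" "norm q \<le> P"
    show "\<bar>c p * M$i$j\<bar> \<le> C * norm M"
      unfolding abs_mult using C pq entry_le_norm by (intro mult_mono) auto
    have "\<bar>c p * M$i$j - c q * M$i$j\<bar> = \<bar>c p - c q\<bar> * \<bar>M$i$j\<bar>" by (simp add: left_diff_distrib flip: abs_mult)
    also have "\<dots> \<le> (C * ((norm p + norm q) * norm (p - q))) * norm M"
      using C pq entry_le_norm by (intro mult_mono) auto
    finally show "\<bar>c p * M$i$j - c q * M$i$j\<bar> \<le> C * ((norm p + norm q) * norm (p - q) * norm M)"
      by (simp add: mult_ac)
  qed (use C in simp)
qed

lemma quad_lip_mat_add:
  assumes "quad_lip_mat P F" "quad_lip_mat P G" shows "quad_lip_mat P (\<lambda>p M. F p M + G p M)"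
proof -
  obtain C where C: "C \<ge> 0" "\<And>p q M. norm p \<le> P \<Longrightarrow> norm q \<le> P \<Longrightarrow> \<bar>F p M\<bar> \<le> C * norm M \<and> \<bar>F p M - F q M\<bar> \<le> C * ((norm p + norm q) * norm (p - q) * norm M)"
    using assms(1) unfolding quad_lip_mat_def by blast
  obtain D where D: "D \<ge> 0" "\<And>p q M. norm p \<le> P \<Longrightarrow> norm q \<le> P \<Longrightarrow> \<bar>G p M\<bar> \<le> D * norm M \<and> \<bar>G p M - G q M\<bar> \<le> D * ((norm p + norm q) * norm (p - q) * norm M)"
    using assms(2) unfolding quad_lip_mat_def by blast
  show ?thesis unfolding quad_lip_mat_def
  proof (intro exI[of _ "C + D"] conjI allI impI)
    fix p q :: "real^2" and M :: "real^2^2" assume pq: "norm p \<le> P" "norm q \<le> P"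
    show "\<bar>F p M + G p M\<bar> \<le> (C + D) * norm M"
      using C(2)[OF pq, of M] D(2)[OF pq, of M] unfolding distrib_right by linarith
    show "\<bar>F p M + G p M - (F q M + G q M)\<bar> \<le> (C + D) * ((norm p + norm q) * norm (p - q) * norm M)"
      using C(2)[OF pq, of M] D(2)[OF pq, of M] unfolding distrib_right[of C D] by linarith
  qed (use C D in simp)
qed

lemma quad_lip_mat_cmult:
  assumes "quad_lip_mat P F" shows "quad_lip_mat P (\<lambda>p M. a * F p M)"
proof -
  obtain C where C: "C \<ge> 0" "\<And>p q M. norm p \<le> P \<Longrightarrow> norm q \<le> P \<Longrightarrow> \<bar>F p M\<bar> \<le> C * norm M \<and> \<bar>F p M - F q M\<bar> \<le> C * ((norm p + norm q) * norm (p - q) * norm M)"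
    using assms(1) unfolding quad_lip_mat_def by blast
  show ?thesis unfolding quad_lip_mat_def
  proof (intro exI[of _ "\<bar>a\<bar> * C"] conjI allI impI)
    fix p q :: "real^2" and M :: "real^2^2" assume pq: "norm p \<le> P" "norm q \<le> P"
    show "\<bar>a * F p M\<bar> \<le> \<bar>a\<bar> * C * norm M"
      using C(2)[OF pq, of M] by (simp add: abs_mult mult.assoc mult_left_mono)
    show "\<bar>a * F p M - a * F q M\<bar> \<le> \<bar>a\<bar> * C * ((norm p + norm q) * norm (p - q) * norm M)"
      using C(2)[OF pq, of M] unfolding right_diff_distrib[symmetric] abs_mult mult.assoc by (intro mult_left_mono) auto
  qed (use C in simp)
qed

lemma quad_lip_mat_diff:
  assumes "quad_lip_mat P F" "quad_lip_mat P G" shows "quad_lip_mat P (\<lambda>p M. F p M - G p M)"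
  using quad_lip_mat_add[OF assms(1) quad_lip_mat_cmult[OF assms(2), of "-1"]] by simp

lemma quad_lip_shape:
  "quad_lip_mat P shape11" "quad_lip_mat P shape12" "quad_lip_mat P shape22"
proof -
  show "quad_lip_mat P shape11" unfolding shape11_def[abs_def]
    by (intro quad_lip_mat_entry quad_lip_mult quad_lip_entries)
  show "quad_lip_mat P shape12" unfolding shape12_def[abs_def]
    by (intro quad_lip_mat_add quad_lip_mat_diff quad_lip_mat_entry quad_lip_mult quad_lip_entries)
  show "quad_lip_mat P shape22" unfolding shape22_def[abs_def]
    by (intro quad_lip_mat_add quad_lip_mat_diff quad_lip_mat_entry quad_lip_mult quad_lip_entries quad_lip_const)
qed

definition shape_bound :: "real \<Rightarrow> real \<Rightarrow> bool" where
  "shape_bound P C \<longleftrightarrow> C > 0 \<and>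
    (\<forall>p M. norm p \<le> P \<longrightarrow> \<bar>shape_trace p M\<bar> \<le> C * norm M \<and> cmod (shape_dev p M) \<le> C * norm M) \<and>
    (\<forall>p q M. norm p \<le> P \<longrightarrow> norm q \<le> P \<longrightarrow>
        \<bar>shape_trace p M - shape_trace q M\<bar> \<le> C * ((norm p + norm q) * norm (p - q) * norm M) \<and>
        cmod (shape_dev p M - shape_dev q M) \<le> C * ((norm p + norm q) * norm (p - q) * norm M))"

lemma shape_boundD:
  assumes "shape_bound P C"
  shows "C > 0"
    "norm p \<le> P \<Longrightarrow> \<bar>shape_trace p M\<bar> \<le> C * norm M"
    "norm p \<le> P \<Longrightarrow> cmod (shape_dev p M) \<le> C * norm M"
    "norm p \<le> P \<Longrightarrow> norm q \<le> P \<Longrightarrow>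
        \<bar>shape_trace p M - shape_trace q M\<bar> \<le> C * ((norm p + norm q) * norm (p - q) * norm M)"
    "norm p \<le> P \<Longrightarrow> norm q \<le> P \<Longrightarrow>
        cmod (shape_dev p M - shape_dev q M) \<le> C * ((norm p + norm q) * norm (p - q) * norm M)"
  using assms unfolding shape_bound_def by blast+

lemma ex_shape_bound: "\<exists>C. shape_bound P C"
proof -
  have "quad_lip_mat P shape_trace" unfolding shape_trace_def[abs_def] by (intro quad_lip_mat_add quad_lip_shape)
  then obtain A where A: "A \<ge> 0" "\<And>p q M. norm p \<le> P \<Longrightarrow> norm q \<le> P \<Longrightarrow> \<bar>shape_trace p M\<bar> \<le> A * norm M
      \<and> \<bar>shape_trace p M - shape_trace q M\<bar> \<le> A * ((norm p + norm q) * norm (p - q) * norm M)"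
    unfolding quad_lip_mat_def by blast
  have "quad_lip_mat P (\<lambda>p M. shape11 p M - shape22 p M)" 
    by (intro quad_lip_mat_diff quad_lip_shape)
  then obtain B where B: "B \<ge> 0" "\<And>p q M. norm p \<le> P \<Longrightarrow> norm q \<le> P \<Longrightarrow> \<bar>Re (shape_dev p M)\<bar> \<le> B * norm M
      \<and> \<bar>Re (shape_dev p M - shape_dev q M)\<bar> \<le> B * ((norm p + norm q) * norm (p - q) * norm M)"
    unfolding quad_lip_mat_def shape_dev_def by auto
  have "quad_lip_mat P (\<lambda>p M. 2 * shape12 p M)" 
    by (intro quad_lip_mat_cmult quad_lip_shape)
  then obtain D where D: "D \<ge> 0" "\<And>p q M. norm p \<le> P \<Longrightarrow> norm q \<le> P \<Longrightarrow> \<bar>Im (shape_dev p M)\<bar> \<le> D * norm M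
      \<and> \<bar>Im (shape_dev p M - shape_dev q M)\<bar> \<le> D * ((norm p + norm q) * norm (p - q) * norm M)"
    unfolding quad_lip_mat_def shape_dev_def by auto
  have "shape_bound P (A + B + D + 1)"
    unfolding shape_bound_def
  proof (intro conjI allI impI)
    have mono: "x \<le> (A + B + D + 1) * y" if "x \<le> A * y" "0 \<le> y" for x y
      using mult_right_mono[of A "A + B + D + 1" y] that A(1) B(1) D(1) by linarith
    have mono2: "cmod z \<le> (A + B + D + 1) * y" if "\<bar>Re z\<bar> \<le> B * y" "\<bar>Im z\<bar> \<le> D * y" "0 \<le> y" for z y
      using mult_right_mono[of "B + D" "A + B + D + 1" y] that A(1) B(1) D(1) cmod_le[of z] 
      unfolding distrib_right[of B D] by linarith
    show "A + B + D + 1 > 0" using A(1) B(1) D(1) by linarith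
    show "\<bar>shape_trace p M\<bar> \<le> (A + B + D + 1) * norm M" if "norm p \<le> P" for p M
      using A(2)[OF that that] by (intro mono) auto
    show "\<bar>shape_trace p M - shape_trace q M\<bar> \<le> (A + B + D + 1) * ((norm p + norm q) * norm (p - q) * norm M)"
      if "norm p \<le> P" "norm q \<le> P" for p q M
      using A(2)[OF that] by (intro mono) auto
    show "cmod (shape_dev p M) \<le> (A + B + D + 1) * norm M" if "norm p \<le> P" for p M
      using B(2)[OF that that] D(2)[OF that that] by (intro mono2) auto
    show "cmod (shape_dev p M - shape_dev q M) \<le> (A + B + D + 1) * ((norm p + norm q) * norm (p - q) * norm M)"
      if "norm p \<le> P" "norm q \<le> P" for p q M
      using B(2)[OF that] D(2)[OF that] by (intro mono2) auto
  qed
  then show ?thesis ..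
qed

text \<open>The squares of the two sides differ by a positive multiple of \<open>det Z\<close>, so
  only the signs of \<open>det Z\<close> and of the trace of the shape operator have to be
  known.\<close>

lemma shape_psd:
  assumes sym: "Z$2$1 = Z$1$2" and psd: "\<And>h. h \<bullet> (Z *v h) \<ge> 0"
  shows "cmod (shape_dev p Z) \<le> shape_trace p Z"
proof -
  have q: "h \<bullet> (Z *v h) = (h$1)\<^sup>2 * Z$1$1 + 2 * h$1 * h$2 * Z$1$2 + (h$2)\<^sup>2 * Z$2$2" for h
    by (simp add: inner_R2 matrix_vector_mult_def sum_2 sym power2_eq_square algebra_simps)
  have Z1: "Z$1$1 \<ge> 0" using psd[of "vector [1, 0]"] by (simp add: q)
  have Z2: "Z$2$2 \<ge> 0" using psd[of "vector [0, 1]"] by (simp add: q)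
  have det: "Z$1$1 * Z$2$2 - Z$1$2 * Z$1$2 \<ge> 0"
  proof (cases "Z$1$1 = 0")
    case True
    have "Z$1$2 = 0"
    proof (rule ccontr)
      assume "Z$1$2 \<noteq> 0"
      \<comment> \<open>With \<open>Z$1$1 = 0\<close> and second coordinate 1 the form is affine in
        the first coordinate, and the chosen one makes it \<open>-1\<close>.\<close>
      then show False
        using psd[of "vector [- (Z$2$2 + 1) / (2 * Z$1$2), 1]"] True by (simp add: q field_simps)
    qed
    then show ?thesis using True by simp
  next
    case False
    have "0 \<le> Z$1$1 * (Z$1$1 * Z$2$2 - Z$1$2 * Z$1$2)"
      using psd[of "vector [- Z$1$2, Z$1$1]"] by (simp add: q power2_eq_square algebra_simps)
    then show ?thesis using False Z1 by (simp add: zero_le_mult_iff)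
  qed
  \<comment> \<open>The trace, cleared of its positive denominator, is the quadratic form at
    \<open>p\<close> turned by a right angle plus the Euclidean trace of \<open>Z\<close>.\<close>
  have "0 \<le> (vector [p$2, - p$1] :: real^2) \<bullet> (Z *v vector [p$2, - p$1]) + (Z$1$1 + Z$2$2)"
    using psd Z1 Z2 by simp
  also have "\<dots> = shape_trace p Z * ((1 + (norm p)\<^sup>2) * sqrt (1 + (norm p)\<^sup>2))"
    unfolding shape_trace_eq q by (simp add: algebra_simps)
  finally have tr: "shape_trace p Z \<ge> 0"
    by (smt (verit) mult_pos_pos mult_neg_pos real_sqrt_gt_zero zero_le_power2)
  have "(cmod (shape_dev p Z))\<^sup>2 \<le> (shape_trace p Z)\<^sup>2"
    using shape_det_eq[OF sym, of p] det by (smt (verit) det_2 divide_nonneg_nonneg sym zero_le_power2)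
  then show ?thesis using tr by (rule power2_le_imp_le)
qed

section \<open>The Weingarten equation\<close>

text \<open>The equation as a relation between the sum and the difference of the principal
  curvatures. In this form no eigenvectors occur, and two solutions can be subtracted even where
  their principal directions differ.\<close>

definition weing :: "(real \<Rightarrow> real) \<Rightarrow> real^2 \<Rightarrow> real^2^2 \<Rightarrow> bool" where
  "weing f p M \<longleftrightarrow> (\<exists>\<kappa>\<ge>0. shape_trace p M = \<kappa> + f \<kappa> \<and> cmod (shape_dev p M) = \<kappa> - f \<kappa>)"

lemma weing_if_principal_curvatures:
  assumes pc: "principal_curvatures S u x \<kappa> (f \<kappa>)" and "\<kappa> \<ge> 0"
    and sym: "hess_on S u x $2$1 = hess_on S u x $1$2"
  shows "weing f (grad_on S u x) (hess_on S u x)"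
proof -
  define p M w where "p = grad_on S u x" and "M = hess_on S u x" and "w = (1 + (norm p)\<^sup>2) * sqrt (1 + (norm p)\<^sup>2)"
  have pos: "1 + (norm p)\<^sup>2 > 0" by (simp add: add_pos_nonneg)
  have w: "w > 0" using pos by (simp add: w_def)
  have "(1 + (norm p)\<^sup>2) powr (3/2) = (1 + (norm p)\<^sup>2) powr (1 + 1/2)" by simp
  also have "\<dots> = w" unfolding powr_add using pos by (simp add: w_def powr_half_sqrt)
  finally have pw: "(1 + (norm p)\<^sup>2) powr (3/2) = w" .
  have "shape_trace p M = 2 * mean_curvature S u x"
    unfolding mean_curvature_def Let_def p_def[symmetric] M_def[symmetric] pw
    using shape_trace_eq[of p M] w by (simp add: w_def[symmetric] field_simps)
  then have tr: "shape_trace p M = \<kappa> + f \<kappa>" using pc by (simp add: principal_curvatures_def)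
  have "(cmod (shape_dev p M))\<^sup>2 = (shape_trace p M)\<^sup>2 - 4 * gauss_curvature S u x"
    using shape_det_eq[of M p] sym by (simp add: gauss_curvature_def p_def M_def)
  also have "\<dots> = (\<kappa> - f \<kappa>)\<^sup>2"
  proof -
    have "gauss_curvature S u x = \<kappa> * f \<kappa>" using pc by (simp add: principal_curvatures_def)
    then show ?thesis unfolding tr by (simp add: power2_eq_square algebra_simps)
  qed
  finally have "cmod (shape_dev p M) = \<kappa> - f \<kappa>"
    using pc by (simp add: principal_curvatures_def power2_eq_iff_nonneg)
  then show ?thesis using tr \<open>\<kappa> \<ge> 0\<close> unfolding weing_def p_def M_def by blast
qed

locale curvature_relation =
  fixes f f' :: "real \<Rightarrow> real" and \<Lambda> :: real
  assumes L: "0 < \<Lambda>" "\<Lambda> < 1"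
    and deriv: "\<And>t. t \<ge> 0 \<Longrightarrow> (f has_real_derivative f' t) (at t within {0..})"
    and lip: "\<And>b. \<exists>L. L-lipschitz_on {0..b} f'"
    and f0: "f 0 = 0"
    and bounds: "\<And>t. t \<ge> 0 \<Longrightarrow> - (1 / \<Lambda>) \<le> f' t \<and> f' t \<le> - \<Lambda>"
    and f'0: "f' 0 = -1"
begin

text \<open>\<open>s + f s\<close> as a function of \<open>s - f s\<close> has slope
  \<open>(1 + f' s) / (1 - f' s)\<close>, and the bounds on \<open>f'\<close> confine this slope to
  the interval from \<open>- contr\<close> to \<open>contr\<close>.\<close>

definition "contr = (1 - \<Lambda>) / (1 + \<Lambda>)"

lemma contr: "0 < contr" "contr < 1"
  using L by (auto simp: contr_def field_simps)

lemma slope: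
  assumes "0 \<le> s" "s < t"
  obtains z where "s < z" "z < t" "f t - f s = f' z * (t - s)"
proof -
  have "\<exists>z\<in>{s<..<t}. f t - f s = (\<lambda>h. f' z * h) (t - s)"
  proof (rule mvt_simple)
    fix z assume "s \<le> z" "z \<le> t"
    then have "(f has_real_derivative f' z) (at z within {s..t})"
      using assms by (intro DERIV_subset[OF deriv]) auto
    then show "(f has_derivative (\<lambda>h. f' z * h)) (at z within {s..t})"
      by (simp add: has_field_derivative_def)
  qed (use assms in auto)
  then show thesis using that by auto
qed

lemma f_nonpos: assumes "t \<ge> 0" shows "f t \<le> 0"
proof (cases "t = 0")
  case False
  then obtain z where z: "0 < z" "z < t" "f t - f 0 = f' z * (t - 0)" using slope[of 0 t] assms by auto
  then show ?thesis using bounds[of z] L assms by (simp add: f0 mult_nonpos_nonneg)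
qed (simp add: f0)

text \<open>The factor \<open>k\<close> is left open: it is \<open>contr\<close> for arbitrary
  curvatures, and a multiple of their size near 0, where \<open>f' 0 = -1\<close> makes the
  numerator of the slope small.\<close>

lemma contraction_wlog:
  assumes "0 \<le> s" "s < t" 
    and k: "\<And>z. 0 \<le> z \<Longrightarrow> z < t \<Longrightarrow> \<bar>1 + f' z\<bar> \<le> k * (1 - f' z)"
  shows "\<bar>(t + f t) - (s + f s)\<bar> \<le> k * \<bar>(t - f t) - (s - f s)\<bar>"
proof -
  obtain z where z: "s < z" "z < t" "f t - f s = f' z * (t - s)" using slope[OF assms(1,2)] .
  have neg: "f' z \<le> 0" using bounds[of z] z assms L by auto
  have 1: "(t + f t) - (s + f s) = (1 + f' z) * (t - s)" 
    and 2: "(t - f t) - (s - f s) = (1 - f' z) * (t - s)" using z(3) by (simp_all add: algebra_simps)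
  have "\<bar>1 + f' z\<bar> * (t - s) \<le> k * (1 - f' z) * (t - s)"
    using k[of z] z assms by (intro mult_right_mono) auto
  then show ?thesis unfolding 1 2 abs_mult using neg assms by (simp add: mult.assoc)
qed

lemma contraction:
  assumes "0 \<le> s" "0 \<le> t"
    and k: "\<And>z. 0 \<le> z \<Longrightarrow> z < max s t \<Longrightarrow> \<bar>1 + f' z\<bar> \<le> k * (1 - f' z)"
  shows "\<bar>(t + f t) - (s + f s)\<bar> \<le> k * \<bar>(t - f t) - (s - f s)\<bar>"
proof (cases s t rule: linorder_cases)
  case less then show ?thesis using assms by (intro contraction_wlog) auto
next
  case greater
  then have "\<bar>(s + f s) - (t + f t)\<bar> \<le> k * \<bar>(s - f s) - (t - f t)\<bar>" using assms by (intro contraction_wlog) auto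
  then show ?thesis by (simp add: abs_minus_commute)
qed simp

lemma contr_bound:
  assumes "z \<ge> 0" shows "\<bar>1 + f' z\<bar> \<le> contr * (1 - f' z)"
proof -
  have b: "- (1 / \<Lambda>) \<le> f' z" "f' z \<le> - \<Lambda>" using bounds[OF assms] by auto
  have "\<Lambda> * (- (1 / \<Lambda>)) \<le> \<Lambda> * f' z" using b(1) L by (intro mult_left_mono) auto
  then have b1: "-1 \<le> \<Lambda> * f' z" using L by simp
  have "(1 + \<Lambda>) * \<bar>1 + f' z\<bar> \<le> (1 - \<Lambda>) * (1 - f' z)"
    using b(2) b1 L by (auto simp: abs_if algebra_simps)
  then have "\<bar>1 + f' z\<bar> \<le> ((1 - \<Lambda>) * (1 - f' z)) / (1 + \<Lambda>)" using L by (simp add: pos_le_divide_eq mult.commute)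
  then show ?thesis by (simp add: contr_def)
qed

text \<open>For solutions the trace is a function of \<open>cmod shape_dev\<close> with Lipschitz
  constant \<open>contr\<close>. The reverse triangle inequality then replaces the difference of the
  moduli by the modulus of the difference.\<close>

lemma weing_diff:
  assumes "weing f p M" "weing f q N"
  shows "\<bar>shape_trace p M - shape_trace q N\<bar> \<le> contr * cmod (shape_dev p M - shape_dev q N)"
proof -
  obtain s where s: "s \<ge> 0" "shape_trace p M = s + f s" "cmod (shape_dev p M) = s - f s" using assms(1) unfolding weing_def by blast
  obtain t where t: "t \<ge> 0" "shape_trace q N = t + f t" "cmod (shape_dev q N) = t - f t" using assms(2) unfolding weing_def by blast
  have "\<bar>shape_trace p M - shape_trace q N\<bar> \<le> contr * \<bar>cmod (shape_dev p M) - cmod (shape_dev q N)\<bar>"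
    unfolding s t using s t contr_bound by (intro contraction) auto
  also have "\<dots> \<le> contr * cmod (shape_dev p M - shape_dev q N)"
    using contr norm_triangle_ineq3 by (intro mult_left_mono) auto
  finally show ?thesis .
qed

text \<open>\<open>f\<close> is nonpositive, so a bound \<open>d\<close> on the deviation bounds the
  larger curvature as well. Since \<open>f'\<close> is Lipschitz with \<open>f' 0 = -1\<close>, the
  slope is at most a multiple of \<open>d\<close>.\<close>

lemma weing_diff_small:
  obtains K where "K > 0" "\<And>p q M N d. weing f p M \<Longrightarrow> weing f q N \<Longrightarrow> cmod (shape_dev p M) \<le> d \<Longrightarrow>
     cmod (shape_dev q N) \<le> d \<Longrightarrow> d \<le> 1 \<Longrightarrow>
     \<bar>shape_trace p M - shape_trace q N\<bar> \<le> K * d * cmod (shape_dev p M - shape_dev q N)"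
proof -
  obtain K0 where K0: "K0-lipschitz_on {0..1} f'" using lip by blast
  show ?thesis
  proof (rule that[of "K0 + 1"])
    have "K0 \<ge> 0" using K0 lipschitz_on_nonneg by blast
    then show "K0 + 1 > 0" by simp
    fix p q M N d assume a: "weing f p M" "weing f q N" "cmod (shape_dev p M) \<le> d" "cmod (shape_dev q N) \<le> d" "d \<le> 1"
    have d0: "d \<ge> 0" using a(3) norm_ge_zero order_trans by blast
    obtain s where s: "s \<ge> 0" "shape_trace p M = s + f s" "cmod (shape_dev p M) = s - f s" using a(1) unfolding weing_def by blast
    obtain t where t: "t \<ge> 0" "shape_trace q N = t + f t" "cmod (shape_dev q N) = t - f t" using a(2) unfolding weing_def by blast
    have st: "s \<le> d" "t \<le> d" using s t a f_nonpos by (smt (verit))+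
    have "\<bar>shape_trace p M - shape_trace q N\<bar> \<le> (K0 + 1) * d * \<bar>cmod (shape_dev p M) - cmod (shape_dev q N)\<bar>"
      unfolding s t
    proof (rule contraction)
      fix z assume z: "0 \<le> z" "z < max t s"
      have "\<bar>f' z - f' 0\<bar> \<le> K0 * \<bar>z - 0\<bar>"
        using lipschitz_onD[OF K0, of z 0] z st a(5) by (auto simp: dist_real_def)
      also have "\<dots> \<le> (K0 + 1) * d" using z st \<open>K0 \<ge> 0\<close> by (intro mult_mono) auto
      finally have "\<bar>1 + f' z\<bar> \<le> (K0 + 1) * d * 1" by (simp add: f'0 add.commute)
      also have "\<dots> \<le> (K0 + 1) * d * (1 - f' z)"
        using bounds[OF z(1)] L \<open>K0 \<ge> 0\<close> d0 by (intro mult_left_mono) auto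
      finally show "\<bar>1 + f' z\<bar> \<le> (K0 + 1) * d * (1 - f' z)" .
    qed (use s t in auto)
    also have "\<dots> \<le> (K0 + 1) * d * cmod (shape_dev p M - shape_dev q N)"
      using norm_triangle_ineq3 \<open>K0 \<ge> 0\<close> d0 by (intro mult_left_mono) auto
    finally show "\<bar>shape_trace p M - shape_trace q N\<bar> \<le> (K0 + 1) * d * cmod (shape_dev p M - shape_dev q N)" .
  qed
qed

lemma weing_0: "weing f 0 0"
  unfolding weing_def by (intro exI[of _ 0]) (simp add: f0 shape_0 complex_eq_iff)

text \<open>Freezing the gradient at \<open>p\<close> costs \<open>C * E\<close>; by linearity the
  difference of the two shape operators then becomes the shape operator of the one matrix
  \<open>M - N\<close>.\<close>

lemma shape_diff_perturb:
  assumes C: "\<bar>shape_trace p N - shape_trace q N\<bar> \<le> C * E" "cmod (shape_dev p N - shape_dev q N) \<le> C * E"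
  shows "\<bar>shape_trace p (M - N) - (shape_trace p M - shape_trace q N)\<bar> \<le> C * E"
    "cmod (shape_dev p (M - N) - (shape_dev p M - shape_dev q N)) \<le> C * E"
  using C by (simp_all add: shape_diff norm_minus_commute abs_minus_commute)

text \<open>\<open>weing_diff\<close> bounds the trace by \<open>contr\<close> times the deviation.
  Small gradients make the coefficients nearly flat, which raises \<open>contr\<close> to
  \<open>k1 < 1\<close>, and the difference of the gradients adds the term \<open>E\<close>. When
  this bound is squared, the gap below 1 absorbs the mixed term.\<close>

lemma det_weing_diff:
  obtains \<eta> c C where "\<eta> > 0" "\<eta> \<le> 1" "c > 0" "C > 0"
    "\<And>p q M N. weing f p M \<Longrightarrow> weing f q N \<Longrightarrow> M$2$1 = M$1$2 \<Longrightarrow> N$2$1 = N$1$2 \<Longrightarrow> norm p \<le> \<eta> \<Longrightarrow> norm q \<le> \<eta> \<Longrightarrow>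
       det (M - N) \<le> - c * (norm (M - N))\<^sup>2 + C * ((norm p + norm q) * norm (p - q) * norm N)\<^sup>2"
proof -
  obtain C0 where C0: "shape_bound 1 C0" using ex_shape_bound by blast
  define C where "C = C0"
  note C = shape_boundD[OF C0, folded C_def]
  \<comment> \<open>\<open>\<theta>\<close> is the share of \<open>1 - contr\<close> left to the
    curved coefficients, and \<open>\<eta>\<close> keeps their error
    \<open>2 * C * \<eta>\<^sup>2\<close> below it. \<open>k1\<close> is the midpoint of
    \<open>contr\<close> and 1, \<open>k2\<close> that of \<open>k1\<^sup>2\<close> and 1; the gap
    between \<open>k1\<^sup>2\<close> and \<open>k2\<close> pays for the mixed term, and
    \<open>D\<close> collects the resulting multiples of \<open>E\<^sup>2\<close>.\<close>
  define \<theta> where "\<theta> = (1 - contr) / 8"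
  define \<eta> where "\<eta> = min 1 (sqrt (\<theta> / (2 * C)))"
  define k1 where "k1 = (1 + contr) / 2"
  define k2 where "k2 = (1 + k1\<^sup>2) / 2"
  define D where "D = (8 * C * k1)\<^sup>2 / (2 * (1 - k1\<^sup>2)) + 16 * C\<^sup>2"
  have \<theta>: "0 < \<theta>" "\<theta> \<le> 1/8" using contr by (auto simp: \<theta>_def)
  have \<eta>: "0 < \<eta>" "\<eta> \<le> 1" using \<theta> C by (auto simp: \<eta>_def)
  have "\<eta>\<^sup>2 \<le> (sqrt (\<theta> / (2 * C)))\<^sup>2" using \<eta> by (intro power_mono) (auto simp: \<eta>_def)
  then have \<eta>2: "2 * C * \<eta>\<^sup>2 \<le> \<theta>" using \<theta> C by (simp add: field_simps)
  have k1: "0 < k1" "k1 < 1" using contr by (auto simp: k1_def)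
  have k1s: "k1\<^sup>2 < 1" using k1 by (simp add: abs_square_less_1)
  have k2: "0 < k2" "k2 < 1" using k1s by (auto simp: k2_def add_pos_nonneg)
  have D: "D > 0" unfolding D_def using k1s C by (intro add_nonneg_pos) auto
  show ?thesis
  proof (rule that[of \<eta> "(1 - k2) / 4" "D"])
    fix p q :: "real^2" and M N :: "real^2^2"
    assume W: "weing f p M" "weing f q N" and sym: "M$2$1 = M$1$2" "N$2$1 = N$1$2" and pq: "norm p \<le> \<eta>" "norm q \<le> \<eta>"
    define E where "E = (norm p + norm q) * norm (p - q) * norm N"
    define Y where "Y = M - N"
    define t x where "t = \<bar>shape_trace 0 Y\<bar>" and "x = cmod (shape_dev 0 Y)"
    have nn: "E \<ge> 0" "t \<ge> 0" "x \<ge> 0" by (simp_all add: E_def t_def x_def)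
    have symY: "Y$2$1 = Y$1$2" using sym by (simp add: Y_def)
    have det: "4 * det Y = t\<^sup>2 - x\<^sup>2"
      using shape_det_eq[OF symY, of 0] by (simp add: t_def x_def)
    have nY: "2 * (norm Y)\<^sup>2 = t\<^sup>2 + x\<^sup>2"
      unfolding t_def x_def norm_R22 shape_0 cmod_power2 using symY by (simp add: power2_eq_square algebra_simps)
    have "2 * (norm Y)\<^sup>2 \<le> 2 * (t + x)\<^sup>2" unfolding nY using nn by (simp add: power2_sum)
    then have "(norm Y)\<^sup>2 \<le> (t + x)\<^sup>2" by simp
    then have nY1: "norm Y \<le> t + x" by (rule power2_le_imp_le) (use nn in auto)
    have p1: "norm p \<le> 1" "norm q \<le> 1" using pq \<eta> by auto
    note e1 = shape_diff_perturb[OF C(4)[OF p1, of N] C(5)[OF p1, of N], of M, folded E_def Y_def]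
    have "C * (norm p * norm p * norm Y) \<le> C * (\<eta> * \<eta> * norm Y)"
      using pq C(1) \<eta> by (intro mult_left_mono mult_right_mono mult_mono) auto
    then have e2: "\<bar>shape_trace p Y - shape_trace 0 Y\<bar> \<le> C * \<eta>\<^sup>2 * norm Y" "cmod (shape_dev p Y - shape_dev 0 Y) \<le> C * \<eta>\<^sup>2 * norm Y"
      using C(4)[OF p1(1), of 0 Y] C(5)[OF p1(1), of 0 Y] by (auto simp: power2_eq_square mult.assoc)
    have h1: "t \<le> \<bar>shape_trace p M - shape_trace q N\<bar> + C * E + C * \<eta>\<^sup>2 * norm Y"
      using e1(1) e2(1) unfolding t_def by linarith
    have h2: "cmod (shape_dev p M - shape_dev q N) \<le> x + C * \<eta>\<^sup>2 * norm Y + C * E"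
    proof -
      have "shape_dev p M - shape_dev q N = shape_dev 0 Y + (shape_dev p Y - shape_dev 0 Y) - (shape_dev p Y - (shape_dev p M - shape_dev q N))" by simp
      also have "cmod \<dots> \<le> x + C * \<eta>\<^sup>2 * norm Y + C * E"
        using order_trans[OF norm_triangle_ineq4 add_mono[OF order_trans[OF norm_triangle_ineq add_mono[OF order_refl e2(2)]] e1(2)]]
          unfolding x_def .
      finally show ?thesis .
    qed
    have h3: "\<bar>shape_trace p M - shape_trace q N\<bar> \<le> contr * (x + C * \<eta>\<^sup>2 * norm Y + C * E)"
      using weing_diff[OF W] mult_left_mono[OF h2, of contr] contr by linarith
    have h4: "contr * (x + C * \<eta>\<^sup>2 * norm Y + C * E) \<le> contr * x + 1 * (C * \<eta>\<^sup>2 * norm Y + C * E)"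
      unfolding distrib_left add.assoc using contr C(1) nn by (intro add_mono mult_right_mono order_refl) auto
    have h5: "2 * C * \<eta>\<^sup>2 * norm Y \<le> \<theta> * (t + x)"
      using \<eta>2 nY1 \<theta> by (intro mult_mono) auto
    have h6: "t \<le> contr * x + 2 * C * \<eta>\<^sup>2 * norm Y + 2 * C * E" using h1 h3 h4 by simp
    have h7: "t * (1 - \<theta>) \<le> (contr + \<theta>) * x + 2 * C * E" using h5 h6 by (simp add: algebra_simps)
    have h8: "(contr + \<theta>) * x \<le> (k1 * (1 - \<theta>)) * x"
    proof (intro mult_right_mono nn)
      have "k1 * \<theta> \<le> 1 * \<theta>" using k1 \<theta> by (intro mult_right_mono) auto
      moreover have "contr + \<theta> \<le> k1 - \<theta>" using contr by (simp add: k1_def \<theta>_def field_simps)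
      ultimately show "contr + \<theta> \<le> k1 * (1 - \<theta>)" by (simp add: right_diff_distrib)
    qed
    have h9: "2 * C * E \<le> 4 * C * E * (1 - \<theta>)"
      using mult_left_mono[of "1/2" "1 - \<theta>" "4 * C * E"] \<theta> C(1) nn by simp
    have "t * (1 - \<theta>) \<le> (k1 * x + 4 * C * E) * (1 - \<theta>)" using h7 h8 h9 by (simp add: algebra_simps)
    then have "t \<le> k1 * x + 4 * C * E" using \<theta> by simp
    then have "t\<^sup>2 \<le> (k1 * x + 4 * C * E)\<^sup>2" using nn by (intro power_mono)
    also have "\<dots> = k1\<^sup>2 * x\<^sup>2 + (8 * C * k1 * E) * x + 16 * C\<^sup>2 * E\<^sup>2" by (simp add: power2_eq_square algebra_simps)
    finally have h10: "t\<^sup>2 \<le> k1\<^sup>2 * x\<^sup>2 + (8 * C * k1 * E) * x + 16 * C\<^sup>2 * E\<^sup>2" .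
    have h11: "(8 * C * k1 * E) * x \<le> (1 - k1\<^sup>2) / 2 * x\<^sup>2 + (8 * C * k1)\<^sup>2 / (2 * (1 - k1\<^sup>2)) * E\<^sup>2"
    proof -
      define a where "a = 1 - k1\<^sup>2"
      have a: "a > 0" using k1s by (simp add: a_def)
      have "0 \<le> (a * x - 8 * C * k1 * E)\<^sup>2" by simp
      then have "2 * a * ((8 * C * k1 * E) * x) \<le> 2 * a * (a / 2 * x\<^sup>2 + (8 * C * k1)\<^sup>2 / (2 * a) * E\<^sup>2)"
        using a by (simp add: power2_eq_square algebra_simps)
      then show ?thesis using a unfolding a_def[symmetric] by simp
    qed
    have "t\<^sup>2 \<le> (k1\<^sup>2 + (1 - k1\<^sup>2) / 2) * x\<^sup>2 + D * E\<^sup>2"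
      using h10 h11 unfolding D_def distrib_right by linarith
    also have "k1\<^sup>2 + (1 - k1\<^sup>2) / 2 = k2" by (simp add: k2_def field_simps)
    finally have "t\<^sup>2 \<le> k2 * x\<^sup>2 + D * E\<^sup>2" .
    then have 1: "4 * det Y \<le> - (1 - k2) * x\<^sup>2 + D * E\<^sup>2" and 2: "2 * (norm Y)\<^sup>2 \<le> (1 + k2) * x\<^sup>2 + D * E\<^sup>2"
      unfolding det nY by (simp_all add: algebra_simps)
    have "(1 + k2) * x\<^sup>2 \<le> 2 * x\<^sup>2" using k2 by (intro mult_right_mono) auto
    then have "(norm Y)\<^sup>2 - D * E\<^sup>2 / 2 \<le> x\<^sup>2" using 2 by linarith
    then have "(1 - k2) * ((norm Y)\<^sup>2 - D * E\<^sup>2 / 2) \<le> (1 - k2) * x\<^sup>2" using k2 by (intro mult_left_mono) auto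
    moreover have "(1 - k2) * (D * E\<^sup>2 / 2) \<le> 1 * (D * E\<^sup>2 / 2)" using k2 D by (intro mult_right_mono) auto
    moreover have "0 \<le> D * E\<^sup>2" using D by simp
    ultimately have fin: "4 * det Y \<le> - (1 - k2) * (norm Y)\<^sup>2 + 4 * (D * E\<^sup>2)" using 1 unfolding right_diff_distrib by linarith
    then have "det Y \<le> - ((1 - k2) / 4) * (norm Y)\<^sup>2 + D * E\<^sup>2"
    proof -
      have "- ((1 - k2) / 4) * (norm Y)\<^sup>2 = (- (1 - k2) * (norm Y)\<^sup>2) / 4" by (simp add: field_simps)
      then show ?thesis using fin by linarith
    qed
    then show "det (M - N) \<le> - ((1 - k2) / 4) * (norm (M - N))\<^sup>2 + D * ((norm p + norm q) * norm (p - q) * norm N)\<^sup>2"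
      unfolding Y_def E_def .
  qed (use \<eta> k2 D in auto)
qed

text \<open>A function \<open>\<phi>\<close> that touches \<open>u - v\<close> from below satisfies this with \<open>X = D\<^sup>2\<phi>\<close>: positive semidefinite
  matrices have \<open>cmod shape_dev \<le> shape_trace\<close>, so the excess \<open>M - N - X\<close> drops out.\<close>

lemma pucci:
  assumes C: "\<bar>shape_trace p N - shape_trace q N\<bar> \<le> C * E" "cmod (shape_dev p N - shape_dev q N) \<le> C * E"
    and k: "0 \<le> k" "k \<le> 1" "\<bar>shape_trace p M - shape_trace q N\<bar> \<le> k * cmod (shape_dev p M - shape_dev q N)"
    and sym: "M$2$1 = M$1$2" "N$2$1 = N$1$2" "X$2$1 = X$1$2"
    and psd: "\<And>h. h \<bullet> ((M - N - X) *v h) \<ge> 0"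
  shows "shape_trace p X \<le> k * cmod (shape_dev p X) + 2 * (C * E)"
proof -
  define Z where "Z = M - N - X"
  have CE: "C * E \<ge> 0" using C(1) by (smt (verit))
  have MN: "M - N = X + Z" by (simp add: Z_def)
  note e = shape_diff_perturb[OF C, of M, unfolded MN shape_add]
  have Z: "cmod (shape_dev p Z) \<le> shape_trace p Z"
    using sym psd by (intro shape_psd) (simp_all add: Z_def)
  have "cmod (shape_dev p M - shape_dev q N) \<le> cmod (shape_dev p X) + cmod (shape_dev p Z) + C * E"
  proof -
    have "shape_dev p M - shape_dev q N = shape_dev p X + shape_dev p Z - (shape_dev p X + shape_dev p Z - (shape_dev p M - shape_dev q N))" by simp
    also have "cmod \<dots> \<le> cmod (shape_dev p X) + cmod (shape_dev p Z) + C * E"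
      using e(2) by (rule order_trans[OF norm_triangle_ineq4 add_mono[OF norm_triangle_ineq]])
    finally show ?thesis .
  qed
  then have "k * cmod (shape_dev p M - shape_dev q N) \<le> k * (cmod (shape_dev p X) + cmod (shape_dev p Z) + C * E)"
    using k by (intro mult_left_mono)
  moreover have "k * cmod (shape_dev p Z) \<le> 1 * shape_trace p Z" using k Z by (intro mult_mono) auto
  moreover have "k * (C * E) \<le> 1 * (C * E)" using k CE by (intro mult_right_mono) auto
  ultimately show ?thesis using k(3) e(1) unfolding distrib_left by linarith
qed

end

section \<open>Quasiregular pairs outside a disc\<close>

text \<open>The square makes the truncation continuously differentiable, as the circle integrals
  require.\<close>

lemma C1_grad_max_square:
  assumes "C1_grad a ga \<Omega>"
  shows "C1_grad (\<lambda>x. (max 0 (a x - m))\<^sup>2) (\<lambda>x. (2 * max 0 (a x - m)) *\<^sub>R ga x) \<Omega>"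
proof -
  have sq: "((\<lambda>y. (max 0 y)\<^sup>2) has_real_derivative 2 * max 0 y) (at y)" for y :: real
  proof (cases y "0::real" rule: linorder_cases)
    case less
    have "((\<lambda>y. 0) has_real_derivative 2 * max 0 y) (at y)" using less by simp
    then show ?thesis
      by (rule has_field_derivative_transform_within_open[of _ _ _ "{..<0}"]) (use less in auto)
  next
    case greater
    have "((\<lambda>y. y\<^sup>2) has_real_derivative 2 * max 0 y) (at y)" using greater by (auto intro!: derivative_eq_intros)
    then show ?thesis
      by (rule has_field_derivative_transform_within_open[of _ _ _ "{0<..}"]) (use greater in auto)
  next
    case equal
    have "((\<lambda>h. (max 0 h)\<^sup>2 / h) \<longlongrightarrow> 0) (at (0::real))"
    proof (rule Lim_null_comparison)
      have "norm ((max 0 h)\<^sup>2 / h) \<le> \<bar>h\<bar>" for h :: real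
        by (cases "h > 0") (auto simp: power2_eq_square max_def)
      then show "\<forall>\<^sub>F h in at 0. norm ((max 0 h)\<^sup>2 / h) \<le> \<bar>h\<bar>" for h :: real by simp
      show "((\<lambda>h. \<bar>h\<bar>) \<longlongrightarrow> 0) (at (0::real))" by (rule tendsto_rabs_zero[OF tendsto_ident_at])
    qed
    then show ?thesis using equal by (simp add: has_field_derivative_iff)
  qed
  have "((\<lambda>x. (max 0 (a x - m))\<^sup>2) has_derivative (\<lambda>h. ((2 * max 0 (a x - m)) *\<^sub>R ga x) \<bullet> h)) (at x)" if "x \<in> \<Omega>" for x
  proof -
    have a: "((\<lambda>x. a x - m) has_derivative (\<lambda>h. ga x \<bullet> h)) (at x)"
      using assms that by (auto simp: C1_grad_def intro!: derivative_eq_intros)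
    have "((\<lambda>y. (max 0 y)\<^sup>2) has_derivative (\<lambda>h. 2 * max 0 (a x - m) * h)) (at (a x - m))"
      using sq[of "a x - m"] by (simp add: has_field_derivative_def)
    from has_derivative_compose[OF a this] show ?thesis by simp
  qed
  moreover have "continuous_on \<Omega> (\<lambda>x. (2 * max 0 (a x - m)) *\<^sub>R ga x)"
    using assms C1_grad_continuous[OF assms] by (auto simp: C1_grad_def intro!: continuous_intros)
  ultimately show ?thesis by (simp add: C1_grad_def)
qed

lemma circ_norm [simp]: "norm (circ 0 r t) = \<bar>r\<bar>"
  using dist_circ(1)[of 0 r t] by (simp add: dist_norm del: dist_circ)

lemma at_infinity_zeroD:
  fixes a :: "real^2 \<Rightarrow> real"
  assumes "(a \<longlongrightarrow> 0) at_infinity" "m > 0"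
  obtains R where "\<And>x. norm x \<ge> R \<Longrightarrow> \<bar>a x\<bar> < m"
  using tendstoD[OF assms] unfolding eventually_at_infinity by (auto simp: dist_real_def)

text \<open>The form \<open>da \<and> db\<close> has a sign; with the multiplier \<open>2 (a - m)\<^sup>+\<close> it becomes \<open>dG \<and> db\<close> for
  \<open>G = ((a - m)\<^sup>+)\<^sup>2\<close>, whose circle integrals vanish on both boundary circles.\<close>

lemma exterior_max_principle:
  assumes a: "C1_grad a ga {x. norm x > R0}" and b: "C1_grad b gb {x. norm x > R0}"
    and qr: "\<And>x. norm x > R0 \<Longrightarrow> cross2 (ga x) (gb x) \<le> - c * ((norm (ga x))\<^sup>2 + (norm (gb x))\<^sup>2)" and c: "c > 0"
    and lim: "(a \<longlongrightarrow> 0) at_infinity" and m: "m > 0" and s: "s > R0" "s > 0"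
    and bd: "\<And>x. norm x = s \<Longrightarrow> a x \<le> m"
    and x: "norm x \<ge> s"
  shows "a x \<le> m"
proof (cases "norm x = s")
  case False
  then have xs: "norm x > s" using x by simp
  obtain R1 where R1: "\<And>x. norm x \<ge> R1 \<Longrightarrow> \<bar>a x\<bar> < m" using at_infinity_zeroD[OF lim m] by blast
  define R2 where "R2 = max R1 (norm x) + 1"
  have R2: "R2 > norm x" "R2 \<ge> R1" by (auto simp: R2_def)
  define \<Omega> where "\<Omega> = {x::real^2. norm x > R0}"
  define G where "G x = (max 0 (a x - m))\<^sup>2" for x
  define gG where "gG x = (2 * max 0 (a x - m)) *\<^sub>R ga x" for x
  have G: "C1_grad G gG \<Omega>" unfolding G_def[abs_def] gG_def[abs_def] \<Omega>_def by (rule C1_grad_max_square[OF a])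
  \<comment> \<open>\<open>R0\<close> may be negative, whereas the sign of the derivative of
    \<open>W\<close> needs positive radii.\<close>
  define lo where "lo = max R0 0"
  have lo: "lo < s" using s by (auto simp: lo_def)
  interpret C1_pair_on_circles 0 lo "R2 + 1" \<Omega> G b gG gb
    by unfold_locales (use G b in \<open>auto simp: \<Omega>_def lo_def\<close>)
  define W where "W = wedge_int G gb 0"
  have sR: "r \<in> {lo<..<R2 + 1}" if "s \<le> r" "r \<le> R2" for r using that lo by auto
  define F where "F x = cross2 (gG x) (gb x)" for x
  have F: "F x \<le> 0" if "x \<in> \<Omega>" for x
  proof -
    have "F x = 2 * max 0 (a x - m) * cross2 (ga x) (gb x)"
      by (simp add: F_def gG_def cross2_def algebra_simps)
    moreover have "cross2 (ga x) (gb x) \<le> 0"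
      using qr[of x] c that unfolding \<Omega>_def by (smt (verit) mem_Collect_eq mult_minus_left mult_nonneg_nonneg zero_le_power2)
    ultimately show ?thesis by (simp add: mult_nonneg_nonpos)
  qed
  have cF: "continuous_on \<Omega> F"
    unfolding F_def[abs_def] cross2_def by (intro continuous_intros cont)
  have W': "(W has_real_derivative r * circ_int 0 r F) (at r)" if "s \<le> r" "r \<le> R2" for r
    using wedge_int_deriv[OF sR[OF that]] by (simp add: W_def F_def[abs_def])
  have intF: "circ_int 0 r F \<le> 0" if "s \<le> r" "r \<le> R2" for r
  proof -
    have "circ_int 0 r F \<le> circ_int 0 r (\<lambda>x. 0)"
      using F circ_in[OF sR[OF that]] cF by (intro circ_int_mono[of \<Omega>]) auto
    then show ?thesis by (simp add: circ_int_def)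
  qed
  have "G (circ 0 s t) = 0" "G (circ 0 R2 t) = 0" for t
    using bd[of "circ 0 s t"] R1[of "circ 0 R2 t"] R2 s xs by (auto simp: G_def)
  then have W0: "W s = 0" "W R2 = 0" by (simp_all add: W_def wedge_int_def)
  have Wz: "W r = 0" if r: "s \<le> r" "r \<le> R2" for r
  proof (rule antisym)
    have "W R2 \<le> W r"
    proof (rule DERIV_nonpos_imp_nonincreasing[OF r(2)])
      show "\<exists>y. (W has_real_derivative y) (at z) \<and> y \<le> 0" if "r \<le> z" "z \<le> R2" for z
        using W'[of z] intF[of z] that r s by (intro exI[of _ "z * circ_int 0 z F"]) (auto simp: mult_nonneg_nonpos)
    qed
    then show "0 \<le> W r" using W0 by simp
    have "W r \<le> W s"
    proof (rule DERIV_nonpos_imp_nonincreasing[OF r(1)])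
      show "\<exists>y. (W has_real_derivative y) (at z) \<and> y \<le> 0" if "s \<le> z" "z \<le> r" for z
        using W'[of z] intF[of z] that r s by (intro exI[of _ "z * circ_int 0 z F"]) (auto simp: mult_nonneg_nonpos)
    qed
    then show "W r \<le> 0" using W0 by simp
  qed
  \<comment> \<open>\<open>W\<close> is constant, so the integral of the nonpositive continuous
    \<open>F\<close> over each circle is 0 and \<open>F\<close> vanishes. Where \<open>a > m\<close>
    the Jacobian is then 0, and the quasiregular inequality makes \<open>ga\<close> vanish.\<close>
  have gG0: "gG (circ 0 r t) = 0" if r: "s < r" "r < R2" and t: "t \<in> {0..2*pi}" for r t
  proof -
    have rr: "s \<le> r" "r \<le> R2" using r by auto
    have "((\<lambda>_. 0) has_real_derivative r * circ_int 0 r F) (at r)"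
      by (rule has_field_derivative_transform_within_open[OF W'[OF rr], of "{s<..<R2}"]) (use r Wz in auto)
    then have "r * circ_int 0 r F = 0" using DERIV_const DERIV_unique by blast
    then have "integral {0..2*pi} (\<lambda>t. - F (circ 0 r t)) = 0" using r s by (simp add: circ_int_def)
    moreover have "continuous_on {0..2*pi} (\<lambda>t. - F (circ 0 r t))"
      by (intro continuous_intros continuous_on_circ_comp[OF cF] circ_in sR rr)
    ultimately have "- F (circ 0 r t) = 0"
      using integral_eq_0_iff[of 0 "2*pi" "\<lambda>t. - F (circ 0 r t)"] t F circ_in[OF sR[OF rr]] by simp
    moreover have "F (circ 0 r t) = 2 * max 0 (a (circ 0 r t) - m) * cross2 (ga (circ 0 r t)) (gb (circ 0 r t))"
      by (simp add: F_def gG_def cross2_def algebra_simps)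
    moreover have "ga (circ 0 r t) = 0" if "cross2 (ga (circ 0 r t)) (gb (circ 0 r t)) = 0"
    proof -
      have "0 \<le> - c * ((norm (ga (circ 0 r t)))\<^sup>2 + (norm (gb (circ 0 r t)))\<^sup>2)"
        using qr[of "circ 0 r t"] that r s by simp
      then have "(norm (ga (circ 0 r t)))\<^sup>2 + (norm (gb (circ 0 r t)))\<^sup>2 \<le> 0" using c by (simp add: mult_le_0_iff)
      then show ?thesis by (smt (verit) zero_le_power2 power2_eq_iff_nonneg norm_eq_zero zero_power2 norm_ge_zero)
    qed
    ultimately show ?thesis by (auto simp: gG_def)
  qed
  obtain t where t: "t \<in> {0..2*pi}" "x = circ 0 (norm x) t" using polar_R2[of x 0] by auto
  \<comment> \<open>The gradient of \<open>G\<close> vanishes in the open annulus, so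
    \<open>G\<close> keeps its value along the ray from \<open>x\<close> to radius
    \<open>R2\<close>, where \<open>a < m\<close>.\<close>
  have "G (circ 0 R2 t) = G (circ 0 (norm x) t)"
  proof (rule DERIV_isconst2[of "norm x" R2 "\<lambda>r. G (circ 0 r t)" R2])
    show "norm x < R2" by (rule R2)
    show "continuous_on {norm x..R2} (\<lambda>r. G (circ 0 r t))"
      by (rule DERIV_continuous_on[OF has_field_derivative_at_within[OF der_r(1)]]) (use x lo in auto)
    show "((\<lambda>r. G (circ 0 r t)) has_real_derivative 0) (at r)" if "norm x < r" "r < R2" for r
      using der_r(1)[of r t] gG0[of r t] that xs lo t by auto
  qed (use R2 in auto)
  moreover have "G (circ 0 R2 t) = 0" using R1[of "circ 0 R2 t"] R2 xs s by (auto simp: G_def max_def)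
  ultimately have "G x = 0" using t(2) by simp
  then show ?thesis by (auto simp: G_def max_def split: if_splits)
qed (use bd in auto)

text \<open>\<open>I\<close> is nonnegative since otherwise \<open>I\<^sup>2 \<le> C r (- I')\<close> would make it blow up at a finite radius; then
  \<open>\<beta> I \<le> r (- I')\<close> gives its decay. Adding \<open>r powr (- \<beta>)\<close> to \<open>I\<close> only serves to keep it positive, so that
  its square root is differentiable.\<close>

lemma quasiregular_decay:
  assumes a: "C1_grad a ga {x. norm x > R0}" and b: "C1_grad b gb {x. norm x > R0}"
    and qr: "\<And>x. norm x > R0 \<Longrightarrow> cross2 (ga x) (gb x) \<le> - c * ((norm (ga x))\<^sup>2 + (norm (gb x))\<^sup>2)" and c: "c > 0"
    and lim: "(a \<longlongrightarrow> 0) at_infinity"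
  shows "\<exists>C R. C > 0 \<and> R > 0 \<and> (\<forall>x. norm x \<ge> R \<longrightarrow> \<bar>a x\<bar> \<le> C * norm x powr (- (c / (2 * pi))))"
proof -
  obtain R1' where R1': "\<And>x. norm x \<ge> R1' \<Longrightarrow> \<bar>a x\<bar> < 1" using at_infinity_zeroD[OF lim, of 1] by auto
  define R1 where "R1 = Max {R1', R0, 1}"
  have R1: "R1 \<ge> R1'" "R1 \<ge> R0" "R1 \<ge> 1" by (auto simp: R1_def)
  define \<Omega> where "\<Omega> = {x::real^2. norm x > R0}"
  have P: "C1_pair_on_circles 0 R1 hi \<Omega> a b ga gb" for hi
    by unfold_locales (use a b R1 in \<open>auto simp: \<Omega>_def\<close>)
  define I where "I = wedge_int a gb 0"
  define e where "e = circ_energy ga gb 0"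
  define I' where "I' r = r * circ_int 0 r (\<lambda>x. cross2 (ga x) (gb x))" for r
  define M where "M r = circ_int 0 r a" for r
  define M' where "M' r = integral {0..2*pi} (\<lambda>t. ga (circ 0 r t) \<bullet> dir t)" for r
  \<comment> \<open>From \<open>c * (r * e r) \<le> - I' r\<close> and the isoperimetric bound of
    \<open>\<bar>I r\<bar>\<close> by \<open>pi * (r\<^sup>2 * e r)\<close>. Since \<open>a\<close>
    is controlled by the square root of \<open>I\<close>, it decays with exponent
    \<open>\<beta> / 2 = c / (2 * pi)\<close>.\<close>
  define \<beta> where "\<beta> = c / pi"
  have \<beta>: "\<beta> > 0" using c by (simp add: \<beta>_def)
  have cc: "continuous_on \<Omega> ga" "continuous_on \<Omega> gb" "continuous_on \<Omega> a" 
    using a b C1_grad_continuous[OF a] by (auto simp: C1_grad_def \<Omega>_def)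
  have dI: "(I has_real_derivative I' r) (at r)" if "r > R1" for r
    using C1_pair_on_circles.wedge_int_deriv[OF P[of "r+1"], of r] that by (simp add: I_def I'_def)
  have dM: "(M has_real_derivative M' r) (at r)" if "r > R1" for r
    using C1_pair_on_circles.mean_deriv[OF P[of "r+1"], of r] that by (simp add: M_def[abs_def] M'_def)
  have in\<Omega>: "circ 0 r t \<in> \<Omega>" if "r > R1" for r t using that R1 by (simp add: \<Omega>_def)
  have I'e: "c * (r * e r) \<le> - I' r" if "r > R1" for r
  proof -
    have "circ_int 0 r (\<lambda>x. cross2 (ga x) (gb x)) \<le> circ_int 0 r (\<lambda>x. - c * ((norm (ga x))\<^sup>2 + (norm (gb x))\<^sup>2))"
      using qr in\<Omega>[OF that] unfolding cross2_def
      by (intro circ_int_mono[of \<Omega>] continuous_intros cc) (auto simp: \<Omega>_def cross2_def)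
    also have "\<dots> = - c * e r" by (simp add: circ_int_def e_def circ_energy_def)
    finally have "r * circ_int 0 r (\<lambda>x. cross2 (ga x) (gb x)) \<le> r * (- c * e r)" using that R1 by (intro mult_left_mono) auto
    then show ?thesis by (simp add: I'_def algebra_simps)
  qed
  have e0: "e r \<ge> 0" if "r > R1" for r
    using C1_pair_on_circles.energy_nonneg[OF P[of "r+1"], of r] that by (simp add: e_def)
  have I'0: "I' r \<le> 0" if "r > R1" for r
    using I'e[OF that] e0[OF that] c that R1 by (smt (verit) mult_nonneg_nonneg)
  have iso: "\<beta> * \<bar>I r\<bar> \<le> r * (- I' r)" if "r > R1" for r
  proof -
    have "\<beta> * \<bar>I r\<bar> \<le> \<beta> * (pi * (r\<^sup>2 * e r))"
      using C1_pair_on_circles.wedge_int_le[OF P[of "r+1"], of r] that \<beta> by (intro mult_left_mono) (auto simp: I_def e_def)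
    also have "\<dots> = r * (c * (r * e r))" by (simp add: \<beta>_def power2_eq_square)
    also have "\<dots> \<le> r * (- I' r)" using I'e[OF that] that R1 by (intro mult_left_mono) auto
    finally show ?thesis .
  qed
  have sq: "c * (I r)\<^sup>2 \<le> 2 * pi * (r * (- I' r))" if "r > R1" for r
  proof -
    have "circ_int 0 r (\<lambda>x. (a x)\<^sup>2) \<le> circ_int 0 r (\<lambda>x. 1)"
    proof (intro circ_int_mono[of \<Omega>] continuous_intros cc in\<Omega> that)
      show "(a x)\<^sup>2 \<le> 1" if "x \<in> \<Omega>" "dist 0 x = \<bar>r\<bar>" for x
        using R1'[of x] that \<open>r > R1\<close> R1 by (simp add: dist_norm abs_square_le_1)
    qed
    then have N: "circ_int 0 r (\<lambda>x. (a x)\<^sup>2) \<le> 2 * pi" by (simp add: circ_int_def)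
    have "c * (I r)\<^sup>2 \<le> c * (circ_int 0 r (\<lambda>x. (a x)\<^sup>2) * (r\<^sup>2 * e r))"
      using C1_pair_on_circles.wedge_int_sq_le[OF P[of "r+1"], of r] that c by (intro mult_left_mono) (auto simp: I_def e_def)
    also have "\<dots> \<le> c * (2 * pi * (r\<^sup>2 * e r))"
      using N c e0[OF that] by (intro mult_left_mono mult_right_mono) auto
    also have "\<dots> = 2 * pi * (r * (c * (r * e r)))" by (simp add: power2_eq_square)
    also have "\<dots> \<le> 2 * pi * (r * (- I' r))" using I'e[OF that] that R1 by (intro mult_left_mono) auto
    finally show ?thesis .
  qed
  have I_mono: "I s \<le> I r" if "R1 < r" "r \<le> s" for r s
    by (rule DERIV_nonpos_imp_nonincreasing[OF that(2)]) (use dI I'0 that in \<open>meson less_le_trans\<close>)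
  have I_nonneg: "I r0 \<ge> 0" if r0: "r0 > R1" for r0
  proof (rule ccontr)
    assume "\<not> I r0 \<ge> 0"
    then have neg: "I r < 0" if "r \<ge> r0" for r using I_mono[of r0 r] r0 that by linarith
    define k where "k = c / (2 * pi)"
    have k: "k > 0" using c by (simp add: k_def)
    \<comment> \<open>As long as \<open>I\<close> is negative, \<open>1 / I r - k * ln r\<close> is
      nondecreasing. \<open>X\<close> is chosen so that this would give
      \<open>1 / I r \<ge> 1\<close> at \<open>r = r0 * exp X\<close>.\<close>
    define X where "X = (1 - 1 / I r0) / k"
    have "1 / I r0 < 0" using neg[of r0] by simp
    then have X: "X > 0" using k by (simp add: X_def)
    define r where "r = r0 * exp X"
    have r: "r \<ge> r0" using r0 R1 X by (simp add: r_def)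
    have "1 / I r0 - k * ln r0 \<le> 1 / I r - k * ln r"
    proof (rule DERIV_nonneg_imp_nondecreasing[OF r])
      fix z assume z: "r0 \<le> z" "z \<le> r"
      have z1: "z > R1" "z > 0" "I z \<noteq> 0" using z r0 R1 neg[of z] by auto
      have "((\<lambda>r. 1 / I r - k * ln r) has_real_derivative (- I' z / (I z)\<^sup>2 - k / z)) (at z)"
        using z1 by (auto intro!: derivative_eq_intros dI simp: power2_eq_square)
      moreover have "k / z \<le> - I' z / (I z)\<^sup>2"
        using sq[OF z1(1)] z1 by (simp add: k_def field_simps)
      ultimately show "\<exists>y. ((\<lambda>r. 1 / I r - k * ln r) has_real_derivative y) (at z) \<and> 0 \<le> y" by force
    qed
    also have "k * ln r = k * ln r0 + k * X" using r0 R1 by (simp add: r_def ln_mult algebra_simps)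
    also have "k * X = 1 - 1 / I r0" using k by (simp add: X_def)
    finally have "1 / I r \<ge> 1" by simp
    then show False using neg[OF r] by (smt (verit) divide_pos_neg)
  qed
  define R2 where "R2 = R1 + 1"
  define A where "A = R2 powr \<beta> * I R2 + 1"
  have A: "A > 0" using I_nonneg[of R2] by (simp add: A_def R2_def add_nonneg_pos)
  have I_decay: "I r + r powr (- \<beta>) \<le> A * r powr (- \<beta>)" if "r \<ge> R2" for r
  proof -
    have "r powr \<beta> * I r \<le> R2 powr \<beta> * I R2"
    proof (rule DERIV_nonpos_imp_nonincreasing[OF that])
      fix z assume z: "R2 \<le> z" "z \<le> r"
      have z1: "z > R1" "z > 0" using z R1 by (auto simp: R2_def)
      have "((\<lambda>r. r powr \<beta> * I r) has_real_derivative (\<beta> * z powr (\<beta> - 1) * I z + z powr \<beta> * I' z)) (at z)"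
        using z1 by (auto intro!: derivative_eq_intros dI)
      moreover have "\<beta> * z powr (\<beta> - 1) * I z + z powr \<beta> * I' z = z powr (\<beta> - 1) * (\<beta> * I z - z * (- I' z))"
        using z1 by (simp add: powr_diff field_simps)
      moreover have "\<dots> \<le> 0" using iso[OF z1(1)] I_nonneg[OF z1(1)] by (intro mult_nonneg_nonpos) auto
      ultimately show "\<exists>y. ((\<lambda>r. r powr \<beta> * I r) has_real_derivative y) (at z) \<and> y \<le> 0" by force
    qed
    then have "(r powr \<beta> * I r + 1) * r powr (- \<beta>) \<le> A * r powr (- \<beta>)" by (intro mult_right_mono) (auto simp: A_def)
    moreover have "r powr \<beta> * r powr (- \<beta>) = 1" using that R1 by (simp add: R2_def flip: powr_add)
    ultimately show ?thesis by (simp add: algebra_simps)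
  qed
  define J where "J r = I r + r powr (- \<beta>)" for r
  define J' where "J' r = I' r - \<beta> * r powr (- \<beta> - 1)" for r
  have J0: "J r > 0" if "r > R1" for r using I_nonneg[OF that] that R1 by (simp add: J_def add_nonneg_pos)
  have dJ: "(J has_real_derivative J' r) (at r)" if "r > R1" for r
    unfolding J_def[abs_def] J'_def using that R1 by (auto intro!: derivative_eq_intros dI)
  have J'0: "J' r \<le> I' r" for r using \<beta> by (simp add: J'_def)
  have Jiso: "\<beta> * J r \<le> r * (- J' r)" if "r > R1" for r
  proof -
    have "r * r powr (- \<beta> - 1) = r powr (- \<beta>)" using that R1 by (simp add: powr_diff)
    then have "r * (- J' r) = r * (- I' r) + \<beta> * r powr (- \<beta>)" by (simp add: J'_def algebra_simps)
    then show ?thesis using iso[OF that] I_nonneg[OF that] by (simp add: J_def algebra_simps)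
  qed
  \<comment> \<open>The right-hand side of \<open>M'le\<close> is the derivative of
    \<open>- 2 * K * sqrt (J r)\<close>. Integration from infinity, where \<open>M\<close> and
    \<open>J\<close> tend to 0, thus bounds the mean by \<open>2 * K * sqrt (J r)\<close>.\<close>
  define K where "K = sqrt (2 * pi / (c * \<beta>))"
  have K: "K > 0" using c \<beta> by (simp add: K_def)
  have M'le: "\<bar>M' r\<bar> \<le> K * (- J' r) / sqrt (J r)" if "r > R1" for r
  proof -
    have r: "r > 0" using that R1 by simp
    have neg: "- J' r \<ge> 0" using J'0[of r] I'0[OF that] by linarith
    have "(M' r)\<^sup>2 \<le> 2 * pi * e r"
      using C1_pair_on_circles.mean_deriv_le[OF P[of "r+1"], of r] that by (simp add: M'_def e_def)
    then have "\<beta> * J r * (c * (M' r)\<^sup>2) \<le> \<beta> * J r * (c * (2 * pi * e r))"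
      using c \<beta> J0[OF that] by (intro mult_left_mono) auto
    also have "\<dots> = 2 * pi * (c * e r) * (\<beta> * J r)" by simp
    also have "\<dots> \<le> 2 * pi * (c * e r) * (r * (- J' r))"
      using Jiso[OF that] c e0[OF that] by (intro mult_left_mono) auto
    also have "\<dots> = 2 * pi * (- J' r) * (c * (r * e r))" by simp
    also have "\<dots> \<le> 2 * pi * (- J' r) * (- J' r)"
      using I'e[OF that] J'0[of r] neg by (intro mult_left_mono mult_nonneg_nonneg) auto
    finally have "(c * \<beta>) * ((M' r)\<^sup>2 * J r) \<le> 2 * pi * (J' r)\<^sup>2" by (simp add: power2_eq_square mult_ac)
    then have "(M' r)\<^sup>2 * J r \<le> 2 * pi / (c * \<beta>) * (J' r)\<^sup>2" using c \<beta> by (simp add: field_simps)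
    also have "\<dots> = (K * (- J' r))\<^sup>2" using c \<beta> by (simp add: K_def power_mult_distrib)
    finally have "(\<bar>M' r\<bar> * sqrt (J r))\<^sup>2 \<le> (K * (- J' r))\<^sup>2" using J0[OF that] by (simp add: power_mult_distrib)
    moreover have "0 \<le> K * (- J' r)" using K neg by (intro mult_nonneg_nonneg) auto
    ultimately have "\<bar>M' r\<bar> * sqrt (J r) \<le> K * (- J' r)" by (rule power2_le_imp_le)
    then show ?thesis using J0[OF that] by (subst pos_le_divide_eq) auto
  qed
  have Jlim: "(J \<longlongrightarrow> 0) at_top"
  proof (rule tendsto_sandwich)
    show "\<forall>\<^sub>F r in at_top. 0 \<le> J r" using eventually_gt_at_top[of R1] by eventually_elim (use J0 less_imp_le in blast)
    show "\<forall>\<^sub>F r in at_top. J r \<le> A * r powr (- \<beta>)" using eventually_ge_at_top[of R2] by eventually_elim (use I_decay J_def in auto)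
    show "((\<lambda>r. A * r powr (- \<beta>)) \<longlongrightarrow> 0) at_top"
      using tendsto_mult_right_zero[OF tendsto_neg_powr[OF _ filterlim_ident], of "- \<beta>"] \<beta> by simp
  qed simp
  have Mlim: "(M \<longlongrightarrow> 0) at_top"
  proof (rule tendstoI)
    fix \<epsilon> :: real assume "\<epsilon> > 0"
    then obtain R3 where R3: "\<And>x. norm x \<ge> R3 \<Longrightarrow> \<bar>a x\<bar> < \<epsilon> / (4 * pi)" using at_infinity_zeroD[OF lim, of "\<epsilon> / (4 * pi)"] by auto
    show "\<forall>\<^sub>F r in at_top. dist (M r) 0 < \<epsilon>" using eventually_gt_at_top[of "max R1 R3"]
    proof eventually_elim
      case (elim r)
      have "\<bar>M r\<bar> \<le> integral {0..2*pi} (\<lambda>_. \<epsilon> / (4 * pi))"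
        unfolding M_def circ_int_def real_norm_def[symmetric]
      proof (intro integral_norm_bound_integral integrable_continuous_real continuous_on_circ_comp[OF cc(3)] in\<Omega>)
        show "norm (a (circ 0 r t)) \<le> \<epsilon> / (4 * pi)" for t using R3[of "circ 0 r t"] elim R1(3) by auto
      qed (use elim in auto)
      then show ?case using \<open>\<epsilon> > 0\<close> by (simp add: dist_real_def)
    qed
  qed
  have Mle: "\<bar>M r\<bar> \<le> 2 * K * sqrt (J r)" if r: "r > R1" for r
  proof -
    have dsq: "((\<lambda>r. 2 * K * sqrt (J r)) has_real_derivative K * J' z / sqrt (J z)) (at z)" if "z > R1" for z
      using J0[OF that] dJ[OF that] by (auto intro!: derivative_eq_intros simp: field_simps)
    have sg: "0 \<le> \<sigma> * M r + 2 * K * sqrt (J r)" if \<sigma>: "\<bar>\<sigma>\<bar> = 1" for \<sigma>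
    proof (rule tendsto_upperbound)
      show "((\<lambda>s. \<sigma> * M s + 2 * K * sqrt (J s)) \<longlongrightarrow> 0) at_top"
        using tendsto_add[OF tendsto_mult_right_zero[OF Mlim] tendsto_mult_right_zero[OF tendsto_real_sqrt[OF Jlim, simplified]]] by simp
      show "\<forall>\<^sub>F s in at_top. \<sigma> * M s + 2 * K * sqrt (J s) \<le> \<sigma> * M r + 2 * K * sqrt (J r)"
        using eventually_ge_at_top[of r]
      proof eventually_elim
        case (elim s)
        show ?case
        proof (rule DERIV_nonpos_imp_nonincreasing[OF elim])
          fix z assume z: "r \<le> z" "z \<le> s"
          then have zR: "z > R1" using r by simp
          have "((\<lambda>s. \<sigma> * M s + 2 * K * sqrt (J s)) has_real_derivative \<sigma> * M' z + K * J' z / sqrt (J z)) (at z)"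
            by (intro DERIV_add DERIV_cmult dM dsq zR)
          moreover have "\<sigma> * M' z \<le> \<bar>M' z\<bar>" using \<sigma> by (metis abs_ge_self abs_mult mult_1)
          moreover have "K * (- J' z) / sqrt (J z) = - (K * J' z / sqrt (J z))" by simp
          ultimately show "\<exists>y. ((\<lambda>s. \<sigma> * M s + 2 * K * sqrt (J s)) has_real_derivative y) (at z) \<and> y \<le> 0"
            using M'le[OF zR] by (intro exI[of _ "\<sigma> * M' z + K * J' z / sqrt (J z)"]) auto
        qed
      qed
    qed simp
    show ?thesis using sg[of 1] sg[of "-1"] by simp
  qed
  define C0 where "C0 = K * sqrt A / pi + sqrt (4 * pi / c * A) + 1"
  have C0: "C0 > 0" using K A c by (auto simp: C0_def intro!: add_nonneg_pos)
  have main: "\<bar>a x\<bar> \<le> C0 * r powr (- (\<beta> / 2))" if r: "r \<ge> R2" and x: "norm x \<ge> 2 * r" for r x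
  proof -
    have r1: "r > R1" "r > 0" using r R1 by (auto simp: R2_def)
    \<comment> \<open>On a circle given by the mean value theorem \<open>- I' s\<close> is at most
      \<open>I r / r\<close>, because \<open>I (2 * r)\<close> is nonnegative; this bounds the
      energy there.\<close>
    obtain s where s: "r < s" "s < 2 * r" "I (2 * r) - I r = (2 * r - r) * I' s"
      using MVT2[of r "2 * r" I I'] r1 dI by auto
    have s1: "s > R1" "s \<ge> R2" using s r1 r by auto
    have "I (2 * r) \<ge> 0" using I_nonneg[of "2 * r"] r1 by simp
    then have "r * (- I' s) \<le> I r" using s(3) by simp
    have "c * (s\<^sup>2 * e s) = s * (c * (s * e s))" by (simp add: power2_eq_square)
    also have "\<dots> \<le> (2 * r) * (- I' s)" using I'e[OF s1(1)] I'0[OF s1(1)] s r1 c e0[OF s1(1)] by (intro mult_mono) auto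
    also have "\<dots> \<le> 2 * I r" using \<open>r * (- I' s) \<le> I r\<close> by simp
    finally have es: "s\<^sup>2 * e s \<le> 2 * I r / c" using c by (simp add: field_simps)
    have Ir: "I r \<le> A * r powr (- \<beta>)" using I_decay[OF r] powr_ge_zero[of r "- \<beta>"] by linarith
    have sqr: "sqrt (r powr (- \<beta>)) = r powr (- (\<beta> / 2))" using r1 by (simp add: powr_half_sqrt[symmetric] powr_powr)
    have "2 * pi * (s\<^sup>2 * e s) \<le> 2 * pi * (2 * (A * r powr (- \<beta>)) / c)"
      using es Ir c by (intro mult_left_mono order_trans[OF es] divide_right_mono) auto
    also have "\<dots> = (4 * pi / c * A) * r powr (- \<beta>)" by simp
    finally have es': "sqrt (2 * pi * (s\<^sup>2 * e s)) \<le> sqrt (4 * pi / c * A) * r powr (- (\<beta> / 2))"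
      unfolding sqr[symmetric] real_sqrt_mult[symmetric] by simp
    have "J s \<le> A * r powr (- \<beta>)"
    proof -
      have "J s \<le> A * s powr (- \<beta>)" using I_decay[OF s1(2)] by (simp add: J_def)
      also have "\<dots> \<le> A * r powr (- \<beta>)" using s r1 \<beta> A by (intro mult_left_mono powr_mono2') auto
      finally show ?thesis .
    qed
    then have "sqrt (J s) \<le> sqrt A * r powr (- (\<beta> / 2))"
      unfolding sqr[symmetric] real_sqrt_mult[symmetric] by simp
    then have "2 * K * sqrt (J s) \<le> 2 * K * (sqrt A * r powr (- (\<beta> / 2)))" using K by (intro mult_left_mono) auto
    then have Ms: "\<bar>M s\<bar> / (2 * pi) \<le> (2 * K * (sqrt A * r powr (- (\<beta> / 2)))) / (2 * pi)" 
      using Mle[OF s1(1)] by (intro divide_right_mono) auto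
    have bnd: "\<bar>M s\<bar> / (2 * pi) + sqrt (2 * pi * (s\<^sup>2 * e s)) \<le> C0 * r powr (- (\<beta> / 2))"
    proof -
      have "(2 * K * (sqrt A * r powr (- (\<beta> / 2)))) / (2 * pi) = K * sqrt A / pi * r powr (- (\<beta> / 2))" by simp
      then show ?thesis using es' Ms powr_ge_zero[of r "- (\<beta> / 2)"]
        unfolding C0_def distrib_right by linarith
    qed
    have sup: "\<bar>a y\<bar> \<le> C0 * r powr (- (\<beta> / 2))" if y: "norm y = s" for y
    proof -
      obtain t where t: "t \<in> {0..2*pi}" "y = circ 0 (norm y) t" using polar_R2[of y 0] by auto
      have "\<bar>a (circ 0 s t)\<bar> \<le> \<bar>M s\<bar> / (2 * pi) + sqrt (2 * pi * (s\<^sup>2 * e s))"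
        using C1_pair_on_circles.sup_le_mean[OF P[of "s+1"], of s t] s1 t by (simp add: M_def e_def)
      then show ?thesis using bnd t y by simp
    qed
    have pos: "C0 * r powr (- (\<beta> / 2)) > 0" using C0 r1 by simp
    have s2: "R0 < s" "0 < s" "s \<le> norm x" using s1 R1 s x r1 by auto
    have "a x \<le> C0 * r powr (- (\<beta> / 2))"
      by (rule exterior_max_principle[OF a b qr c lim pos s2(1,2) _ s2(3)]) (use sup in \<open>auto simp: abs_le_iff\<close>)
    \<comment> \<open>The pair \<open>(- a, - b)\<close> has the same Jacobian as
      \<open>(a, b)\<close>.\<close>
    moreover have "- a x \<le> C0 * r powr (- (\<beta> / 2))"
    proof (rule exterior_max_principle[OF C1_grad_minus[OF a] C1_grad_minus[OF b] _ c _ pos s2(1,2) _ s2(3)])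
      show "cross2 (- ga x) (- gb x) \<le> - c * ((norm (- ga x))\<^sup>2 + (norm (- gb x))\<^sup>2)" if "norm x > R0" for x
        using qr[OF that] by (simp add: cross2_def)
      show "((\<lambda>x. - a x) \<longlongrightarrow> 0) at_infinity" using tendsto_minus[OF lim] by simp
    qed (use sup in \<open>auto simp: abs_le_iff\<close>)
    ultimately show ?thesis by (simp add: abs_le_iff)
  qed
  show ?thesis
  proof (intro exI conjI allI impI)
    show "C0 * 2 powr (\<beta> / 2) > 0" "2 * R2 > 0" using C0 R1 by (auto simp: R2_def)
    fix x :: "real^2" assume x: "norm x \<ge> 2 * R2"
    have "\<bar>a x\<bar> \<le> C0 * (norm x / 2) powr (- (\<beta> / 2))" using x by (intro main) auto
    also have "\<dots> = C0 * 2 powr (\<beta> / 2) * norm x powr (- (c / (2 * pi)))"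
      by (simp add: powr_divide powr_minus_divide \<beta>_def field_simps)
    finally show "\<bar>a x\<bar> \<le> C0 * 2 powr (\<beta> / 2) * norm x powr (- (c / (2 * pi)))" .
  qed
qed

section \<open>Interior estimates\<close>

context C1_pair_on_circles
begin

text \<open>The crux is \<open>Y \<le> \<kappa> r Y'\<close> for the energy \<open>Y\<close>: it turns the bound \<open>M' \<le> C sqrt (Y' / r)\<close>
  for the circle means \<open>M\<close> into \<open>M' \<le> C' (sqrt Y)'\<close>, which integrates up to the centre.\<close>

lemma centre_le:
  fixes V V' :: "real \<Rightarrow> real"
  assumes rad: "lo < 0" "0 < \<rho>" "2 * \<rho> < hi" and pos: "q > 0" "G > 0" "B > 0"
    and qr: "\<And>x. x \<in> \<Omega> \<Longrightarrow> cross2 (ga x) (gb x) \<le> - q * ((norm (ga x))\<^sup>2 + (norm (gb x))\<^sup>2) + G"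
    and V: "\<And>r. 0 \<le> r \<Longrightarrow> r \<le> 2 * \<rho> \<Longrightarrow> (V has_real_derivative V' r) (at r)"
    and N: "\<And>r. 0 \<le> r \<Longrightarrow> r \<le> 2 * \<rho> \<Longrightarrow> r * circ_int c r (\<lambda>x. (a x)\<^sup>2) \<le> V' r"
    and VB: "V (2 * \<rho>) - V 0 \<le> B"
  defines "K \<equiv> sqrt (2 * pi * (pi / q + 1) / q)"
  shows "2 * pi * \<bar>a c\<bar> \<le> sqrt (8 * pi * B) / \<rho> + 2 * K * sqrt (16 * pi * G * \<rho>\<^sup>2 + 4 * B / (q * \<rho>\<^sup>2))"
proof -
  define e where "e = circ_energy ga gb c"
  \<comment> \<open>The term \<open>lam * r\<^sup>2\<close> in \<open>Y\<close> absorbs the defect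
    \<open>G\<close>: half of its derivative cancels \<open>r\<close> times the circle integral of
    \<open>G\<close>, the other half keeps \<open>Y'\<close> above \<open>lam * r\<close> and makes
    \<open>Y\<close> positive for positive radii.\<close>
  define lam where "lam = 2 * pi * G"
  have lam: "lam > 0" using pos by (simp add: lam_def)
  define Y where "Y r = lam * r\<^sup>2 - wedge_int a gb c r" for r
  define Y' where "Y' r = 2 * lam * r - r * circ_int c r (\<lambda>x. cross2 (ga x) (gb x))" for r
  define M where "M r = circ_int c r a" for r
  define M' where "M' r = integral {0..2*pi} (\<lambda>t. ga (circ c r t) \<bullet> dir t)" for r
  define \<kappa> where "\<kappa> = pi / q + 1"
  have \<kappa>: "\<kappa> > 0" using pos by (simp add: \<kappa>_def add_pos_pos)
  have K: "K > 0" "K\<^sup>2 = 2 * pi * \<kappa> / q" using \<kappa> pos by (simp_all add: K_def \<kappa>_def[symmetric])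
  have rr: "r \<in> {lo<..<hi}" if "0 \<le> r" "r \<le> 2 * \<rho>" for r using that rad by auto
  have dY: "(Y has_real_derivative Y' r) (at r)" if "0 \<le> r" "r \<le> 2 * \<rho>" for r
    unfolding Y_def[abs_def] Y'_def by (auto intro!: derivative_eq_intros wedge_int_deriv rr that)
  have dM: "(M has_real_derivative M' r) (at r)" if "0 \<le> r" "r \<le> 2 * \<rho>" for r
    using mean_deriv[OF rr[OF that]] by (simp add: M_def[abs_def] M'_def)
  have e0: "e r \<ge> 0" if "0 \<le> r" "r \<le> 2 * \<rho>" for r using energy_nonneg[OF rr[OF that]] by (simp add: e_def)
  have Y'e: "q * (r * e r) + lam * r \<le> Y' r" if "0 \<le> r" "r \<le> 2 * \<rho>" for r
  proof -
    have "circ_int c r (\<lambda>x. cross2 (ga x) (gb x)) \<le> circ_int c r (\<lambda>x. - q * ((norm (ga x))\<^sup>2 + (norm (gb x))\<^sup>2) + G)"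
      using qr circ_in[OF rr[OF that]] unfolding cross2_def
      by (intro circ_int_mono[of \<Omega>] continuous_intros cont) (auto simp: cross2_def)
    also have "\<dots> = circ_int c r (\<lambda>x. - q * ((norm (ga x))\<^sup>2 + (norm (gb x))\<^sup>2)) + circ_int c r (\<lambda>x. G)"
      unfolding circ_int_def
      by (intro integral_add integrable_continuous_real continuous_intros
          continuous_on_circ_comp[OF cont(3) circ_in[OF rr[OF that]]] continuous_on_circ_comp[OF cont(4) circ_in[OF rr[OF that]]])
    also have "\<dots> = - q * e r + lam" by (simp add: circ_int_def e_def circ_energy_def lam_def)
    finally have "r * circ_int c r (\<lambda>x. cross2 (ga x) (gb x)) \<le> r * (- q * e r + lam)" using that by (intro mult_left_mono) auto
    then show ?thesis by (simp add: Y'_def algebra_simps)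
  qed
  have Y'0: "Y' r \<ge> 0" "q * (r * e r) \<le> Y' r" "lam * r \<le> Y' r" if "0 \<le> r" "r \<le> 2 * \<rho>" for r
  proof -
    have "0 \<le> q * (r * e r)" "0 \<le> lam * r" using e0[OF that] that pos lam by auto
    then show "Y' r \<ge> 0" "q * (r * e r) \<le> Y' r" "lam * r \<le> Y' r" using Y'e[OF that] by linarith+
  qed
  have Ypos: "Y r > 0" if "0 < r" "r \<le> 2 * \<rho>" for r
  proof -
    have "Y 0 - lam * 0\<^sup>2 / 2 \<le> Y r - lam * r\<^sup>2 / 2"
    proof (rule DERIV_nonneg_imp_nondecreasing[where f = "\<lambda>r. Y r - lam * r\<^sup>2 / 2" and a = 0 and b = r])
      fix z assume z: "0 \<le> z" "z \<le> r"
      have "((\<lambda>r. Y r - lam * r\<^sup>2 / 2) has_real_derivative Y' z - lam * z) (at z)"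
        using z that by (auto intro!: derivative_eq_intros dY)
      then show "\<exists>y. ((\<lambda>r. Y r - lam * r\<^sup>2 / 2) has_real_derivative y) (at z) \<and> 0 \<le> y"
        using Y'0(3)[of z] z that by (intro exI[of _ "Y' z - lam * z"]) auto
    qed (use that in simp)
    moreover have "Y 0 = 0" by (simp add: Y_def wedge_int_def)
    moreover have "lam * r\<^sup>2 > 0" using lam that by simp
    ultimately show ?thesis by simp
  qed
  have Ymono: "Y r \<le> Y s" if "0 \<le> r" "r \<le> s" "s \<le> 2 * \<rho>" for r s
    by (rule DERIV_nonneg_imp_nondecreasing[OF that(2)]) (use dY Y'0(1) that in \<open>meson order_trans\<close>)
  have Yiso: "Y r \<le> \<kappa> * (r * Y' r)" if r: "0 \<le> r" "r \<le> 2 * \<rho>" for r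
  proof -
    have "- wedge_int a gb c r \<le> pi * (r\<^sup>2 * e r)" using wedge_int_le[OF rr[OF r]] by (simp add: e_def abs_le_iff)
    also have "\<dots> = pi / q * (r * (q * (r * e r)))" using pos by (simp add: power2_eq_square)
    also have "\<dots> \<le> pi / q * (r * Y' r)" using Y'0(2)[OF r] r pos by (intro mult_left_mono) auto
    finally have 1: "- wedge_int a gb c r \<le> pi / q * (r * Y' r)" .
    have 2: "lam * r\<^sup>2 \<le> r * Y' r" using mult_left_mono[OF Y'0(3)[OF r] r(1)] by (simp add: power2_eq_square mult_ac)
    show ?thesis using 1 2 by (simp add: Y_def \<kappa>_def algebra_simps)
  qed
  \<comment> \<open>Increments of \<open>V\<close> dominate the integrals of the square of
    \<open>a\<close> over annuli, so \<open>V\<close> takes the place of an area integral and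
    \<open>B\<close> that of its bound.\<close>
  have V'0: "V' r \<ge> 0" if r: "0 \<le> r" "r \<le> 2 * \<rho>" for r
  proof -
    have "0 \<le> circ_int c r (\<lambda>x. (a x)\<^sup>2)" unfolding circ_int_def
      by (intro integral_nonneg integrable_continuous_real continuous_intros continuous_on_circ_comp[OF cont(1) circ_in[OF rr[OF r]]]) simp
    then have "0 \<le> r * circ_int c r (\<lambda>x. (a x)\<^sup>2)" using r by simp
    then show ?thesis using N[OF r] by linarith
  qed
  have Vmono: "V r \<le> V s" if "0 \<le> r" "r \<le> s" "s \<le> 2 * \<rho>" for r s
    by (rule DERIV_nonneg_imp_nondecreasing[OF that(2)]) (use V V'0 that in \<open>meson order_trans\<close>)
  have W2: "(wedge_int a gb c r)\<^sup>2 * q \<le> V' r * Y' r" if r: "0 \<le> r" "r \<le> 2 * \<rho>" for r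
  proof -
    have "(wedge_int a gb c r)\<^sup>2 * q \<le> (circ_int c r (\<lambda>x. (a x)\<^sup>2) * (r\<^sup>2 * e r)) * q"
      using wedge_int_sq_le[OF rr[OF r]] pos by (intro mult_right_mono) (auto simp: e_def)
    also have "\<dots> = (r * circ_int c r (\<lambda>x. (a x)\<^sup>2)) * (q * (r * e r))" by (simp add: power2_eq_square mult_ac)
    also have "\<dots> \<le> V' r * Y' r"
      using N[OF r] Y'0[OF r] V'0[OF r] e0[OF r] r pos by (intro mult_mono) auto
    finally show ?thesis .
  qed
  have Y\<rho>: "Y \<rho> \<le> 8 * lam * \<rho>\<^sup>2 + 4 * B / (q * \<rho>\<^sup>2)"
  proof (cases "Y \<rho> \<le> 8 * lam * \<rho>\<^sup>2")
    case True
    then show ?thesis using pos rad by (smt (verit) divide_nonneg_nonneg mult_nonneg_nonneg zero_le_power2)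
  next
    case False
    text \<open>\<open>q Y\<^sup>2 \<le> 4 V' Y'\<close> bounds the derivative of \<open>- 1 / Y\<close> below by \<open>q / (4 V')\<close>, and
      \<open>1 / V' \<ge> 2 / a0 - V' / a0\<^sup>2\<close> can be integrated.\<close>
    define a0 where "a0 = B / \<rho>"
    have a0: "a0 > 0" using pos rad by (simp add: a0_def)
    have "- (1 / Y \<rho>) - q / 4 * (2 * \<rho> / a0 - V \<rho> / a0\<^sup>2) \<le> - (1 / Y (2 * \<rho>)) - q / 4 * (2 * (2 * \<rho>) / a0 - V (2 * \<rho>) / a0\<^sup>2)"
    proof (rule DERIV_nonneg_imp_nondecreasing[where f = "\<lambda>r. - (1 / Y r) - q / 4 * (2 * r / a0 - V r / a0\<^sup>2)" and a = \<rho> and b = "2 * \<rho>"])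
      fix z assume z: "\<rho> \<le> z" "z \<le> 2 * \<rho>"
      have z0: "0 \<le> z" "z \<le> 2 * \<rho>" "Y z > 0" using z rad Ypos[of z] by auto
      \<comment> \<open>Since \<open>z \<le> 2 * \<rho>\<close>, the constant 8 in the case
        distinction makes \<open>lam * z\<^sup>2\<close> at most half of \<open>Y z\<close>; the
        wedge integral supplies the other half.\<close>
      have "z\<^sup>2 \<le> (2 * \<rho>)\<^sup>2" using z z0 by (intro power_mono) auto
      then have "2 * (lam * z\<^sup>2) \<le> 8 * lam * \<rho>\<^sup>2" using lam by (simp add: power_mult_distrib)
      then have "2 * (lam * z\<^sup>2) \<le> Y z" using False Ymono[of \<rho> z] z rad by linarith
      then have "Y z / 2 \<le> - wedge_int a gb c z" by (simp add: Y_def)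
      then have "(Y z / 2)\<^sup>2 \<le> (- wedge_int a gb c z)\<^sup>2" using z0 by (intro power_mono) auto
      then have "(Y z)\<^sup>2 * q \<le> 4 * ((wedge_int a gb c z)\<^sup>2 * q)" using pos by (simp add: power_divide)
      then have YV: "(Y z)\<^sup>2 * q \<le> 4 * (V' z * Y' z)" using W2[OF z0(1,2)] by linarith
      have am: "V' z * (2 * a0 - V' z) \<le> a0\<^sup>2"
        using zero_le_power2[of "V' z - a0"] by (simp add: power2_eq_square algebra_simps)
      have key: "(Y z)\<^sup>2 * q * (2 * a0 - V' z) \<le> 4 * Y' z * a0\<^sup>2"
      proof (cases "2 * a0 - V' z \<le> 0")
        case True
        then have "(Y z)\<^sup>2 * q * (2 * a0 - V' z) \<le> 0" using pos by (intro mult_nonneg_nonpos) auto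
        moreover have "0 \<le> 4 * Y' z * a0\<^sup>2" using Y'0(1)[OF z0(1,2)] by simp
        ultimately show ?thesis by linarith
      next
        case False
        then have "(Y z)\<^sup>2 * q * (2 * a0 - V' z) \<le> 4 * (V' z * Y' z) * (2 * a0 - V' z)" using YV by (intro mult_right_mono) auto
        also have "\<dots> = 4 * Y' z * (V' z * (2 * a0 - V' z))" by simp
        also have "\<dots> \<le> 4 * Y' z * a0\<^sup>2" using am Y'0(1)[OF z0(1,2)] by (intro mult_left_mono) auto
        finally show ?thesis .
      qed
      have "q / 4 * (2 / a0 - V' z / a0\<^sup>2) = ((Y z)\<^sup>2 * q * (2 * a0 - V' z)) / (4 * a0\<^sup>2 * (Y z)\<^sup>2)"
        using a0 z0 by (simp add: field_simps power2_eq_square)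
      also have "\<dots> \<le> (4 * Y' z * a0\<^sup>2) / (4 * a0\<^sup>2 * (Y z)\<^sup>2)" using key a0 z0 by (intro divide_right_mono) auto
      also have "\<dots> = Y' z / (Y z)\<^sup>2" using a0 by simp
      finally have le: "q / 4 * (2 / a0 - V' z / a0\<^sup>2) \<le> Y' z / (Y z)\<^sup>2" .
      have "((\<lambda>r. - (1 / Y r) - q / 4 * (2 * r / a0 - V r / a0\<^sup>2)) has_real_derivative
          (Y' z / (Y z)\<^sup>2 - q / 4 * (2 / a0 - V' z / a0\<^sup>2))) (at z)"
        using z0 a0 by (auto intro!: derivative_eq_intros dY V simp: power2_eq_square)
      then show "\<exists>y. ((\<lambda>r. - (1 / Y r) - q / 4 * (2 * r / a0 - V r / a0\<^sup>2)) has_real_derivative y) (at z) \<and> 0 \<le> y"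
        using le by (intro exI[of _ "Y' z / (Y z)\<^sup>2 - q / 4 * (2 / a0 - V' z / a0\<^sup>2)"]) auto
    qed (use rad in simp)
    moreover have "- (1 / Y (2 * \<rho>)) \<le> 0" using Ypos[of "2 * \<rho>"] rad by simp
    ultimately have "q / 4 * (2 * (2 * \<rho>) / a0 - V (2 * \<rho>) / a0\<^sup>2) - q / 4 * (2 * \<rho> / a0 - V \<rho> / a0\<^sup>2) \<le> 1 / Y \<rho>" by linarith
    moreover have "q / 4 * (2 * (2 * \<rho>) / a0 - V (2 * \<rho>) / a0\<^sup>2) - q / 4 * (2 * \<rho> / a0 - V \<rho> / a0\<^sup>2)
       = q / 4 * (2 * \<rho> / a0 - (V (2 * \<rho>) - V \<rho>) / a0\<^sup>2)"
      by (simp add: diff_divide_distrib algebra_simps)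
    moreover have "(V (2 * \<rho>) - V \<rho>) / a0\<^sup>2 \<le> B / a0\<^sup>2"
      using VB Vmono[of 0 \<rho>] rad by (intro divide_right_mono) auto
    then have "q / 4 * (2 * \<rho> / a0 - B / a0\<^sup>2) \<le> q / 4 * (2 * \<rho> / a0 - (V (2 * \<rho>) - V \<rho>) / a0\<^sup>2)"
      using pos by (intro mult_left_mono) auto
    moreover have "q / 4 * (2 * \<rho> / a0 - B / a0\<^sup>2) = q * \<rho>\<^sup>2 / (4 * B)"
      using pos rad by (simp add: a0_def field_simps power2_eq_square)
    ultimately have "q * \<rho>\<^sup>2 / (4 * B) \<le> 1 / Y \<rho>" by linarith
    then have "Y \<rho> \<le> 4 * B / (q * \<rho>\<^sup>2)" using Ypos[of \<rho>] rad pos by (simp add: field_simps)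
    then show ?thesis using lam by (smt (verit) mult_nonneg_nonneg zero_le_power2)
  qed
  \<comment> \<open>On this circle \<open>V'\<close>, and hence the square mean of \<open>a\<close>,
    is at most average. The mean of \<open>a\<close> is estimated here and carried to the centre by
    \<open>M'le\<close>.\<close>
  obtain s where s: "\<rho> / 2 < s" "s < \<rho>" "V \<rho> - V (\<rho> / 2) = (\<rho> - \<rho> / 2) * V' s"
    using MVT2[of "\<rho> / 2" \<rho> V V'] rad V by auto
  have s0: "0 \<le> s" "s \<le> 2 * \<rho>" "0 < s" using s rad by auto
  have "V \<rho> - V (\<rho> / 2) \<le> B" using VB Vmono[of 0 "\<rho> / 2"] Vmono[of \<rho> "2 * \<rho>"] rad by simp
  then have V's: "V' s \<le> 2 * B / \<rho>" using s(3) rad by (simp add: field_simps)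
  have Ms: "\<bar>M s\<bar> \<le> sqrt (8 * pi * B) / \<rho>"
  proof -
    have cs: "continuous_on {0..2*pi} (\<lambda>t. a (circ c s t))" by (intro continuous_on_circ_comp[OF cont(1) circ_in[OF rr[OF s0(1,2)]]])
    have "(M s)\<^sup>2 \<le> 2 * pi * circ_int c s (\<lambda>x. (a x)\<^sup>2)"
      using integral_Cauchy_Schwarz[OF _ cs, of "\<lambda>_. 1"] by (simp add: M_def circ_int_def)
    also have "circ_int c s (\<lambda>x. (a x)\<^sup>2) \<le> 4 * B / \<rho>\<^sup>2"
    proof -
      have "0 \<le> circ_int c s (\<lambda>x. (a x)\<^sup>2)" unfolding circ_int_def
        by (intro integral_nonneg integrable_continuous_real continuous_intros cs) simp
      then have "\<rho> / 2 * circ_int c s (\<lambda>x. (a x)\<^sup>2) \<le> s * circ_int c s (\<lambda>x. (a x)\<^sup>2)" using s by (intro mult_right_mono) auto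
      also have "\<dots> \<le> 2 * B / \<rho>" using N[OF s0(1,2)] V's by linarith
      finally show ?thesis using rad by (simp add: field_simps power2_eq_square)
    qed
    finally have "(M s)\<^sup>2 \<le> 8 * pi * B / \<rho>\<^sup>2" by simp
    then have "\<bar>M s\<bar> \<le> sqrt (8 * pi * B / \<rho>\<^sup>2)" by (simp add: real_le_rsqrt)
    also have "\<dots> = sqrt (8 * pi * B) / \<rho>" using rad by (simp add: real_sqrt_divide)
    finally show ?thesis .
  qed
  have M'le: "\<bar>M' r\<bar> \<le> K * Y' r / sqrt (Y r)" if r: "0 < r" "r \<le> 2 * \<rho>" for r
  proof -
    have r0: "0 \<le> r" "r \<le> 2 * \<rho>" using r by auto
    have "(M' r)\<^sup>2 \<le> 2 * pi * e r" using mean_deriv_le[OF rr[OF r0]] by (simp add: M'_def e_def)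
    then have "(M' r)\<^sup>2 * (q * Y r) \<le> (2 * pi * e r) * (q * (\<kappa> * (r * Y' r)))"
      using Yiso[OF r0] Ypos[OF r] pos e0[OF r0] by (intro mult_mono mult_left_mono) auto
    also have "\<dots> = 2 * pi * \<kappa> * Y' r * (q * (r * e r))" by simp
    also have "\<dots> \<le> 2 * pi * \<kappa> * Y' r * Y' r" using Y'0[OF r0] \<kappa> by (intro mult_left_mono) auto
    finally have "(M' r)\<^sup>2 * Y r \<le> K\<^sup>2 * (Y' r)\<^sup>2" unfolding K(2) using pos by (simp add: field_simps power2_eq_square)
    then have "(\<bar>M' r\<bar> * sqrt (Y r))\<^sup>2 \<le> (K * Y' r)\<^sup>2" using Ypos[OF r] by (simp add: power_mult_distrib)
    moreover have "0 \<le> K * Y' r" using K Y'0(1)[OF r0] by simp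
    ultimately have "\<bar>M' r\<bar> * sqrt (Y r) \<le> K * Y' r" by (rule power2_le_imp_le)
    then show ?thesis using Ypos[OF r] by (subst pos_le_divide_eq) auto
  qed
  have dsq: "((\<lambda>r. 2 * K * sqrt (Y r)) has_real_derivative K * Y' z / sqrt (Y z)) (at z)" if "0 < z" "z \<le> 2 * \<rho>" for z
    using Ypos[OF that] dY[of z] that by (auto intro!: derivative_eq_intros simp: field_simps)
  have diff: "\<sigma> * M s - \<sigma> * M z \<le> 2 * K * sqrt (Y \<rho>)" if \<sigma>: "\<bar>\<sigma>\<bar> = 1" and z: "0 < z" "z \<le> s" for \<sigma> z
  proof -
    have "2 * K * sqrt (Y z) - \<sigma> * M z \<le> 2 * K * sqrt (Y s) - \<sigma> * M s"
    proof (rule DERIV_nonneg_imp_nondecreasing[OF z(2)])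
      fix x assume x: "z \<le> x" "x \<le> s"
      have x0: "0 < x" "x \<le> 2 * \<rho>" "0 \<le> x" using x z s0 by auto
      have "((\<lambda>r. 2 * K * sqrt (Y r) - \<sigma> * M r) has_real_derivative K * Y' x / sqrt (Y x) - \<sigma> * M' x) (at x)"
        by (intro DERIV_diff DERIV_cmult dM dsq x0)
      moreover have "\<sigma> * M' x \<le> \<bar>M' x\<bar>" using \<sigma> by (metis abs_ge_self abs_mult mult_1)
      ultimately show "\<exists>y. ((\<lambda>r. 2 * K * sqrt (Y r) - \<sigma> * M r) has_real_derivative y) (at x) \<and> 0 \<le> y"
        using M'le[OF x0(1,2)] by (intro exI[of _ "K * Y' x / sqrt (Y x) - \<sigma> * M' x"]) auto
    qed
    moreover have "0 \<le> 2 * K * sqrt (Y z)" using K Ypos[of z] z s0 by simp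
    moreover have "2 * K * sqrt (Y s) \<le> 2 * K * sqrt (Y \<rho>)"
      using K Ymono[of s \<rho>] s s0 rad by (intro mult_left_mono) auto
    ultimately show ?thesis by linarith
  qed
  \<comment> \<open>\<open>Y\<close> vanishes at radius 0, where its square root need not be
    differentiable; hence \<open>M'le\<close> is integrated from \<open>z > 0\<close> only, and
    \<open>z\<close> tends to 0.\<close>
  have lim: "\<sigma> * M s - \<sigma> * M 0 \<le> 2 * K * sqrt (Y \<rho>)" if \<sigma>: "\<bar>\<sigma>\<bar> = 1" for \<sigma>
  proof (rule tendsto_upperbound)
    have "isCont M 0" using dM[of 0] rad DERIV_isCont by auto
    then show "((\<lambda>z. \<sigma> * M s - \<sigma> * M z) \<longlongrightarrow> \<sigma> * M s - \<sigma> * M 0) (at_right 0)"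
      unfolding isCont_def by (intro tendsto_intros) (auto intro: tendsto_mono[OF at_le])
    show "\<forall>\<^sub>F z in at_right 0. \<sigma> * M s - \<sigma> * M z \<le> 2 * K * sqrt (Y \<rho>)"
      unfolding eventually_at_right_field using diff[OF \<sigma>] s0 by (intro exI[of _ s]) auto
  qed simp
  have "\<bar>M 0\<bar> \<le> \<bar>M s\<bar> + 2 * K * sqrt (Y \<rho>)" using lim[of 1] lim[of "-1"] by auto
  also have "M 0 = 2 * pi * a c" by (simp add: M_def circ_int_def)
  finally have "2 * pi * \<bar>a c\<bar> \<le> \<bar>M s\<bar> + 2 * K * sqrt (Y \<rho>)" by (simp add: abs_mult)
  also have "2 * K * sqrt (Y \<rho>) \<le> 2 * K * sqrt (16 * pi * G * \<rho>\<^sup>2 + 4 * B / (q * \<rho>\<^sup>2))"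
    using K Y\<rho> by (intro mult_left_mono) (auto simp: lam_def)
  finally show ?thesis using Ms by linarith
qed

text \<open>A Caccioppoli inequality without cutoff functions. For \<open>Y = - wedge_int\<close>,
  boundedness of \<open>a\<close> bounds the square of \<open>Y\<close> by a multiple of
  \<open>Y'\<close>. Wherever \<open>Y\<close> is positive, \<open>1 / Y\<close> therefore falls at
  a fixed rate; being still positive at \<open>3 * \<rho>\<close>, it cannot be small at
  \<open>2 * \<rho>\<close>.\<close>

lemma energy_le:
  assumes rad: "lo < 0" "0 < \<rho>" "3 * \<rho> < hi" and pos: "q > 0" "m > 0"
    and qr: "\<And>x. x \<in> \<Omega> \<Longrightarrow> cross2 (ga x) (gb x) \<le> - q * ((norm (ga x))\<^sup>2 + (norm (gb x))\<^sup>2)"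
    and bd: "\<And>x. x \<in> \<Omega> \<Longrightarrow> \<bar>a x\<bar> \<le> m"
  shows "\<And>r. 0 \<le> r \<Longrightarrow> r \<le> 2 * \<rho> \<Longrightarrow> q * (r * circ_energy ga gb c r) \<le> - (r * circ_int c r (\<lambda>x. cross2 (ga x) (gb x)))"
    "- wedge_int a gb c (2 * \<rho>) \<le> 6 * pi * m\<^sup>2 / q"
proof -
  define e where "e = circ_energy ga gb c"
  define Y where "Y r = - wedge_int a gb c r" for r
  define Y' where "Y' r = - (r * circ_int c r (\<lambda>x. cross2 (ga x) (gb x)))" for r
  have rr: "r \<in> {lo<..<hi}" if "0 \<le> r" "r \<le> 3 * \<rho>" for r using that rad by auto
  have dY: "(Y has_real_derivative Y' r) (at r)" if "0 \<le> r" "r \<le> 3 * \<rho>" for r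
    unfolding Y_def[abs_def] Y'_def by (intro DERIV_minus wedge_int_deriv rr that)
  have e0: "e r \<ge> 0" if "0 \<le> r" "r \<le> 3 * \<rho>" for r using energy_nonneg[OF rr[OF that]] by (simp add: e_def)
  have Y'e: "q * (r * e r) \<le> Y' r" if "0 \<le> r" "r \<le> 3 * \<rho>" for r
  proof -
    have "circ_int c r (\<lambda>x. cross2 (ga x) (gb x)) \<le> circ_int c r (\<lambda>x. - q * ((norm (ga x))\<^sup>2 + (norm (gb x))\<^sup>2))"
      using qr circ_in[OF rr[OF that]] unfolding cross2_def
      by (intro circ_int_mono[of \<Omega>] continuous_intros cont) (auto simp: cross2_def)
    also have "\<dots> = - q * e r" by (simp add: circ_int_def e_def circ_energy_def)
    finally have "r * circ_int c r (\<lambda>x. cross2 (ga x) (gb x)) \<le> r * (- q * e r)" using that by (intro mult_left_mono) auto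
    then show ?thesis by (simp add: Y'_def algebra_simps)
  qed
  then show "q * (r * circ_energy ga gb c r) \<le> - (r * circ_int c r (\<lambda>x. cross2 (ga x) (gb x)))"
    if "0 \<le> r" "r \<le> 2 * \<rho>" for r using that by (simp add: Y'_def e_def)
  have Y'0: "Y' r \<ge> 0" if "0 \<le> r" "r \<le> 3 * \<rho>" for r
  proof -
    have "0 \<le> q * (r * e r)" using e0[OF that] that pos by auto
    then show ?thesis using Y'e[OF that] by linarith
  qed
  have Ymono: "Y r \<le> Y s" if "0 \<le> r" "r \<le> s" "s \<le> 3 * \<rho>" for r s
    by (rule DERIV_nonneg_imp_nondecreasing[OF that(2)]) (use dY Y'0 that in \<open>meson order_trans\<close>)
  have sq: "(Y r)\<^sup>2 * q \<le> 6 * pi * m\<^sup>2 * \<rho> * Y' r" if r: "0 \<le> r" "r \<le> 3 * \<rho>" for r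
  proof -
    have "circ_int c r (\<lambda>x. (a x)\<^sup>2) \<le> circ_int c r (\<lambda>x. m\<^sup>2)"
    proof (intro circ_int_mono[of \<Omega>] continuous_intros cont circ_in rr r)
      show "(a x)\<^sup>2 \<le> m\<^sup>2" if "x \<in> \<Omega>" for x
        using bd[OF that] pos by (metis abs_le_square_iff abs_of_pos)
    qed
    then have N: "circ_int c r (\<lambda>x. (a x)\<^sup>2) \<le> 2 * pi * m\<^sup>2" by (simp add: circ_int_def)
    have "(Y r)\<^sup>2 * q \<le> (circ_int c r (\<lambda>x. (a x)\<^sup>2) * (r\<^sup>2 * e r)) * q"
      using wedge_int_sq_le[OF rr[OF r]] pos by (intro mult_right_mono) (auto simp: e_def Y_def)
    also have "\<dots> \<le> ((2 * pi * m\<^sup>2) * (r\<^sup>2 * e r)) * q"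
      using N e0[OF r] pos by (intro mult_right_mono) auto
    also have "\<dots> = (2 * pi * m\<^sup>2) * r * (q * (r * e r))" by (simp add: power2_eq_square)
    also have "\<dots> \<le> (2 * pi * m\<^sup>2) * (3 * \<rho>) * Y' r"
      using Y'e[OF r] e0[OF r] r pos by (intro mult_mono) auto
    finally show ?thesis by simp
  qed
  show "- wedge_int a gb c (2 * \<rho>) \<le> 6 * pi * m\<^sup>2 / q"
  proof (cases "Y (2 * \<rho>) \<le> 0")
    case True
    then show ?thesis using pos by (smt (verit) Y_def divide_nonneg_nonneg mult_nonneg_nonneg pi_ge_zero zero_le_power2)
  next
    case False
    define k where "k = q / (6 * pi * m\<^sup>2 * \<rho>)"
    have k: "k > 0" using pos rad by (simp add: k_def)
    have "- (1 / Y (2 * \<rho>)) - k * (2 * \<rho>) \<le> - (1 / Y (3 * \<rho>)) - k * (3 * \<rho>)"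
    proof (rule DERIV_nonneg_imp_nondecreasing[where f = "\<lambda>r. - (1 / Y r) - k * r" and a = "2 * \<rho>" and b = "3 * \<rho>"])
      fix z assume z: "2 * \<rho> \<le> z" "z \<le> 3 * \<rho>"
      have z0: "0 \<le> z" "z \<le> 3 * \<rho>" "Y z > 0" using z rad False Ymono[of "2 * \<rho>" z] by auto
      have "k \<le> Y' z / (Y z)\<^sup>2" using sq[OF z0(1,2)] z0 pos rad by (simp add: k_def field_simps)
      moreover have "((\<lambda>r. - (1 / Y r) - k * r) has_real_derivative (Y' z / (Y z)\<^sup>2 - k)) (at z)"
        using z0 by (auto intro!: derivative_eq_intros dY simp: power2_eq_square)
      ultimately show "\<exists>y. ((\<lambda>r. - (1 / Y r) - k * r) has_real_derivative y) (at z) \<and> 0 \<le> y"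
        by (intro exI[of _ "Y' z / (Y z)\<^sup>2 - k"]) auto
    qed (use rad in simp)
    moreover have "1 / Y (3 * \<rho>) > 0" using False Ymono[of "2 * \<rho>" "3 * \<rho>"] rad by simp
    moreover have "k * (3 * \<rho>) = k * (2 * \<rho>) + k * \<rho>" by (simp add: algebra_simps)
    ultimately have "k * \<rho> \<le> 1 / Y (2 * \<rho>)" by linarith
    moreover have "k * \<rho> = q / (6 * pi * m\<^sup>2)" using rad by (simp add: k_def)
    ultimately have "q / (6 * pi * m\<^sup>2) \<le> 1 / Y (2 * \<rho>)" by simp
    then have "Y (2 * \<rho>) \<le> 6 * pi * m\<^sup>2 / q" using False pos by (simp add: field_simps)
    then show ?thesis by (simp add: Y_def)
  qed
qed

end

text \<open>The function itself is absent: the estimates concern its gradient \<open>p\<close> as a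
  pair of functions and the Hessian \<open>H\<close> as their gradients. Symmetry of
  \<open>H\<close> is recorded because it cannot be read off from \<open>p\<close> alone.\<close>

definition weing_sol :: "(real \<Rightarrow> real) \<Rightarrow> (real^2) set \<Rightarrow> (real^2 \<Rightarrow> real^2) \<Rightarrow> (real^2 \<Rightarrow> real^2^2) \<Rightarrow> bool" where
  "weing_sol f \<Omega> p H \<longleftrightarrow> (\<forall>i. C1_grad (\<lambda>x. p x $ i) (\<lambda>x. H x $ i) \<Omega>) \<and>
     (\<forall>x\<in>\<Omega>. H x $2$1 = H x $1$2 \<and> weing f (p x) (H x))"

lemma weing_solD:
  assumes "weing_sol f \<Omega> p H"
  shows "C1_grad (\<lambda>x. p x $ i) (\<lambda>x. H x $ i) \<Omega>"
    "x \<in> \<Omega> \<Longrightarrow> H x $2$1 = H x $1$2" "x \<in> \<Omega> \<Longrightarrow> weing f (p x) (H x)"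
    "continuous_on \<Omega> p" "continuous_on \<Omega> H"
proof -
  show 1: "C1_grad (\<lambda>x. p x $ i) (\<lambda>x. H x $ i) \<Omega>" for i using assms by (simp add: weing_sol_def)
  show "continuous_on \<Omega> p"
    using continuous_on_vec_lambda[of \<Omega> "\<lambda>i x. p x $ i"] C1_grad_continuous[OF 1] by simp
  show "continuous_on \<Omega> H"
    using continuous_on_vec_lambda[of \<Omega> "\<lambda>i x. H x $ i"] 1 by (simp add: C1_grad_def)
qed (use assms in \<open>auto simp: weing_sol_def\<close>)

lemma weing_sol_subset: "weing_sol f \<Omega> p H \<Longrightarrow> S \<subseteq> \<Omega> \<Longrightarrow> weing_sol f S p H"
  unfolding weing_sol_def using C1_grad_subset by blast

lemma cross2_rows: "cross2 (M$1) (M$2) = det M"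
  by (simp add: cross2_def det_2)

lemma norm_rows: "(norm (M$1))\<^sup>2 + (norm (M$2))\<^sup>2 = (norm M)\<^sup>2" for M :: "real^2^2"
  by (simp add: norm_R22 norm_R2)

section \<open>Hessian bounds through difference quotients\<close>

lemma difference_quotient:
  assumes a: "C1_grad a ga (ball c R)" and h: "0 < h" and x: "x \<in> ball c (R - h)"
  obtains y where "dist x y < h" "y \<in> ball c R" "(a (x + h *\<^sub>R axis k 1) - a x) / h = ga y $ k"
proof -
  have inb: "x + s *\<^sub>R axis k 1 \<in> ball c R" if "0 \<le> s" "s \<le> h" for s
  proof -
    have "dist c (x + s *\<^sub>R axis k 1) \<le> dist c x + dist x (x + s *\<^sub>R axis k 1)" by (rule dist_triangle)
    also have "dist x (x + s *\<^sub>R axis k 1) = s" using that by (simp add: dist_norm norm_axis_1)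
    finally show ?thesis using x that h by simp
  qed
  have "((\<lambda>s. a (x + s *\<^sub>R axis k 1)) has_real_derivative ga (x + s *\<^sub>R axis k 1) \<bullet> axis k 1) (at s)"
    if "0 \<le> s" "s \<le> h" for s
    using a inb[OF that] unfolding C1_grad_def
    by (intro has_real_derivative_along) (auto intro!: derivative_eq_intros)
  then obtain s where s: "0 < s" "s < h" "a (x + h *\<^sub>R axis k 1) - a (x + 0 *\<^sub>R axis k 1) = (h - 0) * (ga (x + s *\<^sub>R axis k 1) \<bullet> axis k 1)"
    using MVT2[OF h(1), of "\<lambda>s. a (x + s *\<^sub>R axis k 1)" "\<lambda>s. ga (x + s *\<^sub>R axis k 1) \<bullet> axis k 1"] by blast
  show thesis
  proof (rule that)
    show "dist x (x + s *\<^sub>R axis k 1) < h" using s by (simp add: dist_norm norm_axis_1)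
    show "x + s *\<^sub>R axis k 1 \<in> ball c R" using inb s by auto
    show "(a (x + h *\<^sub>R axis k 1) - a x) / h = ga (x + s *\<^sub>R axis k 1) $ k"
      using s h by (simp add: cart_eq_inner_axis)
  qed
qed

lemma C1_grad_difference_quotient:
  assumes a: "C1_grad a ga \<Omega>" and S: "\<And>x. x \<in> S \<Longrightarrow> x \<in> \<Omega> \<and> x + v \<in> \<Omega>"
  shows "C1_grad (\<lambda>x. (a (x + v) - a x) / h) (\<lambda>x. (1 / h) *\<^sub>R (ga (x + v) - ga x)) S"
proof -
  have ga: "continuous_on \<Omega> ga" using a by (simp add: C1_grad_def)
  have c: "continuous_on S (\<lambda>x. ga (x + v))" "continuous_on S ga"
    using S by (auto intro!: continuous_intros continuous_on_compose2[OF ga] continuous_on_subset[OF ga])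
  have d: "((\<lambda>x. (a (x + v) - a x) / h) has_derivative (\<lambda>k. ((1 / h) *\<^sub>R (ga (x + v) - ga x)) \<bullet> k)) (at x)" if "x \<in> S" for x
  proof -
    have 1: "(a has_derivative (\<lambda>k. ga x \<bullet> k)) (at x)" "(a has_derivative (\<lambda>k. ga (x + v) \<bullet> k)) (at (x + v))"
      using a S[OF that] by (auto simp: C1_grad_def)
    have "((\<lambda>x. x + v) has_derivative (\<lambda>k. k)) (at x)" by (auto intro!: derivative_eq_intros)
    from has_derivative_compose[OF this 1(2)] have "((\<lambda>x. a (x + v)) has_derivative (\<lambda>k. ga (x + v) \<bullet> k)) (at x)" .
    from has_derivative_mult_right[OF has_derivative_diff[OF this 1(1)], of "1 / h"]
    show ?thesis by (simp add: inner_diff_left diff_divide_distrib)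
  qed
  show ?thesis unfolding C1_grad_def
    by (rule conjI[OF continuous_on_scaleR[OF continuous_on_const continuous_on_diff[OF c]] ballI[OF d]])
qed

context curvature_relation
begin

text \<open>The difference quotients of the two components of \<open>p\<close> in one direction form
  a pair as in \<open>centre_le\<close>: \<open>det_weing_diff\<close>, for a solution and its
  translate, makes their Jacobian negative up to \<open>G\<close>. The defect \<open>G\<close>
  arises because the gradients at the two points differ; it causes the term with \<open>A\<close>,
  which \<open>hessian_interior\<close> removes.\<close>

lemma hessian_centre:
  obtains \<eta> K where "\<eta> > 0" "K > 0"
    "\<And>x0 \<rho> m A p H \<Omega>. weing_sol f \<Omega> p H \<Longrightarrow> cball x0 (4 * \<rho>) \<subseteq> \<Omega> \<Longrightarrow> 0 < \<rho> \<Longrightarrow> 0 < m \<Longrightarrow> m \<le> \<eta> \<Longrightarrow> 0 < A \<Longrightarrow>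
      (\<And>x. x \<in> cball x0 (4 * \<rho>) \<Longrightarrow> norm (p x) \<le> m \<and> norm (H x) \<le> A) \<Longrightarrow>
      norm (H x0) \<le> K * (m / \<rho> + m * A\<^sup>2 * \<rho>)"
proof -
  obtain \<eta> q C where \<eta>: "\<eta> > 0" "\<eta> \<le> 1" "q > 0" "C > 0" and
    D: "\<And>p q' M N. weing f p M \<Longrightarrow> weing f q' N \<Longrightarrow> M$2$1 = M$1$2 \<Longrightarrow> N$2$1 = N$1$2 \<Longrightarrow> norm p \<le> \<eta> \<Longrightarrow> norm q' \<le> \<eta> \<Longrightarrow>
       det (M - N) \<le> - q * (norm (M - N))\<^sup>2 + C * ((norm p + norm q') * norm (p - q') * norm N)\<^sup>2"
    using det_weing_diff by blast
  \<comment> \<open>The total increment of \<open>V\<close> below: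
    \<open>12 * pi / q\<^sup>2\<close> comes from \<open>energy_le\<close>, \<open>8 * pi\<close>
    from the tolerance \<open>\<epsilon>\<close> on radius \<open>2 * \<rho>\<close>.\<close>
  define b0 where "b0 = 12 * pi / q\<^sup>2 + 8 * pi"
  have b0: "b0 > 0" using \<eta> by (simp add: b0_def add_pos_pos)
  define Kc where "Kc = sqrt (2 * pi * (pi / q + 1) / q)"
  have Kc: "Kc > 0" using \<eta> by (simp add: Kc_def add_pos_pos)
  define K1 where "K1 = sqrt (8 * pi * b0) + 2 * Kc * (16 * sqrt (pi * C) + 2 * sqrt (b0 / q))"
  have K1: "K1 > 0" using Kc b0 \<eta> by (simp add: K1_def add_pos_pos)
  show ?thesis
  proof (rule that[of \<eta> "2 * (K1 + 1)"])
    fix x0 and \<rho> m A :: real and p H \<Omega>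
    assume sol: "weing_sol f \<Omega> p H" and sub: "cball x0 (4 * \<rho>) \<subseteq> \<Omega>" and \<rho>: "0 < \<rho>" and m: "0 < m" "m \<le> \<eta>" and A: "0 < A"
      and bd: "\<And>x. x \<in> cball x0 (4 * \<rho>) \<Longrightarrow> norm (p x) \<le> m \<and> norm (H x) \<le> A"
    \<comment> \<open>The tolerated distance between a difference quotient and the corresponding
      Hessian entry; it has the size of the bound to be proved.\<close>
    define \<epsilon> where "\<epsilon> = m / \<rho>"
    define X where "X = m / \<rho> + m * A\<^sup>2 * \<rho>"
    define G where "G = 16 * C * m\<^sup>2 * A^4"
    define B where "B = m\<^sup>2 * b0"
    have \<epsilon>: "\<epsilon> > 0" and X: "X > 0" and G: "G > 0" and B: "B > 0" 
      using m \<rho> A \<eta> b0 by (auto simp: \<epsilon>_def X_def G_def B_def add_pos_pos)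
    have sub': "ball x0 (4 * \<rho>) \<subseteq> \<Omega>" using sub by (auto simp: subset_iff)
    note sol4 = weing_sol_subset[OF sol sub']
    interpret P: C1_pair_on_circles x0 "- (4 * \<rho>)" "4 * \<rho>" "ball x0 (4 * \<rho>)" "\<lambda>x. p x $ 1" "\<lambda>x. p x $ 2" "\<lambda>x. H x $ 1" "\<lambda>x. H x $ 2"
      by unfold_locales (use weing_solD(1)[OF sol4] in auto)
    have Jp: "cross2 (H x $ 1) (H x $ 2) \<le> - q * ((norm (H x $ 1))\<^sup>2 + (norm (H x $ 2))\<^sup>2)" if "x \<in> ball x0 (4 * \<rho>)" for x
      using D[OF weing_solD(3)[OF sol4 that] weing_0 weing_solD(2)[OF sol4 that]] bd[of x] that m \<eta>
      unfolding cross2_rows norm_rows by simp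
    have pm: "\<bar>p x $ i\<bar> \<le> m" if "x \<in> ball x0 (4 * \<rho>)" for x i
      using component_le_norm_cart[of "p x" i] bd[of x] that by simp
    have rad: "- (4 * \<rho>) < 0" "3 * \<rho> < 4 * \<rho>" using \<rho> by auto
    have E1: "q * (r * circ_energy (\<lambda>x. H x $ 1) (\<lambda>x. H x $ 2) x0 r) \<le> - (r * circ_int x0 r (\<lambda>x. cross2 (H x $ 1) (H x $ 2)))"
      if "0 \<le> r" "r \<le> 2 * \<rho>" for r
      by (rule P.energy_le(1)[OF rad(1) \<rho> rad(2) \<eta>(3) m(1) _ _ that]) (use Jp pm in auto)
    have E2: "- wedge_int (\<lambda>x. p x $ 1) (\<lambda>x. H x $ 2) x0 (2 * \<rho>) \<le> 6 * pi * m\<^sup>2 / q"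
      by (rule P.energy_le(2)[OF rad(1) \<rho> rad(2) \<eta>(3) m(1)]) (use Jp pm in auto)
    \<comment> \<open>The wedge integral of \<open>p\<close> itself provides the function that
      \<open>centre_le\<close> asks for: by \<open>E1\<close> its negative has derivative at least
      \<open>q * (r * circ_energy)\<close>. The factor 2 and the term with \<open>\<epsilon>\<close>
      come from squaring \<open>norm (H x) + \<epsilon>\<close>.\<close>
    define V where "V r = 2 / q * (- wedge_int (\<lambda>x. p x $ 1) (\<lambda>x. H x $ 2) x0 r) + 2 * pi * \<epsilon>\<^sup>2 * r\<^sup>2" for r
    define V' where "V' r = 2 / q * (- (r * circ_int x0 r (\<lambda>x. cross2 (H x $ 1) (H x $ 2)))) + 4 * pi * \<epsilon>\<^sup>2 * r" for r
    have dV: "(V has_real_derivative V' r) (at r)" if "0 \<le> r" "r \<le> 2 * \<rho>" for r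
    proof -
      have "r \<in> {- (4 * \<rho>)<..<4 * \<rho>}" using that \<rho> by auto
      from P.wedge_int_deriv[OF this] show ?thesis
        unfolding V_def[abs_def] V'_def using \<eta>(3) by (auto intro!: derivative_eq_intros)
    qed
    have VB: "V (2 * \<rho>) - V 0 \<le> B"
    proof -
      have "V (2 * \<rho>) - V 0 \<le> 2 / q * (6 * pi * m\<^sup>2 / q) + 2 * pi * \<epsilon>\<^sup>2 * (2 * \<rho>)\<^sup>2"
        using mult_left_mono[OF E2, of "2 / q"] \<eta> by (simp add: V_def wedge_int_def)
      also have "\<dots> = B" using \<eta> \<rho> by (simp add: B_def b0_def \<epsilon>_def field_simps power2_eq_square)
      finally show ?thesis .
    qed
    have core: "\<bar>a x0\<bar> \<le> K1 * X"
      if ab: "C1_grad a ga (ball x0 (3 * \<rho>))" "C1_grad b gb (ball x0 (3 * \<rho>))"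
        and J: "\<And>x. x \<in> ball x0 (3 * \<rho>) \<Longrightarrow> cross2 (ga x) (gb x) \<le> - q * ((norm (ga x))\<^sup>2 + (norm (gb x))\<^sup>2) + G"
        and aH: "\<And>x. x \<in> ball x0 (3 * \<rho>) \<Longrightarrow> (a x)\<^sup>2 \<le> 2 * (norm (H x))\<^sup>2 + 2 * \<epsilon>\<^sup>2" for a b ga gb
    proof -
      interpret Q: C1_pair_on_circles x0 "- (3 * \<rho>)" "3 * \<rho>" "ball x0 (3 * \<rho>)" a b ga gb
        by unfold_locales (use ab in auto)
      have N: "r * circ_int x0 r (\<lambda>x. (a x)\<^sup>2) \<le> V' r" if r: "0 \<le> r" "r \<le> 2 * \<rho>" for r
      proof -
        have in3: "circ x0 r t \<in> ball x0 (3 * \<rho>)" for t using r \<rho> by simp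
        have cH: "continuous_on (ball x0 (3 * \<rho>)) H"
          by (rule continuous_on_subset[OF weing_solD(5)[OF sol4]]) (use \<rho> in auto)
        note [continuous_intros] = continuous_on_circ_comp[OF cH in3]
        have "circ_int x0 r (\<lambda>x. (a x)\<^sup>2) \<le> circ_int x0 r (\<lambda>x. 2 * (norm (H x))\<^sup>2 + 2 * \<epsilon>\<^sup>2)"
          by (intro circ_int_mono[of "ball x0 (3 * \<rho>)"] continuous_intros Q.cont cH in3 aH) auto
        also have "\<dots> = 2 * circ_int x0 r (\<lambda>x. (norm (H x))\<^sup>2) + 4 * pi * \<epsilon>\<^sup>2"
          unfolding circ_int_def by (subst integral_add; (intro integrable_continuous_real continuous_intros)?) simp
        also have "circ_int x0 r (\<lambda>x. (norm (H x))\<^sup>2) = circ_energy (\<lambda>x. H x $ 1) (\<lambda>x. H x $ 2) x0 r"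
          by (simp add: circ_energy_def norm_rows)
        finally have "r * circ_int x0 r (\<lambda>x. (a x)\<^sup>2) \<le> r * (2 * circ_energy (\<lambda>x. H x $ 1) (\<lambda>x. H x $ 2) x0 r + 4 * pi * \<epsilon>\<^sup>2)"
          using r by (intro mult_left_mono) auto
        also have "\<dots> = 2 / q * (q * (r * circ_energy (\<lambda>x. H x $ 1) (\<lambda>x. H x $ 2) x0 r)) + 4 * pi * \<epsilon>\<^sup>2 * r"
          using \<eta> by (simp add: algebra_simps)
        also have "\<dots> \<le> V' r" unfolding V'_def using E1[OF r] \<eta> by (intro add_mono mult_left_mono) auto
        finally show ?thesis .
      qed
      have "2 * pi * \<bar>a x0\<bar> \<le> sqrt (8 * pi * B) / \<rho> + 2 * Kc * sqrt (16 * pi * G * \<rho>\<^sup>2 + 4 * B / (q * \<rho>\<^sup>2))"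
        unfolding Kc_def by (rule Q.centre_le[OF _ \<rho> _ \<eta>(3) G B J dV N VB]) (use \<rho> in auto)
      also have "sqrt (8 * pi * B) / \<rho> = sqrt (8 * pi * b0) * (m / \<rho>)"
        using m by (simp add: B_def real_sqrt_mult)
      also have "sqrt (16 * pi * G * \<rho>\<^sup>2 + 4 * B / (q * \<rho>\<^sup>2)) \<le> 16 * sqrt (pi * C) * (m * A\<^sup>2 * \<rho>) + 2 * sqrt (b0 / q) * (m / \<rho>)"
      proof -
        have "16 * pi * G * \<rho>\<^sup>2 = (16 * sqrt (pi * C) * (m * A\<^sup>2 * \<rho>))\<^sup>2"
          using \<eta> by (simp add: G_def power_mult_distrib) 
        moreover have "4 * B / (q * \<rho>\<^sup>2) = (2 * sqrt (b0 / q) * (m / \<rho>))\<^sup>2"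
          using \<eta> b0 by (simp add: B_def power_mult_distrib power_divide)
        moreover have "0 \<le> 16 * sqrt (pi * C) * (m * A\<^sup>2 * \<rho>)" "0 \<le> 2 * sqrt (b0 / q) * (m / \<rho>)"
          using \<eta> m A \<rho> b0 by auto
        ultimately show ?thesis using sqrt_sum_squares_le_sum by metis
      qed
      finally have "2 * pi * \<bar>a x0\<bar> \<le> sqrt (8 * pi * b0) * (m / \<rho>)
          + 2 * Kc * (16 * sqrt (pi * C) * (m * A\<^sup>2 * \<rho>) + 2 * sqrt (b0 / q) * (m / \<rho>))"
        using Kc by simp
      also have "\<dots> \<le> sqrt (8 * pi * b0) * X + 2 * Kc * (16 * sqrt (pi * C) * X + 2 * sqrt (b0 / q) * X)"
        using Kc b0 \<eta> m A \<rho> by (intro add_mono mult_left_mono) (auto simp: X_def)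
      also have "\<dots> = K1 * X" by (simp add: K1_def algebra_simps)
      finally have "2 * pi * \<bar>a x0\<bar> \<le> K1 * X" .
      moreover have "1 * \<bar>a x0\<bar> \<le> 2 * pi * \<bar>a x0\<bar>" using pi_gt3 by (intro mult_right_mono) auto
      ultimately show ?thesis by simp
    qed
    have entry: "\<bar>H x0 $ i $ k\<bar> \<le> (K1 + 1) * X" for i k
    proof -
      have "uniformly_continuous_on (cball x0 (4 * \<rho>)) H"
        by (intro compact_uniformly_continuous continuous_on_subset[OF weing_solD(5)[OF sol]] sub) auto
      then obtain \<delta> where \<delta>: "\<delta> > 0" "\<And>x y. x \<in> cball x0 (4 * \<rho>) \<Longrightarrow> y \<in> cball x0 (4 * \<rho>) \<Longrightarrow> dist x y < \<delta> \<Longrightarrow> dist (H x) (H y) < \<epsilon>"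
        unfolding uniformly_continuous_on_def using \<epsilon> by (metis dist_commute)
      \<comment> \<open>The step depends on the modulus of continuity of \<open>H\<close>, but none
        of the constants above depends on the step.\<close>
      define h where "h = min \<rho> \<delta> / 2"
      have h: "0 < h" "h < \<rho>" "h < \<delta>" using \<rho> \<delta> by (auto simp: h_def)
      define v :: "real^2" where "v = h *\<^sub>R axis k 1"
      have nv: "norm v = h" using h by (simp add: v_def norm_axis_1)
      have shift: "x \<in> ball x0 (4 * \<rho>) \<and> x + v \<in> ball x0 (4 * \<rho>)" if "x \<in> ball x0 (3 * \<rho>)" for x
      proof -
        have "dist x0 (x + v) \<le> dist x0 x + dist x (x + v)" by (rule dist_triangle)
        then show ?thesis using that nv h \<rho> by (simp add: dist_norm)
      qed
      define a where "a j x = (p (x + v) $ j - p x $ j) / h" for j x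
      define g where "g j x = (1 / h) *\<^sub>R (H (x + v) $ j - H x $ j)" for j x
      have aC: "C1_grad (a j) (g j) (ball x0 (3 * \<rho>))" for j
        unfolding a_def[abs_def] g_def[abs_def]
        by (rule C1_grad_difference_quotient[OF weing_solD(1)[OF sol4] shift])
      have ay: "\<exists>y. dist x y < h \<and> y \<in> ball x0 (4 * \<rho>) \<and> a j x = H y $ j $ k" if x: "x \<in> ball x0 (3 * \<rho>)" for j x
      proof -
        have "x \<in> ball x0 (4 * \<rho> - h)" using x h by simp
        from difference_quotient[OF weing_solD(1)[OF sol4] h(1) this, where k = k]
        show ?thesis unfolding a_def v_def by metis
      qed
      have aA: "\<bar>a j x\<bar> \<le> A" if "x \<in> ball x0 (3 * \<rho>)" for j x
      proof -
        obtain y where "y \<in> ball x0 (4 * \<rho>)" "a j x = H y $ j $ k" using ay[OF \<open>x \<in> ball x0 (3 * \<rho>)\<close>] by blast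
        then show ?thesis using entry_le_norm[of "H y" j k] bd[of y] by simp
      qed
      have a\<epsilon>: "\<bar>a j x - H x $ j $ k\<bar> \<le> \<epsilon>" if "x \<in> ball x0 (3 * \<rho>)" for j x
      proof -
        obtain y where y: "dist x y < h" "y \<in> ball x0 (4 * \<rho>)" "a j x = H y $ j $ k" using ay[OF \<open>x \<in> ball x0 (3 * \<rho>)\<close>] by blast
        have "dist (H x) (H y) < \<epsilon>" using \<delta>(2)[of x y] y h shift[OF that] by simp
        moreover have "\<bar>(H y - H x) $ j $ k\<bar> \<le> norm (H y - H x)" by (rule entry_le_norm)
        ultimately show ?thesis using y by (simp add: dist_norm norm_minus_commute)
      qed
      have aH: "(a j x)\<^sup>2 \<le> 2 * (norm (H x))\<^sup>2 + 2 * \<epsilon>\<^sup>2" if "x \<in> ball x0 (3 * \<rho>)" for j x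
      proof -
        have "\<bar>a j x\<bar> \<le> norm (H x) + \<epsilon>" using a\<epsilon>[OF that, of j] entry_le_norm[of "H x" j k] by linarith
        then have "(\<bar>a j x\<bar>)\<^sup>2 \<le> (norm (H x) + \<epsilon>)\<^sup>2" by (intro power_mono) auto
        also have "\<dots> \<le> 2 * (norm (H x))\<^sup>2 + 2 * \<epsilon>\<^sup>2"
          using sum_squares_bound[of "norm (H x)" \<epsilon>] by (simp add: power2_sum)
        finally show ?thesis by simp
      qed
      have J: "cross2 (g 1 x) (g 2 x) \<le> - q * ((norm (g 1 x))\<^sup>2 + (norm (g 2 x))\<^sup>2) + G" if x: "x \<in> ball x0 (3 * \<rho>)" for x
      proof -
        \<comment> \<open>The increment of \<open>p\<close> is at most \<open>2 * A * h\<close>, so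
          the defect in \<open>det_weing_diff\<close> is quadratic in \<open>h\<close>; division by
          \<open>h\<^sup>2\<close> leaves \<open>G\<close>.\<close>
        define Y where "Y = H (x + v) - H x"
        note s1 = conjunct1[OF shift[OF x]] and s2 = conjunct2[OF shift[OF x]]
        have b: "norm (p x) \<le> m" "norm (p (x + v)) \<le> m" "norm (H x) \<le> A" using bd[of x] bd[of "x + v"] s1 s2 by auto
        have "norm (p (x + v) - p x) \<le> \<bar>(p (x + v) - p x) $ 1\<bar> + \<bar>(p (x + v) - p x) $ 2\<bar>"
          using norm_le_l1_cart[of "p (x + v) - p x"] by (simp add: sum_2)
        also have "\<dots> = h * (\<bar>a 1 x\<bar> + \<bar>a 2 x\<bar>)" using h by (simp add: a_def abs_divide field_simps)
        also have "\<dots> \<le> h * (2 * A)" using aA[OF x, of 1] aA[OF x, of 2] h by (intro mult_left_mono) auto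
        finally have dp: "norm (p (x + v) - p x) \<le> h * (2 * A)" .
        have "((norm (p (x + v)) + norm (p x)) * norm (p (x + v) - p x) * norm (H x))\<^sup>2 \<le> ((m + m) * (h * (2 * A)) * A)\<^sup>2"
          using b dp A h m by (intro power_mono mult_mono add_mono) auto
        also have "\<dots> = h\<^sup>2 * (16 * m\<^sup>2 * A^4)" by (simp add: power2_eq_square power4_eq_xxxx)
        finally have "C * ((norm (p (x + v)) + norm (p x)) * norm (p (x + v) - p x) * norm (H x))\<^sup>2 \<le> C * (h\<^sup>2 * (16 * m\<^sup>2 * A^4))"
          using \<eta> by (intro mult_left_mono) auto
        then have det: "det Y \<le> - q * (norm Y)\<^sup>2 + h\<^sup>2 * G"
          using D[OF weing_solD(3)[OF sol4 s2] weing_solD(3)[OF sol4 s1] weing_solD(2)[OF sol4 s2] weing_solD(2)[OF sol4 s1]] b m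
          unfolding Y_def[symmetric] G_def by (simp add: algebra_simps)
        have "cross2 (g 1 x) (g 2 x) = det Y / h\<^sup>2"
        proof -
          have "cross2 (r *\<^sub>R y) (r *\<^sub>R z) = r\<^sup>2 * cross2 y z" for r :: real and y z
            by (simp add: cross2_def power2_eq_square algebra_simps)
          then show ?thesis
            unfolding cross2_rows[of Y, symmetric] by (simp add: g_def Y_def power_divide)
        qed
        moreover have "(norm (g 1 x))\<^sup>2 + (norm (g 2 x))\<^sup>2 = (norm Y)\<^sup>2 / h\<^sup>2"
          unfolding norm_rows[of Y, symmetric] using h by (simp add: g_def Y_def power_divide add_divide_distrib)
        moreover have "det Y / h\<^sup>2 \<le> (- q * (norm Y)\<^sup>2 + h\<^sup>2 * G) / h\<^sup>2" using det by (intro divide_right_mono) auto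
        moreover have "(- q * (norm Y)\<^sup>2 + h\<^sup>2 * G) / h\<^sup>2 = - q * ((norm Y)\<^sup>2 / h\<^sup>2) + G" using h by (simp add: field_simps)
        ultimately show ?thesis by simp
      qed
      have "\<bar>a i x0\<bar> \<le> K1 * X"
      proof (cases "i = 1")
        case True
        have "\<bar>a 1 x0\<bar> \<le> K1 * X" by (rule core[OF aC aC J aH])
        then show ?thesis using True by simp
      next
        case False
        then have i: "i = 2" using exhaust_2[of i] by simp
        \<comment> \<open>Passing from the pair \<open>(a 1, a 2)\<close> to
          \<open>(a 2, - a 1)\<close> preserves the Jacobian and puts the other component
          first.\<close>
        have "\<bar>a 2 x0\<bar> \<le> K1 * X"
        proof (rule core[OF aC C1_grad_minus[OF aC[of 1]] _ aH])
          show "cross2 (g 2 x) (- g 1 x) \<le> - q * ((norm (g 2 x))\<^sup>2 + (norm (- g 1 x))\<^sup>2) + G" if "x \<in> ball x0 (3 * \<rho>)" for x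
            using J[OF that] by (simp add: cross2_def algebra_simps)
        qed
        then show ?thesis using i by simp
      qed
      moreover have "\<bar>a i x0 - H x0 $ i $ k\<bar> \<le> \<epsilon>" using a\<epsilon>[of x0 i] \<rho> by simp
      moreover have "\<epsilon> \<le> X" using m \<rho> A by (simp add: \<epsilon>_def X_def)
      ultimately show ?thesis by (simp add: algebra_simps)
    qed
    have e2: "(H x0 $ i $ k)\<^sup>2 \<le> ((K1 + 1) * X)\<^sup>2" for i k
      using entry[of i k] by (metis abs_ge_zero power2_abs power_mono)
    have "(norm (H x0))\<^sup>2 \<le> (2 * ((K1 + 1) * X))\<^sup>2"
      unfolding norm_R22 using e2[of 1 1] e2[of 1 2] e2[of 2 1] e2[of 2 2] by (simp add: power_mult_distrib)
    moreover have "0 \<le> 2 * ((K1 + 1) * X)" using K1 X by simp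
    ultimately have "norm (H x0) \<le> 2 * ((K1 + 1) * X)" by (rule power2_le_imp_le)
    then show "norm (H x0) \<le> 2 * (K1 + 1) * (m / \<rho> + m * A\<^sup>2 * \<rho>)"
      unfolding X_def mult.assoc .
  qed (use \<eta> K1 in auto)
qed

text \<open>Apply the previous estimate at the point that maximises \<open>(\<rho> - |x - x0|) |H x|\<close>: on the ball
  of half the distance to the boundary \<open>H\<close> is at most twice its value at the centre.\<close>

lemma hessian_interior:
  obtains \<eta> K where "\<eta> > 0" "K > 0"
    "\<And>x0 \<rho> m p H \<Omega>. weing_sol f \<Omega> p H \<Longrightarrow> cball x0 \<rho> \<subseteq> \<Omega> \<Longrightarrow> 0 < \<rho> \<Longrightarrow> 0 < m \<Longrightarrow> m \<le> \<eta> \<Longrightarrow>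
      (\<And>x. x \<in> cball x0 \<rho> \<Longrightarrow> norm (p x) \<le> m) \<Longrightarrow> norm (H x0) \<le> K * (m / \<rho>)"
proof -
  obtain \<eta> K where \<eta>: "\<eta> > 0" "K > 0" and centre: 
    "\<And>x0 \<rho> m A p H \<Omega>. weing_sol f \<Omega> p H \<Longrightarrow> cball x0 (4 * \<rho>) \<subseteq> \<Omega> \<Longrightarrow> 0 < \<rho> \<Longrightarrow> 0 < m \<Longrightarrow> m \<le> \<eta> \<Longrightarrow> 0 < A \<Longrightarrow>
      (\<And>x. x \<in> cball x0 (4 * \<rho>) \<Longrightarrow> norm (p x) \<le> m \<and> norm (H x) \<le> A) \<Longrightarrow>
      norm (H x0) \<le> K * (m / \<rho> + m * A\<^sup>2 * \<rho>)"
    using hessian_centre by blast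
  show ?thesis
  proof (rule that[of "min \<eta> (1 / (10 * K))" "40 * K"])
    fix x0 and \<rho> m :: real and p H \<Omega>
    assume sol: "weing_sol f \<Omega> p H" and sub: "cball x0 \<rho> \<subseteq> \<Omega>" and \<rho>: "0 < \<rho>" and m: "0 < m" "m \<le> min \<eta> (1 / (10 * K))"
      and bd: "\<And>x. x \<in> cball x0 \<rho> \<Longrightarrow> norm (p x) \<le> m"
    \<comment> \<open>This threshold decides between the two candidates for \<open>s\<close> below:
      \<open>s = 1 / A0\<close> would give \<open>1 \<le> 5 * K * m\<close>.\<close>
    have mK: "10 * K * m \<le> 1" using m \<eta> by (simp add: field_simps)
    define F where "F x = (\<rho> - dist x0 x) * norm (H x)" for x
    have "continuous_on (cball x0 \<rho>) F"
      unfolding F_def by (intro continuous_intros continuous_on_subset[OF weing_solD(5)[OF sol] sub])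
    moreover have "cball x0 \<rho> \<noteq> {}" "compact (cball x0 \<rho>)" using \<rho> by auto
    ultimately obtain y where y: "y \<in> cball x0 \<rho>" "\<And>x. x \<in> cball x0 \<rho> \<Longrightarrow> F x \<le> F y"
      using continuous_attains_sup[of "cball x0 \<rho>" F] by blast
    have "F y \<le> 40 * K * m"
    proof (cases "F y \<le> 0")
      case True
      then show ?thesis using \<eta> m by (smt (verit) mult_pos_pos)
    next
      case False
      define d where "d = \<rho> - dist x0 y"
      define A0 where "A0 = norm (H y)"
      have Fy: "F y = d * A0" by (simp add: F_def d_def A0_def)
      have d: "d > 0" using False y Fy by (cases "d = 0") (auto simp: d_def)
      have A0: "A0 > 0" using False Fy d by (simp add: A0_def zero_less_mult_iff not_le)
      \<comment> \<open>\<open>d / 8\<close> keeps the ball of radius \<open>4 * s\<close> where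
        \<open>H\<close> is at most \<open>2 * A0\<close>; \<open>1 / A0\<close> keeps
        \<open>A0 * s\<close> below 1, so that the quadratic term of \<open>hessian_centre\<close>
        stays bounded.\<close>
      define s where "s = min (d / 8) (1 / A0)"
      have s: "s > 0" "4 * s \<le> d / 2" using d A0 by (auto simp: s_def)
      have in\<rho>: "x \<in> cball x0 \<rho> \<and> d / 2 \<le> \<rho> - dist x0 x" if "x \<in> cball y (4 * s)" for x
      proof -
        have "dist x0 x \<le> dist x0 y + dist y x" by (rule dist_triangle)
        then have "dist x0 x \<le> dist x0 y + d / 2" using that s by simp
        then show ?thesis using d by (simp add: d_def field_simps)
      qed
      have "norm (p x) \<le> m \<and> norm (H x) \<le> 2 * A0" if "x \<in> cball y (4 * s)" for x
      proof
        show "norm (p x) \<le> m" using bd in\<rho>[OF that] by simp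
        have "d / 2 * norm (H x) \<le> F x" unfolding F_def using in\<rho>[OF that] by (intro mult_right_mono) auto
        also have "\<dots> \<le> d * A0" using y(2) in\<rho>[OF that] Fy by simp
        finally show "norm (H x) \<le> 2 * A0" using d by simp
      qed
      moreover have "cball y (4 * s) \<subseteq> \<Omega>" using in\<rho> sub by blast
      ultimately have "A0 \<le> K * (m / s + m * (2 * A0)\<^sup>2 * s)"
        unfolding A0_def[symmetric] using centre[OF sol _ s(1) m(1) _, of y "2 * A0"] m A0 by (simp add: A0_def)
      then have "A0 * s \<le> K * (m / s + m * (2 * A0)\<^sup>2 * s) * s" using s by (intro mult_right_mono) auto
      also have "\<dots> = K * m * (1 + 4 * (A0 * s)\<^sup>2)" using s by (simp add: field_simps power2_eq_square)
      also have "\<dots> \<le> K * m * (1 + 4 * 1)"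
      proof -
        have "A0 * s \<le> 1" using A0 by (simp add: s_def min_def field_simps)
        then have "(A0 * s)\<^sup>2 \<le> 1\<^sup>2" using A0 s by (intro power_mono) auto
        then show ?thesis using \<eta> m by (intro mult_left_mono) auto
      qed
      finally have As: "A0 * s \<le> 5 * (K * m)" by simp
      have "s = d / 8"
      proof (rule ccontr)
        assume "s \<noteq> d / 8"
        then have "A0 * s = 1" using A0 by (auto simp: s_def min_def)
        then show False using As mK by simp
      qed
      then have "F y = 8 * (A0 * s)" using Fy by simp
      then show ?thesis using As by simp
    qed
    then have "\<rho> * norm (H x0) \<le> 40 * K * m" using y(2)[of x0] \<rho> by (simp add: F_def)
    then show "norm (H x0) \<le> 40 * K * (m / \<rho>)" using \<rho> by (simp add: field_simps)
  qed (use \<eta> in auto)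
qed

end

section \<open>Solutions outside a disc\<close>

lemma has_derivative_inner_R2:
  fixes u :: "real^2 \<Rightarrow> real"
  assumes "(u has_derivative D) (at x)"
  shows "(u has_derivative (\<lambda>h. (\<chi> i. D (axis i 1)) \<bullet> h)) (at x)"
proof -
  have lin: "linear D" using assms has_derivative_linear by blast
  have "D h = (\<chi> i. D (axis i 1)) \<bullet> h" for h
  proof -
    have "h = h$1 *\<^sub>R axis 1 1 + h$2 *\<^sub>R axis 2 1" by (simp add: vec_eq_iff forall_2 axis_def)
    then have "D h = D (h$1 *\<^sub>R axis 1 1 + h$2 *\<^sub>R axis 2 1)" by simp
    also have "\<dots> = h$1 * D (axis 1 1) + h$2 * D (axis 2 1)"
      using lin by (simp add: linear_add linear_cmul)
    finally show ?thesis by (simp add: inner_R2 mult.commute)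
  qed
  then have "D = (\<lambda>h. (\<chi> i. D (axis i 1)) \<bullet> h)" by blast
  then show ?thesis using assms by metis
qed

lemma interior_ball_compl: "norm x > R \<Longrightarrow> x \<in> interior (ball_compl R)" for x :: "real^2"
  using interior_maximal[of "- cball 0 R" "ball_compl R"] by (auto simp: subset_iff open_Compl)

text \<open>Off the boundary circle the derivatives within the domain are ordinary ones. The
  comparison of \<open>u\<close> and \<open>v\<close> takes place on this open set; the boundary
  circle is added at the very end by continuity.\<close>

lemma C2_on_C1_grad:
  assumes "C2_on (ball_compl R) u"
  shows "C1_grad u (grad_on (ball_compl R) u) {x. norm x > R}"
    and "C1_grad (\<lambda>x. grad_on (ball_compl R) u x $ i) (\<lambda>x. hess_on (ball_compl R) u x $ i) {x. norm x > R}"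
proof -
  define S where "S = ball_compl R"
  have der: "(w has_derivative (\<lambda>h. (\<chi> i. pderiv_on S i w x) \<bullet> h)) (at x)" if "w differentiable_on S" "norm x > R" for w x
  proof -
    have "x \<in> S" using that(2) by (simp add: S_def)
    then have "(w has_derivative frechet_derivative w (at x within S)) (at x within S)"
      using that(1) frechet_derivative_works unfolding differentiable_on_def by blast
    then have "(w has_derivative frechet_derivative w (at x within S)) (at x)"
      using at_within_interior[OF interior_ball_compl[OF that(2)]] by (simp add: S_def)
    from has_derivative_inner_R2[OF this] show ?thesis by (simp add: pderiv_on_def)
  qed
  have d: "u differentiable_on S" "\<And>i. pderiv_on S i u differentiable_on S" "continuous_on S (hess_on S u)"
    using assms by (auto simp: C2_on_def S_def)
  have sub: "{x. norm x > R} \<subseteq> S" by (auto simp: S_def)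
  have "continuous_on {x. norm x > R} (\<lambda>x. \<chi> i. pderiv_on S i u x)"
    by (intro continuous_on_vec_lambda continuous_on_subset[OF differentiable_imp_continuous_on[OF d(2)] sub])
  then show "C1_grad u (grad_on (ball_compl R) u) {x. norm x > R}"
    using der[OF d(1)] unfolding C1_grad_def grad_on_def S_def by auto
  have "continuous_on {x. norm x > R} (\<lambda>x. hess_on S u x $ i)"
    by (intro continuous_intros continuous_on_subset[OF d(3) sub])
  then show "C1_grad (\<lambda>x. grad_on (ball_compl R) u x $ i) (\<lambda>x. hess_on (ball_compl R) u x $ i) {x. norm x > R}"
    using der[OF d(2)[of i]] unfolding C1_grad_def grad_on_def hess_on_def S_def by auto
qed

lemma C1_grad_real_derivative:
  assumes "C1_grad a ga \<Omega>" "x + s *\<^sub>R v \<in> \<Omega>"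
  shows "((\<lambda>s. a (x + s *\<^sub>R v)) has_real_derivative ga (x + s *\<^sub>R v) \<bullet> v) (at s)"
  using assms unfolding C1_grad_def
  by (intro has_real_derivative_along) (auto intro!: derivative_eq_intros)

text \<open>The mean value theorem, applied twice. The left-hand side is symmetric in
  \<open>i\<close> and \<open>j\<close>, so the two mixed second derivatives attain a common value
  arbitrarily close to \<open>x\<close>; by continuity they agree at \<open>x\<close>.\<close>

lemma second_difference:
  assumes u: "C1_grad u p \<Omega>" and p: "C1_grad (\<lambda>x. p x $ i) (\<lambda>x. H x $ i) \<Omega>"
    and t: "t > 0" "cball x (2 * t) \<subseteq> \<Omega>"
  shows "\<exists>y\<in>cball x (2 * t). u (x + t *\<^sub>R axis i 1 + t *\<^sub>R axis j 1) - u (x + t *\<^sub>R axis i 1) - u (x + t *\<^sub>R axis j 1) + u x = t\<^sup>2 * H y $ i $ j"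
proof -
  have inb: "x + s *\<^sub>R axis i 1 + s' *\<^sub>R axis j 1 \<in> cball x (2 * t)" if "0 \<le> s" "s \<le> t" "0 \<le> s'" "s' \<le> t" for s s'
  proof -
    have "norm (s *\<^sub>R axis i 1 + s' *\<^sub>R axis j 1 :: real^2) \<le> norm (s *\<^sub>R axis i 1 :: real^2) + norm (s' *\<^sub>R axis j 1 :: real^2)" by (rule norm_triangle_ineq)
    also have "\<dots> \<le> 2 * t" using that by (simp add: norm_axis_1)
    moreover have "x - (x + s *\<^sub>R axis i 1 + s' *\<^sub>R axis j 1) = - (s *\<^sub>R axis i 1 + s' *\<^sub>R axis j 1)" by simp
    ultimately show ?thesis unfolding mem_cball dist_norm by (simp only: norm_minus_cancel)
  qed
  have inb0: "x + s *\<^sub>R axis i 1 \<in> cball x (2 * t)" if "0 \<le> s" "s \<le> t" for s using inb[OF that, of 0] t by simp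
  define \<phi> where "\<phi> s = u (x + t *\<^sub>R axis j 1 + s *\<^sub>R axis i 1) - u (x + s *\<^sub>R axis i 1)" for s
  have sw: "x + t *\<^sub>R axis j 1 + s *\<^sub>R axis i 1 = x + s *\<^sub>R axis i 1 + t *\<^sub>R axis j 1" for s by simp
  have "(\<phi> has_real_derivative (p (x + t *\<^sub>R axis j 1 + s *\<^sub>R axis i 1) \<bullet> axis i 1 - p (x + s *\<^sub>R axis i 1) \<bullet> axis i 1)) (at s)"
    if "0 \<le> s" "s \<le> t" for s
    unfolding \<phi>_def using t(2) inb[OF that, of t] inb0[OF that] t(1)
    by (intro DERIV_diff C1_grad_real_derivative[OF u]) (auto simp: sw)
  from MVT2[OF t(1) this] obtain s where s: "0 < s" "s < t"
    "\<phi> t - \<phi> 0 = t * (p (x + t *\<^sub>R axis j 1 + s *\<^sub>R axis i 1) \<bullet> axis i 1 - p (x + s *\<^sub>R axis i 1) \<bullet> axis i 1)" by auto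
  have "((\<lambda>s'. p (x + s *\<^sub>R axis i 1 + s' *\<^sub>R axis j 1) $ i) has_real_derivative H (x + s *\<^sub>R axis i 1 + s' *\<^sub>R axis j 1) $ i \<bullet> axis j 1) (at s')"
    if "0 \<le> s'" "s' \<le> t" for s'
    using t(2) inb[of s s'] that s by (intro C1_grad_real_derivative[OF p]) auto
  from MVT2[OF t(1) this] obtain s' where s': "0 < s'" "s' < t"
    "p (x + s *\<^sub>R axis i 1 + t *\<^sub>R axis j 1) $ i - p (x + s *\<^sub>R axis i 1 + 0 *\<^sub>R axis j 1) $ i = t * (H (x + s *\<^sub>R axis i 1 + s' *\<^sub>R axis j 1) $ i \<bullet> axis j 1)" by auto
  show ?thesis
  proof
    show "x + s *\<^sub>R axis i 1 + s' *\<^sub>R axis j 1 \<in> cball x (2 * t)" using inb s s' by simp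
    have "\<phi> t - \<phi> 0 = t * (t * (H (x + s *\<^sub>R axis i 1 + s' *\<^sub>R axis j 1) $ i \<bullet> axis j 1))"
      using s(3) s'(3) by (simp add: sw cart_eq_inner_axis)
    then show "u (x + t *\<^sub>R axis i 1 + t *\<^sub>R axis j 1) - u (x + t *\<^sub>R axis i 1) - u (x + t *\<^sub>R axis j 1) + u x
       = t\<^sup>2 * H (x + s *\<^sub>R axis i 1 + s' *\<^sub>R axis j 1) $ i $ j"
      by (simp add: \<phi>_def sw cart_eq_inner_axis power2_eq_square)
  qed
qed

lemma hessian_symmetric:
  assumes u: "C1_grad u p \<Omega>" and p: "\<And>i. C1_grad (\<lambda>x. p x $ i) (\<lambda>x. H x $ i) \<Omega>" and "open \<Omega>" "x \<in> \<Omega>"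
  shows "H x $ 2 $ 1 = H x $ 1 $ 2"
proof (rule ccontr)
  assume "H x $ 2 $ 1 \<noteq> H x $ 1 $ 2"
  define e where "e = \<bar>H x $ 2 $ 1 - H x $ 1 $ 2\<bar> / 2"
  have e: "e > 0" using \<open>H x $ 2 $ 1 \<noteq> H x $ 1 $ 2\<close> by (simp add: e_def)
  have "continuous_on \<Omega> (\<lambda>x. H x $ i $ j)" for i j
    by (rule continuous_on_component) (use p[of i] in \<open>simp add: C1_grad_def\<close>)
  then have "isCont (\<lambda>x. H x $ i $ j) x" for i j using assms(3,4) continuous_on_eq_continuous_at by blast
  then have "\<exists>d>0. \<forall>y. dist y x < d \<longrightarrow> \<bar>H y $ i $ j - H x $ i $ j\<bar> < e" for i j
    using e unfolding continuous_at_eps_delta dist_real_def by metis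
  then obtain d12 d21 where d: "d12 > 0" "\<And>y. dist y x < d12 \<Longrightarrow> \<bar>H y $ 1 $ 2 - H x $ 1 $ 2\<bar> < e"
    "d21 > 0" "\<And>y. dist y x < d21 \<Longrightarrow> \<bar>H y $ 2 $ 1 - H x $ 2 $ 1\<bar> < e" by metis
  obtain d0 where d0: "d0 > 0" "cball x d0 \<subseteq> \<Omega>" using assms(3,4) open_contains_cball by blast
  define t where "t = Min {d0, d12, d21} / 3"
  have t: "t > 0" "2 * t < d0" "2 * t < d12" "2 * t < d21" using d d0 by (auto simp: t_def)
  have sub: "cball x (2 * t) \<subseteq> \<Omega>" using d0 t by (auto simp: subset_iff)
  obtain y where y: "y \<in> cball x (2 * t)" "u (x + t *\<^sub>R axis 1 1 + t *\<^sub>R axis 2 1) - u (x + t *\<^sub>R axis 1 1) - u (x + t *\<^sub>R axis 2 1) + u x = t\<^sup>2 * H y $ 1 $ 2"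
    using second_difference[OF u p t(1) sub, of 1 2] by blast
  obtain z where z: "z \<in> cball x (2 * t)" "u (x + t *\<^sub>R axis 2 1 + t *\<^sub>R axis 1 1) - u (x + t *\<^sub>R axis 2 1) - u (x + t *\<^sub>R axis 1 1) + u x = t\<^sup>2 * H z $ 2 $ 1"
    using second_difference[OF u p t(1) sub, of 2 1] by blast
  have sw: "x + t *\<^sub>R axis 2 1 + t *\<^sub>R axis 1 1 = x + t *\<^sub>R axis 1 1 + t *\<^sub>R axis 2 1" by simp
  have "t\<^sup>2 * H y $ 1 $ 2 = t\<^sup>2 * H z $ 2 $ 1" using y(2) z(2)[unfolded sw] by linarith
  then have "H y $ 1 $ 2 = H z $ 2 $ 1" using t(1) by simp
  moreover have "\<bar>H y $ 1 $ 2 - H x $ 1 $ 2\<bar> < e" "\<bar>H z $ 2 $ 1 - H x $ 2 $ 1\<bar> < e"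
    using d(2)[of y] d(4)[of z] y z t by (auto simp: dist_commute)
  ultimately show False unfolding e_def by (smt (verit) field_sum_of_halves)
qed

lemma C2_on_weing_sol:
  assumes C2: "C2_on (ball_compl R) u" and W: "weingarten_graph f (ball_compl R) u"
  shows "weing_sol f {x. norm x > R} (grad_on (ball_compl R) u) (hess_on (ball_compl R) u)"
  unfolding weing_sol_def
proof (intro conjI allI ballI)
  show 1: "C1_grad (\<lambda>x. grad_on (ball_compl R) u x $ i) (\<lambda>x. hess_on (ball_compl R) u x $ i) {x. norm x > R}" for i
    by (rule C2_on_C1_grad(2)[OF C2])
  fix x :: "real^2" assume x: "x \<in> {x. norm x > R}"
  have op: "open {x::real^2. norm x > R}" by (intro open_Collect_less continuous_intros)
  show sym: "hess_on (ball_compl R) u x $2$1 = hess_on (ball_compl R) u x $1$2"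
    by (rule hessian_symmetric[OF C2_on_C1_grad(1)[OF C2] 1 op x])
  obtain \<kappa>\<^sub>1 where "principal_curvatures (ball_compl R) u x \<kappa>\<^sub>1 (f \<kappa>\<^sub>1)" "\<kappa>\<^sub>1 \<ge> 0"
    using W x unfolding weingarten_graph_def by force
  then show "weing f (grad_on (ball_compl R) u x) (hess_on (ball_compl R) u x)"
    using weing_if_principal_curvatures sym by blast
qed

text \<open>The third component of the normal already determines the norm of the gradient.\<close>

lemma grad_tendsto_0:
  assumes "(upward_normal S u \<longlongrightarrow> vector [0, 0, 1]) at_infinity"
  shows "(grad_on S u \<longlongrightarrow> 0) at_infinity"
proof -
  define n where "n x = 1 / sqrt (1 + (norm (grad_on S u x))\<^sup>2)" for x
  have "((\<lambda>x. upward_normal S u x $ 3) \<longlongrightarrow> (vector [0, 0, 1] :: real^3) $ 3) at_infinity"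
    by (rule tendsto_vec_nth[OF assms])
  then have "(n \<longlongrightarrow> 1) at_infinity" by (simp add: upward_normal_def n_def[abs_def] vector_3)
  then have "((\<lambda>x. sqrt (1 / (n x)\<^sup>2 - 1)) \<longlongrightarrow> sqrt (1 / 1\<^sup>2 - 1)) at_infinity"
    by (intro tendsto_intros) auto
  moreover have "sqrt (1 / (n x)\<^sup>2 - 1) = norm (grad_on S u x)" for x
    by (simp add: n_def power_divide add_nonneg_nonneg)
  ultimately show ?thesis by (simp add: tendsto_norm_zero_iff)
qed

lemma second_derivative_test:
  fixes W :: "real^2 \<Rightarrow> real"
  assumes op: "open \<Omega>" "x0 \<in> \<Omega>" and W: "C1_grad W g \<Omega>" "\<And>i. C1_grad (\<lambda>x. g x $ i) (\<lambda>x. H x $ i) \<Omega>"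
    and min: "\<And>x. x \<in> \<Omega> \<Longrightarrow> W x0 \<le> W x"
  shows "g x0 = 0" "h \<bullet> (H x0 *v h) \<ge> 0"
proof -
  have "(W has_derivative (\<lambda>h. g x0 \<bullet> h)) (at x0)" using W(1) op by (simp add: C1_grad_def)
  from differential_zero_maxmin[OF op(2,1) this] min have "(\<lambda>h. g x0 \<bullet> h) = (\<lambda>v. 0)" by blast
  then have "g x0 \<bullet> g x0 = 0" by metis
  then show g0: "g x0 = 0" by simp
  show "h \<bullet> (H x0 *v h) \<ge> 0"
  proof (rule ccontr)
    assume neg: "\<not> h \<bullet> (H x0 *v h) \<ge> 0"
    have "open ((\<lambda>s. x0 + s *\<^sub>R h) -` \<Omega>)"
      by (rule open_vimage[OF op(1)]) (intro continuous_intros)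
    then obtain d where d: "d > 0" "ball 0 d \<subseteq> (\<lambda>s. x0 + s *\<^sub>R h) -` \<Omega>"
      using op(2) open_contains_ball[of "(\<lambda>s. x0 + s *\<^sub>R h) -` \<Omega>"] by force
    have in\<Omega>: "x0 + s *\<^sub>R h \<in> \<Omega>" if "0 \<le> s" "s < d" for s using d(2) that by (auto simp: subset_iff dist_real_def)
    define \<phi>' where "\<phi>' s = g (x0 + s *\<^sub>R h) \<bullet> h" for s
    have \<phi>: "((\<lambda>s. W (x0 + s *\<^sub>R h)) has_real_derivative \<phi>' s) (at s)" if "0 \<le> s" "s < d" for s
      unfolding \<phi>'_def by (rule C1_grad_real_derivative[OF W(1) in\<Omega>[OF that]])
    have "((\<lambda>s. g (x0 + s *\<^sub>R h) $ 1 * h $ 1 + g (x0 + s *\<^sub>R h) $ 2 * h $ 2) has_real_derivative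
       (H (x0 + 0 *\<^sub>R h) $ 1 \<bullet> h) * h $ 1 + (H (x0 + 0 *\<^sub>R h) $ 2 \<bullet> h) * h $ 2) (at 0)"
      using in\<Omega>[of 0] d(1) by (intro DERIV_add DERIV_cmult_right C1_grad_real_derivative[OF W(2)]) auto
    moreover have "(H x0 $ 1 \<bullet> h) * h $ 1 + (H x0 $ 2 \<bullet> h) * h $ 2 = h \<bullet> (H x0 *v h)"
      by (simp add: inner_R2 matrix_vector_mult_def sum_2)
    ultimately have "(\<phi>' has_real_derivative h \<bullet> (H x0 *v h)) (at 0)" by (simp add: \<phi>'_def[abs_def] inner_R2)
    from has_real_derivative_neg_dec_right[OF this] neg obtain d' where d': "d' > 0" "\<And>s. 0 < s \<Longrightarrow> s < d' \<Longrightarrow> \<phi>' s < \<phi>' 0" by auto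
    define s where "s = min d d' / 2"
    have s: "0 < s" "s < d" "s < d'" using d d' by (auto simp: s_def)
    obtain z where z: "0 < z" "z < s" "W (x0 + s *\<^sub>R h) - W (x0 + 0 *\<^sub>R h) = (s - 0) * \<phi>' z"
      using MVT2[of 0 s "\<lambda>s. W (x0 + s *\<^sub>R h)" \<phi>'] s \<phi> by auto
    have "\<phi>' z < 0" using d'(2)[of z] z s g0 by (simp add: \<phi>'_def)
    then have "s * \<phi>' z < 0" using s by (intro mult_pos_neg) auto
    then have "W (x0 + s *\<^sub>R h) < W x0" using z by simp
    then show False using min[OF in\<Omega>[of s]] s by simp
  qed
qed

context curvature_relation
begin

text \<open>The exponent is obtained before the solution is given, since it depends only on the
  constant \<open>q\<close> of \<open>det_weing_diff\<close>; two solutions therefore share it. The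
  Hessian at \<open>x\<close> is estimated on the disc of radius \<open>norm x / 2\<close>, which
  costs the factor \<open>2 powr \<gamma>\<close>.\<close>

lemma solution_decay:
  obtains \<gamma> where "\<gamma> > 0"
    "\<And>p H R0. weing_sol f {x. norm x > R0} p H \<Longrightarrow> (p \<longlongrightarrow> 0) at_infinity \<Longrightarrow>
       \<exists>C>0. \<exists>R>0. \<forall>x. norm x \<ge> R \<longrightarrow> norm (p x) \<le> C * norm x powr (- \<gamma>) \<and> norm (H x) \<le> C * (norm x powr (- \<gamma>) / norm x)"
proof -
  obtain \<eta> q C where \<eta>: "\<eta> > 0" "\<eta> \<le> 1" "q > 0" "C > 0" and
    D: "\<And>p q' M N. weing f p M \<Longrightarrow> weing f q' N \<Longrightarrow> M$2$1 = M$1$2 \<Longrightarrow> N$2$1 = N$1$2 \<Longrightarrow> norm p \<le> \<eta> \<Longrightarrow> norm q' \<le> \<eta> \<Longrightarrow>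
       det (M - N) \<le> - q * (norm (M - N))\<^sup>2 + C * ((norm p + norm q') * norm (p - q') * norm N)\<^sup>2"
    using det_weing_diff by blast
  obtain \<eta>' K where K: "\<eta>' > 0" "K > 0" and int: 
    "\<And>x0 \<rho> m p H \<Omega>. weing_sol f \<Omega> p H \<Longrightarrow> cball x0 \<rho> \<subseteq> \<Omega> \<Longrightarrow> 0 < \<rho> \<Longrightarrow> 0 < m \<Longrightarrow> m \<le> \<eta>' \<Longrightarrow>
      (\<And>x. x \<in> cball x0 \<rho> \<Longrightarrow> norm (p x) \<le> m) \<Longrightarrow> norm (H x0) \<le> K * (m / \<rho>)"
    using hessian_interior by blast
  define \<gamma> where "\<gamma> = q / (2 * pi)"
  have \<gamma>: "\<gamma> > 0" using \<eta> by (simp add: \<gamma>_def)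
  show ?thesis
  proof (rule that[OF \<gamma>])
    fix p H R0 assume sol: "weing_sol f {x. norm x > R0} p H" and lim: "(p \<longlongrightarrow> 0) at_infinity"
    obtain R1 where R1: "\<And>x. norm x \<ge> R1 \<Longrightarrow> norm (p x) < \<eta>"
      using tendstoD[OF lim \<eta>(1)] unfolding eventually_at_infinity by (auto simp: dist_norm)
    define R2 where "R2 = max R0 R1"
    have sol2: "weing_sol f {x. norm x > R2} p H" by (rule weing_sol_subset[OF sol]) (auto simp: R2_def)
    have J: "cross2 (H x $ 1) (H x $ 2) \<le> - q * ((norm (H x $ 1))\<^sup>2 + (norm (H x $ 2))\<^sup>2)" if "norm x > R2" for x
    proof -
      have x: "x \<in> {x. norm x > R2}" using that by simp
      show ?thesis
        using D[OF weing_solD(3)[OF sol2 x] weing_0 weing_solD(2)[OF sol2 x]] R1[of x] that \<eta>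
        unfolding cross2_rows norm_rows by (simp add: R2_def)
    qed
    have limi: "((\<lambda>x. p x $ i) \<longlongrightarrow> 0) at_infinity" for i using tendsto_vec_nth[OF lim, of i] by simp
    obtain C1 S1 where C1: "C1 > 0" "S1 > 0" "\<And>x. norm x \<ge> S1 \<Longrightarrow> \<bar>p x $ 1\<bar> \<le> C1 * norm x powr (- \<gamma>)"
      using quasiregular_decay[OF weing_solD(1)[OF sol2, of 1] weing_solD(1)[OF sol2, of 2] J \<eta>(3) limi] unfolding \<gamma>_def by blast
    \<comment> \<open>\<open>quasiregular_decay\<close> only bounds the first function of a pair,
      hence the rotated pair for the second component.\<close>
    have J2: "cross2 (H x $ 2) (- (H x $ 1)) \<le> - q * ((norm (H x $ 2))\<^sup>2 + (norm (- (H x $ 1)))\<^sup>2)" if "norm x > R2" for x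
      using J[OF that] by (simp add: cross2_def algebra_simps)
    obtain C2 S2 where C2: "C2 > 0" "S2 > 0" "\<And>x. norm x \<ge> S2 \<Longrightarrow> \<bar>p x $ 2\<bar> \<le> C2 * norm x powr (- \<gamma>)"
      using quasiregular_decay[OF weing_solD(1)[OF sol2, of 2] C1_grad_minus[OF weing_solD(1)[OF sol2, of 1]] J2 \<eta>(3) limi] unfolding \<gamma>_def by blast
    define C3 where "C3 = C1 + C2"
    define S3 where "S3 = Max {S1, S2, R2 + 1, 1}"
    have S3: "S3 \<ge> S1" "S3 \<ge> S2" "S3 \<ge> R2 + 1" "S3 \<ge> 1" by (simp_all add: S3_def)
    have C3: "C3 > 0" using C1 C2 by (simp add: C3_def)
    have pb: "norm (p x) \<le> C3 * norm x powr (- \<gamma>)" if "norm x \<ge> S3" for x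
    proof -
      have "norm (p x) \<le> \<bar>p x $ 1\<bar> + \<bar>p x $ 2\<bar>" using norm_le_l1_cart[of "p x"] by (simp add: sum_2)
      then show ?thesis using C1(3)[of x] C2(3)[of x] that S3 by (simp add: C3_def distrib_right)
    qed
    have "((\<lambda>r. C3 * r powr (- \<gamma>)) \<longlongrightarrow> 0) at_top"
      using tendsto_mult_right_zero[OF tendsto_neg_powr[OF _ filterlim_ident], of "- \<gamma>"] \<gamma> by simp
    from order_tendstoD(2)[OF this K(1)] obtain S4 where S4: "\<And>r. r \<ge> S4 \<Longrightarrow> C3 * r powr (- \<gamma>) < \<eta>'"
      unfolding eventually_at_top_linorder by blast
    define S5 where "S5 = 2 * max S3 S4"
    define C4 where "C4 = C3 + 2 * K * C3 * 2 powr \<gamma>"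
    have C4: "C4 \<ge> C3" "C4 \<ge> 2 * K * C3 * 2 powr \<gamma>" using K C3 by (simp_all add: C4_def)
    show "\<exists>C>0. \<exists>R>0. \<forall>x. norm x \<ge> R \<longrightarrow> norm (p x) \<le> C * norm x powr (- \<gamma>) \<and> norm (H x) \<le> C * (norm x powr (- \<gamma>) / norm x)"
    proof (intro exI conjI allI impI)
      show "C4 > 0" using C3 C4 by linarith
      show "S5 > 0" using S3 by (simp add: S5_def)
      fix x :: "real^2" assume x: "norm x \<ge> S5"
      have x0: "norm x > 0" "norm x \<ge> S3" "norm x / 2 \<ge> S3" "norm x / 2 \<ge> S4" using x S3 by (auto simp: S5_def)
      have "C3 * norm x powr (- \<gamma>) \<le> C4 * norm x powr (- \<gamma>)" using C4 by (intro mult_right_mono) auto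
      then show "norm (p x) \<le> C4 * norm x powr (- \<gamma>)" using pb[OF x0(2)] by linarith
      define m where "m = C3 * (norm x / 2) powr (- \<gamma>)"
      have far: "norm y \<ge> norm x / 2" if "y \<in> cball x (norm x / 2)" for y
        using that norm_triangle_ineq3[of x y] by (simp add: dist_norm)
      have "norm (H x) \<le> K * (m / (norm x / 2))"
      proof (rule int[OF sol])
        show "cball x (norm x / 2) \<subseteq> {x. R0 < norm x}"
          using far x0 S3 by (force simp: R2_def)
        show "0 < norm x / 2" "0 < m" "m \<le> \<eta>'" using x0 C3 S4[OF x0(4)] by (auto simp: m_def)
        show "norm (p y) \<le> m" if "y \<in> cball x (norm x / 2)" for y
        proof -
          have "norm (p y) \<le> C3 * norm y powr (- \<gamma>)" using far[OF that] x0 by (intro pb) linarith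
          also have "\<dots> \<le> m" unfolding m_def using far[OF that] x0 \<gamma> C3 by (intro mult_left_mono powr_mono2') auto
          finally show ?thesis .
        qed
      qed
      also have "(norm x / 2) powr (- \<gamma>) = 2 powr \<gamma> * norm x powr (- \<gamma>)"
        using x0 by (simp add: powr_divide powr_minus_divide)
      then have "K * (m / (norm x / 2)) = (2 * K * C3 * 2 powr \<gamma>) * (norm x powr (- \<gamma>) / norm x)"
        by (simp add: m_def)
      also have "\<dots> \<le> C4 * (norm x powr (- \<gamma>) / norm x)" using C4 by (intro mult_right_mono) auto
      finally show "norm (H x) \<le> C4 * (norm x powr (- \<gamma>) / norm x)" .
    qed
  qed
qed

end

section \<open>Comparison of two solutions\<close>

lemma C1_grad_diff:
  "C1_grad a ga \<Omega> \<Longrightarrow> C1_grad b gb \<Omega> \<Longrightarrow> C1_grad (\<lambda>x. a x - b x) (\<lambda>x. ga x - gb x) \<Omega>"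
  unfolding C1_grad_def inner_diff_left by (auto intro!: continuous_on_diff has_derivative_diff)

text \<open>The matrix \<alpha> I + \<beta> y y^T. It is the Hessian of
  \<open>G ((norm (x - c))\<^sup>2)\<close> for \<open>y = x - c\<close>, with \<alpha> twice the
  first and \<beta> four times the second derivative of \<open>G\<close>.\<close>

definition rad_hess :: "real \<Rightarrow> real \<Rightarrow> real^2 \<Rightarrow> real^2^2" where
  "rad_hess \<alpha> \<beta> y = (\<chi> i j. (if i = j then \<alpha> else 0) + \<beta> * (y$i * y$j))"

lemma rad_hess_component: "rad_hess \<alpha> \<beta> y $ i = \<alpha> *\<^sub>R axis i 1 + (\<beta> * y$i) *\<^sub>R y"
  by (auto simp: rad_hess_def vec_eq_iff axis_def)

lemma rad_hess_sym: "rad_hess \<alpha> \<beta> y $ 2 $ 1 = rad_hess \<alpha> \<beta> y $ 1 $ 2"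
  by (simp add: rad_hess_def mult.commute)

text \<open>Written in the squared distance, so that the chain rule involves no square root and the
  centre is no exception.\<close>

lemma C1_grad_radial:
  assumes G: "\<And>x. x \<in> \<Omega> \<Longrightarrow> (G has_real_derivative G1 ((norm (x - c))\<^sup>2)) (at ((norm (x - c))\<^sup>2))"
    "\<And>x. x \<in> \<Omega> \<Longrightarrow> (G1 has_real_derivative G2 ((norm (x - c))\<^sup>2)) (at ((norm (x - c))\<^sup>2))"
    "continuous_on \<Omega> (\<lambda>x. G2 ((norm (x - c))\<^sup>2))"
  shows "C1_grad (\<lambda>x. G ((norm (x - c))\<^sup>2)) (\<lambda>x. (2 * G1 ((norm (x - c))\<^sup>2)) *\<^sub>R (x - c)) \<Omega>"
    "C1_grad (\<lambda>x. ((2 * G1 ((norm (x - c))\<^sup>2)) *\<^sub>R (x - c)) $ i)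
       (\<lambda>x. rad_hess (2 * G1 ((norm (x - c))\<^sup>2)) (4 * G2 ((norm (x - c))\<^sup>2)) (x - c) $ i) \<Omega>"
proof -
  have sq: "((\<lambda>x. (norm (x - c))\<^sup>2) has_derivative (\<lambda>h. 2 * ((x - c) \<bullet> h))) (at x)" for x :: "real^2"
    unfolding power2_norm_eq_inner by (auto intro!: derivative_eq_intros simp: inner_commute)
  have comp: "((\<lambda>x. F ((norm (x - c))\<^sup>2)) has_derivative (\<lambda>h. F' * (2 * ((x - c) \<bullet> h)))) (at x)"
    if "(F has_real_derivative F') (at ((norm (x - c))\<^sup>2))" for F F' and x :: "real^2"
    using has_derivative_compose[OF sq, of F "\<lambda>h. F' * h"] that by (simp add: has_field_derivative_def)
  have cG1: "continuous_on \<Omega> (\<lambda>x. G1 ((norm (x - c))\<^sup>2))"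
    by (rule continuous_at_imp_continuous_on) (use has_derivative_continuous[OF comp[OF G(2)]] in blast)
  show "C1_grad (\<lambda>x. G ((norm (x - c))\<^sup>2)) (\<lambda>x. (2 * G1 ((norm (x - c))\<^sup>2)) *\<^sub>R (x - c)) \<Omega>"
    unfolding C1_grad_def
  proof (intro conjI ballI)
    show "continuous_on \<Omega> (\<lambda>x. (2 * G1 ((norm (x - c))\<^sup>2)) *\<^sub>R (x - c))" by (intro continuous_intros cG1)
    show "((\<lambda>x. G ((norm (x - c))\<^sup>2)) has_derivative (\<lambda>h. (2 * G1 ((norm (x - c))\<^sup>2)) *\<^sub>R (x - c) \<bullet> h)) (at x)" if "x \<in> \<Omega>" for x
      using comp[OF G(1)[OF that]] by (simp add: mult_ac)
  qed
  show "C1_grad (\<lambda>x. ((2 * G1 ((norm (x - c))\<^sup>2)) *\<^sub>R (x - c)) $ i)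
       (\<lambda>x. rad_hess (2 * G1 ((norm (x - c))\<^sup>2)) (4 * G2 ((norm (x - c))\<^sup>2)) (x - c) $ i) \<Omega>"
    unfolding C1_grad_def rad_hess_component
  proof (intro conjI ballI)
    show "continuous_on \<Omega> (\<lambda>x. (2 * G1 ((norm (x - c))\<^sup>2)) *\<^sub>R axis i 1 + (4 * G2 ((norm (x - c))\<^sup>2) * (x - c) $ i) *\<^sub>R (x - c))"
      by (intro continuous_intros cG1 G(3))
    fix x assume x: "x \<in> \<Omega>"
    have "((\<lambda>x. (x - c) $ i) has_derivative (\<lambda>h. h $ i)) (at x)"
      by (rule bounded_linear.has_derivative[OF bounded_linear_vec_nth]) (auto intro!: derivative_eq_intros)
    from has_derivative_mult[OF has_derivative_mult_right[OF comp[OF G(2)[OF x]], of 2] this]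
    have "((\<lambda>x. 2 * G1 ((norm (x - c))\<^sup>2) * (x - c) $ i) has_derivative
      (\<lambda>h. 2 * G1 ((norm (x - c))\<^sup>2) * h $ i + 2 * (G2 ((norm (x - c))\<^sup>2) * (2 * ((x - c) \<bullet> h))) * (x - c) $ i)) (at x)" .
    moreover have "(\<lambda>h. 2 * G1 ((norm (x - c))\<^sup>2) * h $ i + 2 * (G2 ((norm (x - c))\<^sup>2) * (2 * ((x - c) \<bullet> h))) * (x - c) $ i)
       = (\<lambda>h. ((2 * G1 ((norm (x - c))\<^sup>2)) *\<^sub>R axis i 1 + (4 * G2 ((norm (x - c))\<^sup>2) * (x - c) $ i) *\<^sub>R (x - c)) \<bullet> h)"
      by (simp add: inner_add_left inner_axis' algebra_simps)
    ultimately show "((\<lambda>x. ((2 * G1 ((norm (x - c))\<^sup>2)) *\<^sub>R (x - c)) $ i) has_derivative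
       (\<lambda>h. ((2 * G1 ((norm (x - c))\<^sup>2)) *\<^sub>R axis i 1 + (4 * G2 ((norm (x - c))\<^sup>2) * (x - c) $ i) *\<^sub>R (x - c)) \<bullet> h)) (at x)"
      by simp
  qed
qed

text \<open>The first- and second-order conditions at a minimum of \<open>u - v - G\<close>; they
  give \<open>pucci\<close> its semidefinite matrix, with the radial Hessian as \<open>X\<close>,
  and express the difference of the gradients through \<open>G\<close>.\<close>

lemma touching:
  assumes op: "open \<Omega>" "x0 \<in> \<Omega>"
    and u: "C1_grad u p \<Omega>" "weing_sol f \<Omega> p M" and v: "C1_grad v q \<Omega>" "weing_sol f \<Omega> q N"
    and G: "\<And>x. x \<in> \<Omega> \<Longrightarrow> (G has_real_derivative G1 ((norm (x - c))\<^sup>2)) (at ((norm (x - c))\<^sup>2))"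
    "\<And>x. x \<in> \<Omega> \<Longrightarrow> (G1 has_real_derivative G2 ((norm (x - c))\<^sup>2)) (at ((norm (x - c))\<^sup>2))"
    "continuous_on \<Omega> (\<lambda>x. G2 ((norm (x - c))\<^sup>2))"
    and min: "\<And>x. x \<in> \<Omega> \<Longrightarrow> u x0 - v x0 - G ((norm (x0 - c))\<^sup>2) \<le> u x - v x - G ((norm (x - c))\<^sup>2)"
  shows "p x0 - q x0 = (2 * G1 ((norm (x0 - c))\<^sup>2)) *\<^sub>R (x0 - c)"
    "h \<bullet> ((M x0 - N x0 - rad_hess (2 * G1 ((norm (x0 - c))\<^sup>2)) (4 * G2 ((norm (x0 - c))\<^sup>2)) (x0 - c)) *v h) \<ge> 0"
proof -
  have 1: "C1_grad (\<lambda>x. u x - v x - G ((norm (x - c))\<^sup>2)) (\<lambda>x. p x - q x - (2 * G1 ((norm (x - c))\<^sup>2)) *\<^sub>R (x - c)) \<Omega>"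
    by (intro C1_grad_diff u v C1_grad_radial(1)[of \<Omega> G G1 c G2, OF G])
  have 2: "C1_grad (\<lambda>x. (p x - q x - (2 * G1 ((norm (x - c))\<^sup>2)) *\<^sub>R (x - c)) $ i)
      (\<lambda>x. (M x - N x - rad_hess (2 * G1 ((norm (x - c))\<^sup>2)) (4 * G2 ((norm (x - c))\<^sup>2)) (x - c)) $ i) \<Omega>" for i
    unfolding vector_minus_component[of "p _ - q _"] vector_minus_component[of "M _ - N _"] vector_minus_component[of "p _"] vector_minus_component[of "M _"]
    by (intro C1_grad_diff weing_solD(1)[OF u(2)] weing_solD(1)[OF v(2)] C1_grad_radial(2)[of \<Omega> G G1 c G2, OF G])
  from second_derivative_test[OF op 1 2 min]
  show "p x0 - q x0 = (2 * G1 ((norm (x0 - c))\<^sup>2)) *\<^sub>R (x0 - c)"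
    "h \<bullet> ((M x0 - N x0 - rad_hess (2 * G1 ((norm (x0 - c))\<^sup>2)) (4 * G2 ((norm (x0 - c))\<^sup>2)) (x0 - c)) *v h) \<ge> 0"
    by simp_all
qed

lemma shape_rad_hess:
  "shape_trace p (rad_hess \<alpha> \<beta> y) = \<alpha> * shape_trace p (rad_hess 1 0 y) + \<beta> * shape_trace p (rad_hess 0 1 y)"
  "shape_dev p (rad_hess \<alpha> \<beta> y) = complex_of_real \<alpha> * shape_dev p (rad_hess 1 0 y) + complex_of_real \<beta> * shape_dev p (rad_hess 0 1 y)"
  by (simp_all add: shape_trace_def shape_dev_def shape11_def shape12_def shape22_def rad_hess_def complex_eq_iff algebra_simps)

text \<open>y y^T has rank one, so its shape operator has determinant 0 and the modulus of the
  deviation equals the trace. The lower bound is ellipticity in direction \<open>y\<close>; the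
  exponent 2 instead of 3/2 avoids a root.\<close>

lemma shape_outer:
  "(norm y)\<^sup>2 / (1 + (norm p)\<^sup>2)\<^sup>2 \<le> shape_trace p (rad_hess 0 1 y)"
  "cmod (shape_dev p (rad_hess 0 1 y)) \<le> shape_trace p (rad_hess 0 1 y)"
proof -
  define w where "w = 1 + (norm p)\<^sup>2"
  have w: "w \<ge> 1" by (simp add: w_def)
  have "shape_trace p (rad_hess 0 1 y) * (w * sqrt w) = (norm y)\<^sup>2 + (p$2 * y$1 - p$1 * y$2)\<^sup>2"
    unfolding w_def shape_trace_eq norm_R2[of y] by (simp add: rad_hess_def power2_eq_square algebra_simps)
  then have *: "(norm y)\<^sup>2 \<le> shape_trace p (rad_hess 0 1 y) * (w * sqrt w)" by simp
  have tr: "shape_trace p (rad_hess 0 1 y) \<ge> 0"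
  proof (rule ccontr)
    assume "\<not> shape_trace p (rad_hess 0 1 y) \<ge> 0"
    then have "shape_trace p (rad_hess 0 1 y) * (w * sqrt w) < 0" using w by (intro mult_neg_pos) auto
    then show False using * by (smt (verit) zero_le_power2)
  qed
  have "sqrt w \<le> w" using w by (simp add: real_le_lsqrt power2_eq_square mult_le_cancel_left1 real_sqrt_le_iff')
  then have "w * sqrt w \<le> w\<^sup>2" using w by (simp add: power2_eq_square)
  then have "(norm y)\<^sup>2 \<le> shape_trace p (rad_hess 0 1 y) * w\<^sup>2" using * tr by (meson mult_left_mono order_trans)
  moreover have "0 < w\<^sup>2" using w by simp
  ultimately show "(norm y)\<^sup>2 / (1 + (norm p)\<^sup>2)\<^sup>2 \<le> shape_trace p (rad_hess 0 1 y)"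
    unfolding w_def[symmetric] by (simp add: pos_divide_le_eq)
  have "det (rad_hess 0 1 y) = 0" by (simp add: det_2 rad_hess_def)
  then have "(cmod (shape_dev p (rad_hess 0 1 y)))\<^sup>2 = (shape_trace p (rad_hess 0 1 y))\<^sup>2"
    using shape_det_eq[OF rad_hess_sym[of 0 1 y], of p] by simp
  then show "cmod (shape_dev p (rad_hess 0 1 y)) \<le> shape_trace p (rad_hess 0 1 y)"
    using tr by (simp add: power2_eq_iff_nonneg)
qed

lemma shape_identity: "cmod (shape_dev p (rad_hess 1 0 y)) \<le> shape_trace p (rad_hess 1 0 y)"
proof (rule shape_psd[OF rad_hess_sym])
  fix h :: "real^2"
  show "0 \<le> h \<bullet> (rad_hess 1 0 y *v h)"
    by (simp add: inner_R2 matrix_vector_mult_def sum_2 rad_hess_def)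
qed

lemma norm_rad_hess: "norm (rad_hess \<alpha> \<beta> y) \<le> 2 * \<bar>\<alpha>\<bar> + \<bar>\<beta>\<bar> * (norm y)\<^sup>2"
proof -
  have dec: "rad_hess \<alpha> \<beta> y = \<alpha> *\<^sub>R rad_hess 1 0 y + \<beta> *\<^sub>R rad_hess 0 1 y"
    by (simp add: vec_eq_iff rad_hess_def)
  have "(norm (rad_hess 1 0 y))\<^sup>2 \<le> 2\<^sup>2" by (simp add: norm_R22 rad_hess_def)
  then have 1: "norm (rad_hess 1 0 y) \<le> 2" by (rule power2_le_imp_le) simp
  have "(norm (rad_hess 0 1 y))\<^sup>2 = ((norm y)\<^sup>2)\<^sup>2"
    unfolding norm_R22 norm_R2[of y] by (simp add: rad_hess_def power2_eq_square algebra_simps)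
  then have 2: "norm (rad_hess 0 1 y) = (norm y)\<^sup>2" by (metis norm_ge_zero power2_eq_iff_nonneg zero_le_power2)
  have "norm (rad_hess \<alpha> \<beta> y) \<le> \<bar>\<alpha>\<bar> * norm (rad_hess 1 0 y) + \<bar>\<beta>\<bar> * norm (rad_hess 0 1 y)"
    unfolding dec by (rule order_trans[OF norm_triangle_ineq]) simp
  also have "\<dots> \<le> \<bar>\<alpha>\<bar> * 2 + \<bar>\<beta>\<bar> * (norm y)\<^sup>2" using 1 2 by (intro add_mono mult_left_mono) auto
  finally show ?thesis by simp
qed

section \<open>Touching points and the strong maximum principle\<close>

context curvature_relation
begin

text \<open>The barrier is Hopf's exponential, with value \<open>e\<close> at the point and
  derivatives \<open>- \<gamma> * e\<close> and \<open>\<gamma>\<^sup>2 * e\<close> in the squared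
  radius. In \<open>pucci\<close> only the rank-one term is quadratic in \<open>\<gamma>\<close>,
  and it enters with the positive factor \<open>1 - contr\<close>. Hence the conclusion is an upper
  bound for \<open>\<gamma>\<close> at points away from the centre, and a large
  \<open>\<gamma>\<close> excludes touching.\<close>

lemma hopf_pointwise:
  assumes W: "weing f p M" "weing f q N" and sym: "M$2$1 = M$1$2" "N$2$1 = N$1$2"
    and bd: "norm p \<le> P" "norm q \<le> P" "norm N \<le> A" and C: "shape_bound P C" and e: "e > 0" and g: "\<gamma> > 0"
    and D: "p - q = (2 * (- \<gamma> * e)) *\<^sub>R y"
    and psd: "\<And>h. h \<bullet> ((M - N - rad_hess (2 * (- \<gamma> * e)) (4 * (\<gamma>\<^sup>2 * e)) y) *v h) \<ge> 0"
  shows "\<gamma> * ((1 - contr) * ((norm y)\<^sup>2 / (1 + P\<^sup>2)\<^sup>2)) \<le> 2 * C + 2 * C * P * A * norm y"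
proof -
  define T1 T2 where "T1 = shape_trace p (rad_hess 1 0 y)" and "T2 = shape_trace p (rad_hess 0 1 y)"
  define E where "E = (norm p + norm q) * norm (p - q) * norm N"
  note Cb = shape_boundD[OF C]
  define X where "X = rad_hess (2 * (- \<gamma> * e)) (4 * (\<gamma>\<^sup>2 * e)) y"
  have P: "P \<ge> 0" using bd(1) norm_ge_zero order_trans by blast
  have A: "A \<ge> 0" using bd(3) norm_ge_zero order_trans by blast
  have "norm (rad_hess 1 0 y) \<le> 2" using norm_rad_hess[of 1 0 y] by simp
  then have T1: "0 \<le> T1" "T1 \<le> 2 * C"
    using shape_identity[of p y] norm_ge_zero[of "shape_dev p (rad_hess 1 0 y)"] Cb(2)[OF bd(1), of "rad_hess 1 0 y"] 
      mult_left_mono[of "norm (rad_hess 1 0 y)" 2 C] Cb(1)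
    unfolding T1_def by linarith+
  have T2: "T2 \<ge> 0" using shape_outer(2)[of p y] norm_ge_zero order_trans unfolding T2_def by blast
  have tr: "shape_trace p X = - 2 * (\<gamma> * e) * T1 + 4 * (\<gamma>\<^sup>2 * e) * T2"
    unfolding X_def by (subst shape_rad_hess(1)) (simp add: T1_def T2_def)
  have dev: "cmod (shape_dev p X) \<le> 2 * (\<gamma> * e) * T1 + 4 * (\<gamma>\<^sup>2 * e) * T2"
  proof -
    have "cmod (shape_dev p X) \<le> cmod (complex_of_real (2 * (- \<gamma> * e)) * shape_dev p (rad_hess 1 0 y)) + cmod (complex_of_real (4 * (\<gamma>\<^sup>2 * e)) * shape_dev p (rad_hess 0 1 y))"
      unfolding X_def by (subst shape_rad_hess(2)) (rule norm_triangle_ineq)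
    also have "\<dots> = (2 * (\<gamma> * e)) * cmod (shape_dev p (rad_hess 1 0 y)) + (4 * (\<gamma>\<^sup>2 * e)) * cmod (shape_dev p (rad_hess 0 1 y))"
      unfolding norm_mult norm_of_real using e g by (simp add: abs_mult)
    also have "\<dots> \<le> 2 * (\<gamma> * e) * T1 + 4 * (\<gamma>\<^sup>2 * e) * T2"
      unfolding T1_def T2_def using e g by (intro add_mono mult_left_mono shape_identity shape_outer) auto
    finally show ?thesis .
  qed
  have "shape_trace p X \<le> contr * cmod (shape_dev p X) + 2 * (C * E)"
    unfolding X_def by (rule pucci[OF _ _ _ _ weing_diff[OF W] sym rad_hess_sym psd])
      (use Cb(4,5)[OF bd(1,2)] contr in \<open>auto simp: E_def\<close>)
  also have "contr * cmod (shape_dev p X) \<le> contr * (2 * (\<gamma> * e) * T1 + 4 * (\<gamma>\<^sup>2 * e) * T2)"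
    using dev contr by (intro mult_left_mono) auto
  finally have 1: "4 * (\<gamma>\<^sup>2 * e) * T2 * (1 - contr) \<le> 2 * (\<gamma> * e) * T1 + contr * (2 * (\<gamma> * e) * T1) + 2 * (C * E)"
    unfolding tr by (simp add: algebra_simps)
  have 2: "contr * (2 * (\<gamma> * e) * T1) \<le> 1 * (2 * (\<gamma> * e) * T1)" using contr e g T1 by (intro mult_right_mono) auto
  have "norm (p - q) = 2 * \<gamma> * e * norm y" unfolding D using e g by (simp add: abs_mult)
  then have "E \<le> (P + P) * (2 * \<gamma> * e * norm y) * A"
    unfolding E_def using bd e g P A by (intro mult_mono add_mono) auto
  then have "2 * (C * E) \<le> 2 * (C * ((P + P) * (2 * \<gamma> * e * norm y) * A))" by (intro mult_left_mono) (use Cb(1) in auto)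
  then have "(4 * \<gamma> * e) * (\<gamma> * ((1 - contr) * T2)) \<le> (4 * \<gamma> * e) * (T1 + 2 * C * P * A * norm y)"
    using 1 2 by (simp add: algebra_simps power2_eq_square)
  then have 3: "\<gamma> * ((1 - contr) * T2) \<le> T1 + 2 * C * P * A * norm y" using e g by simp
  have "(norm p)\<^sup>2 \<le> P\<^sup>2" using bd(1) by (intro power_mono) auto
  then have "(1 + (norm p)\<^sup>2)\<^sup>2 \<le> (1 + P\<^sup>2)\<^sup>2" by (intro power_mono) auto
  moreover have "0 < 1 + (norm p)\<^sup>2" "0 < 1 + P\<^sup>2" by (simp_all add: add_pos_nonneg)
  then have "0 < (1 + P\<^sup>2)\<^sup>2 * (1 + (norm p)\<^sup>2)\<^sup>2" by (intro mult_pos_pos zero_less_power)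
  ultimately have "(norm y)\<^sup>2 / (1 + P\<^sup>2)\<^sup>2 \<le> (norm y)\<^sup>2 / (1 + (norm p)\<^sup>2)\<^sup>2"
    by (intro divide_left_mono) auto
  then have "(norm y)\<^sup>2 / (1 + P\<^sup>2)\<^sup>2 \<le> T2" using shape_outer(1)[of y p] unfolding T2_def by linarith
  then have "\<gamma> * ((1 - contr) * ((norm y)\<^sup>2 / (1 + P\<^sup>2)\<^sup>2)) \<le> \<gamma> * ((1 - contr) * T2)"
    using g contr by (intro mult_left_mono) auto
  then show ?thesis using 3 T1 by linarith
qed

text \<open>\<open>\<tau>\<close> stands for a negative power of \<open>r\<close>, and
  \<open>4 * e * b\<close> is the Laplacian of the test function. Three errors compete with it: the
  coefficients at \<open>p\<close> instead of 0, the nonlinearity of \<open>f\<close>, and the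
  difference of the gradients. Each is at most a multiple of \<open>\<tau> * e / r\<^sup>2\<close>,
  with constants 20, 20 and 16 in this order, so at a touching point \<open>b * r\<^sup>2\<close> is
  at most a multiple of \<open>\<tau>\<close>.\<close>

lemma barrier_pointwise:
  assumes K: "\<And>p q M N d. weing f p M \<Longrightarrow> weing f q N \<Longrightarrow> cmod (shape_dev p M) \<le> d \<Longrightarrow>
     cmod (shape_dev q N) \<le> d \<Longrightarrow> d \<le> 1 \<Longrightarrow> \<bar>shape_trace p M - shape_trace q N\<bar> \<le> K * d * cmod (shape_dev p M - shape_dev q N)" "K > 0"
    and C: "shape_bound 1 C"
    and W: "weing f p M" "weing f q N" and sym: "M$2$1 = M$1$2" "N$2$1 = N$1$2"
    and \<tau>: "0 < \<tau>" "\<tau> \<le> 1" and C1: "C1 > 0" and r: "r \<ge> 1" "norm y = r"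
    and bd: "norm p \<le> C1 * \<tau>" "norm q \<le> C1 * \<tau>" "norm M \<le> C1 * \<tau> / r" "norm N \<le> C1 * \<tau> / r"
    and small: "C1 * \<tau> \<le> 1" "C * C1 * \<tau> \<le> 1" "K * (C * C1 * \<tau>) \<le> 1"
    and e: "e > 0" and g: "0 \<le> g1" "g1 \<le> 2 / r\<^sup>2" "\<bar>g2\<bar> \<le> 3 / r^4" "g1 + r\<^sup>2 * g2 = - b"
    and D: "p - q = (2 * (- e * g1)) *\<^sub>R y"
    and psd: "\<And>h. h \<bullet> ((M - N - rad_hess (2 * (- e * g1)) (4 * (- e * g2)) y) *v h) \<ge> 0"
  shows "4 * b * r\<^sup>2 \<le> (36 * C * C1\<^sup>2 + 20 * K * C\<^sup>2 * C1) * \<tau>"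
proof -
  note Cb = shape_boundD[OF C]
  define X where "X = rad_hess (2 * (- e * g1)) (4 * (- e * g2)) y"
  define E where "E = (norm p + norm q) * norm (p - q) * norm N"
  have p1: "norm p \<le> 1" "norm q \<le> 1" using bd small by auto
  have "C1 * \<tau> / r \<le> C1 * \<tau> / 1" using C1 \<tau> r by (intro divide_left_mono) auto
  then have MN: "norm M \<le> C1 * \<tau>" "norm N \<le> C1 * \<tau>" using bd by auto
  have d: "cmod (shape_dev p M) \<le> C * C1 * \<tau>" "cmod (shape_dev q N) \<le> C * C1 * \<tau>"
    using Cb(3)[OF p1(1), of M] Cb(3)[OF p1(2), of N] mult_left_mono[OF MN(1), of C] mult_left_mono[OF MN(2), of C] Cb(1)
    unfolding mult.assoc by linarith+
  have "norm X \<le> 2 * \<bar>2 * (- e * g1)\<bar> + \<bar>4 * (- e * g2)\<bar> * r\<^sup>2"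
    unfolding X_def r(2)[symmetric] by (rule norm_rad_hess)
  also have "\<dots> = 4 * e * g1 + 4 * e * (\<bar>g2\<bar> * r\<^sup>2)" using e g by (simp add: abs_mult)
  also have "\<dots> \<le> 4 * e * (2 / r\<^sup>2) + 4 * e * (3 / r^4 * r\<^sup>2)" using e g by (intro add_mono mult_left_mono mult_right_mono) auto
  also have "\<dots> = 20 * (e / r\<^sup>2)" using r by (simp add: power4_eq_xxxx power2_eq_square field_simps)
  finally have X: "norm X \<le> 20 * (e / r\<^sup>2)" .
  have tr0: "shape_trace 0 X = 4 * e * b"
  proof -
    have "shape_trace 0 X = - 4 * e * g1 - 4 * e * g2 * ((y$1)\<^sup>2 + (y$2)\<^sup>2)"
      by (simp add: shape_0 X_def rad_hess_def power2_eq_square algebra_simps)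
    also have "(y$1)\<^sup>2 + (y$2)\<^sup>2 = r\<^sup>2" using norm_R2[of y] r by simp
    also have "- 4 * e * g1 - 4 * e * g2 * r\<^sup>2 = - 4 * e * (g1 + r\<^sup>2 * g2)" by (simp add: algebra_simps)
    finally show ?thesis using g(4) by simp
  qed
  define z where "z = e / r\<^sup>2"
  have ee: "z > 0" using e r by (simp add: z_def)
  have \<tau>2: "\<tau> * \<tau> \<le> \<tau> * 1" using \<tau> by (intro mult_left_mono) auto
  have "\<bar>shape_trace p X - shape_trace 0 X\<bar> \<le> C * ((norm p + norm (0::real^2)) * norm (p - 0) * norm X)"
    by (rule Cb(4)) (use p1 in auto)
  also have "\<dots> \<le> C * ((C1 * \<tau>) * (C1 * \<tau>) * (20 * (e / r\<^sup>2)))"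
    using bd X Cb(1) C1 \<tau> by (intro mult_left_mono mult_mono) auto
  also have "\<dots> = 20 * C * C1\<^sup>2 * (e / r\<^sup>2) * (\<tau> * \<tau>)" by (simp add: power2_eq_square)
  also have "\<dots> \<le> 20 * C * C1\<^sup>2 * (e / r\<^sup>2) * (\<tau> * 1)" by (intro mult_left_mono \<tau>2) (use Cb(1) e in auto)
  finally have 1: "4 * e * b - 20 * C * C1\<^sup>2 * (e / r\<^sup>2) * \<tau> \<le> shape_trace p X" unfolding tr0 by simp
  have "shape_trace p X \<le> (K * (C * C1 * \<tau>)) * cmod (shape_dev p X) + 2 * (C * E)"
    unfolding X_def
    by (rule pucci[OF _ _ _ small(3) K(1)[OF W d small(2)] sym rad_hess_sym psd])
      (use Cb(1) Cb(4,5)[OF p1] K(2) C1 \<tau> in \<open>auto simp: E_def\<close>)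
  moreover have "(K * (C * C1 * \<tau>)) * cmod (shape_dev p X) \<le> (K * (C * C1 * \<tau>)) * (C * (20 * (e / r\<^sup>2)))"
  proof (rule mult_left_mono)
    show "cmod (shape_dev p X) \<le> C * (20 * (e / r\<^sup>2))"
      using Cb(3)[OF p1(1), of X] mult_left_mono[OF X, of C] Cb(1) by linarith
  qed (use Cb(1) K(2) C1 \<tau> in auto)
  moreover have "2 * (C * E) \<le> 16 * C * C1\<^sup>2 * (e / r\<^sup>2) * \<tau>"
  proof -
    have "norm (p - q) = 2 * e * g1 * r" unfolding D using e g r by (simp add: abs_mult)
    also have "\<dots> \<le> 2 * e * (2 / r\<^sup>2) * r" using e g r by (intro mult_right_mono mult_left_mono) auto
    also have "\<dots> = 4 * e / r" using r by (simp add: power2_eq_square)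
    finally have pq: "norm (p - q) \<le> 4 * e / r" .
    have "E \<le> (C1 * \<tau> + C1 * \<tau>) * (4 * e / r) * (C1 * \<tau> / r)"
      unfolding E_def using bd pq C1 \<tau> e r by (intro mult_mono add_mono) auto
    also have "\<dots> = 8 * C1\<^sup>2 * (e / r\<^sup>2) * (\<tau> * \<tau>)" by (simp add: power2_eq_square)
    also have "\<dots> \<le> 8 * C1\<^sup>2 * (e / r\<^sup>2) * (\<tau> * 1)" by (intro mult_left_mono \<tau>2) (use e in auto)
    finally have "C * E \<le> C * (8 * C1\<^sup>2 * (e / r\<^sup>2) * (\<tau> * 1))" using Cb(1) by (intro mult_left_mono) auto
    then show ?thesis unfolding z_def[symmetric] by (simp add: algebra_simps)
  qed
  ultimately have "4 * e * b \<le> (36 * C * C1\<^sup>2 + 20 * K * C\<^sup>2 * C1) * \<tau> * (e / r\<^sup>2)"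
    using 1 unfolding z_def[symmetric] by (simp add: algebra_simps power2_eq_square)
  moreover have "(4 * b * r\<^sup>2) * (e / r\<^sup>2) = 4 * e * b" using r by simp
  ultimately have "(4 * b * r\<^sup>2) * (e / r\<^sup>2) \<le> ((36 * C * C1\<^sup>2 + 20 * K * C\<^sup>2 * C1) * \<tau>) * (e / r\<^sup>2)" by simp
  then show ?thesis unfolding z_def[symmetric] using ee by (simp only: mult_le_cancel_right_pos)
qed

text \<open>Hopf's argument at a ball on which \<open>u - v\<close> is positive except for one
  boundary point \<open>y0\<close>. No linearised equation is formed: after subtraction of an
  exponential barrier, \<open>u - v\<close> has an interior minimum near \<open>y0\<close>, and
  there \<open>touching\<close> and \<open>hopf_pointwise\<close> contradict the choice of
  \<open>\<gamma>\<close>.\<close>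

lemma strong_maximum_principle:
  assumes op: "open \<Omega>" "connected \<Omega>"
    and u: "C1_grad u p \<Omega>" "weing_sol f \<Omega> p M" and v: "C1_grad v q \<Omega>" "weing_sol f \<Omega> q N"
    and ge: "\<And>x. x \<in> \<Omega> \<Longrightarrow> v x \<le> u x" and x1: "x1 \<in> \<Omega>" "u x1 = v x1" and x: "x \<in> \<Omega>"
  shows "u x = v x"
proof (rule ccontr)
  assume ne: "u x \<noteq> v x"
  define w where "w x = u x - v x" for x
  have w0: "w x \<ge> 0" if "x \<in> \<Omega>" for x using ge[OF that] by (simp add: w_def)
  have cw: "continuous_on \<Omega> w"
    unfolding w_def[abs_def] by (intro continuous_intros C1_grad_continuous[OF u(1)] C1_grad_continuous[OF v(1)])
  define Z where "Z = {x\<in>\<Omega>. w x = 0}"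
  have "\<Omega> \<inter> frontier Z \<noteq> {}"
    using op(2) x1 x ne by (intro connected_Int_frontier) (auto simp: Z_def w_def)
  then obtain z where z: "z \<in> \<Omega>" "z \<in> frontier Z" by blast
  note zf = z(2)[unfolded frontier_straddle, rule_format]
  obtain r where r: "r > 0" "cball z r \<subseteq> \<Omega>" using op(1) z(1) open_contains_cball by blast
  have cz: "continuous_on (cball z r) w" by (rule continuous_on_subset[OF cw r(2)])
  define Zc where "Zc = {x\<in>cball z r. w x = 0}"
  have "closed Zc" unfolding Zc_def by (rule continuous_closed_preimage_constant[OF cz]) simp
  moreover have "Zc \<subseteq> cball z r" by (auto simp: Zc_def)
  ultimately have Zc: "compact Zc" using compact_Int_closed[of "cball z r" Zc] by (simp add: Int_absorb1)
  have wz: "w z = 0"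
  proof (rule ccontr)
    assume "w z \<noteq> 0"
    then have "w z > 0" using w0[OF z(1)] by simp
    then obtain d where d: "d > 0" "\<And>y. y \<in> \<Omega> \<Longrightarrow> dist y z < d \<Longrightarrow> dist (w y) (w z) < w z"
      using cw z(1) unfolding continuous_on_iff by blast
    obtain y where "y \<in> Z" "dist z y < d" using zf[OF d(1)] by blast
    then show False using d(2)[of y] \<open>w z > 0\<close> by (auto simp: Z_def dist_commute dist_real_def)
  qed
  \<comment> \<open>Within \<open>r / 2\<close> of \<open>z\<close>: the zero nearest to
    \<open>c0\<close> is then closer than \<open>r / 2\<close>, and the ball around
    \<open>c0\<close> that reaches it stays in \<open>cball z r\<close>.\<close>
  obtain c0 where c0: "c0 \<notin> Z" "dist z c0 < r / 2" using zf[of "r / 2"] r by auto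
  have c0r: "c0 \<in> cball z r" using c0 r by auto
  have "c0 \<in> \<Omega>" using c0r r(2) by blast
  then have wc0: "w c0 \<noteq> 0" using c0 by (auto simp: Z_def)
  have "z \<in> Zc" using wz r by (simp add: Zc_def)
  then have "\<exists>x\<in>Zc. \<forall>y\<in>Zc. dist c0 x \<le> dist c0 y"
    by (intro continuous_attains_inf[OF Zc] continuous_intros) auto
  then obtain y0 where y0: "y0 \<in> Zc" "\<And>y. y \<in> Zc \<Longrightarrow> dist c0 y0 \<le> dist c0 y" by blast
  define d where "d = dist c0 y0"
  have d: "d > 0" "d < r / 2"
    using y0 wc0 c0(2) y0(2)[OF \<open>z \<in> Zc\<close>] by (auto simp: d_def Zc_def dist_commute)
  have pos: "w x > 0 \<and> x \<in> cball z r" if "dist c0 x < d" for x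
  proof -
    have "dist z x \<le> dist z c0 + dist c0 x" by (rule dist_triangle)
    then have xr: "x \<in> cball z r" using that c0 d by simp
    have "x \<notin> Zc" using y0(2)[of x] that by (auto simp: d_def)
    then show ?thesis using w0[of x] xr r by (auto simp: Zc_def less_le)
  qed
  text \<open>The midpoint gives a ball that touches the zero set in \<open>y0\<close> only.\<close>
  define c where "c = (1/2) *\<^sub>R (c0 + y0)"
  define \<rho> where "\<rho> = d / 2"
  have \<rho>: "\<rho> > 0" using d by (simp add: \<rho>_def)
  have y0c: "y0 - c = (1/2) *\<^sub>R (y0 - c0)" "c - c0 = (1/2) *\<^sub>R (y0 - c0)"
    by (simp_all add: c_def vec_eq_iff field_simps)
  have ny0: "norm (y0 - c) = \<rho>" unfolding y0c \<rho>_def d_def by (simp add: dist_norm norm_minus_commute)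
  have touch: "w x > 0" if "norm (x - c) \<le> \<rho>" "x \<noteq> y0" for x
  proof -
    \<comment> \<open>By the parallelogram law: \<open>c\<close> is the midpoint of
      \<open>c0\<close> and \<open>y0\<close>, so in the smaller ball the squared distances to these
      two points add up to at most \<open>d\<^sup>2\<close>.\<close>
    define a where "a = (1/2) *\<^sub>R (y0 - c0)"
    have na: "norm a = \<rho>" using ny0 y0c a_def by simp
    have e: "x - c0 = (x - c) + a" "x - y0 = (x - c) - a" using y0c by (simp_all add: a_def algebra_simps)
    have "(norm (x - c0))\<^sup>2 + (norm (x - y0))\<^sup>2 = 2 * (norm (x - c))\<^sup>2 + 2 * (norm a)\<^sup>2"
      unfolding e power2_norm_eq_inner by (simp add: inner_simps inner_commute)
    also have "\<dots> \<le> 2 * \<rho>\<^sup>2 + 2 * \<rho>\<^sup>2" using that na by (intro add_mono mult_left_mono power_mono) auto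
    also have "\<dots> = d\<^sup>2" by (simp add: \<rho>_def power2_eq_square)
    finally have "(norm (x - c0))\<^sup>2 + (norm (x - y0))\<^sup>2 \<le> d\<^sup>2" .
    moreover have "(norm (x - y0))\<^sup>2 > 0" using that by simp
    ultimately have "(norm (x - c0))\<^sup>2 < d\<^sup>2" by linarith
    then have "norm (x - c0) < d" by (rule power2_less_imp_less) (use d in simp)
    then show ?thesis using pos[of x] by (simp add: dist_norm norm_minus_commute)
  qed
  have y0\<Omega>: "y0 \<in> \<Omega>" "w y0 = 0" using y0(1) r by (auto simp: Zc_def)
  obtain \<delta>0 where \<delta>0: "\<delta>0 > 0" "cball y0 \<delta>0 \<subseteq> \<Omega>" using op(1) y0\<Omega>(1) open_contains_cball by blast
  \<comment> \<open>The bound \<open>\<rho> / 2\<close> keeps the small ball at distance at least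
    \<open>\<rho> / 2\<close> from \<open>c\<close>, where the rank-one term of the barrier does not
    degenerate.\<close>
  define \<delta> where "\<delta> = min \<delta>0 (\<rho> / 2)"
  have \<delta>: "\<delta> > 0" "\<delta> \<le> \<rho> / 2" "cball y0 \<delta> \<subseteq> \<Omega>" using \<delta>0 \<rho> by (auto simp: \<delta>_def)
  have bdd: "\<exists>B. \<forall>x\<in>cball y0 \<delta>. norm (F x) \<le> B" if "continuous_on \<Omega> F" for F :: "real^2 \<Rightarrow> 'a::real_normed_vector"
    using compact_imp_bounded[OF compact_continuous_image[OF continuous_on_subset[OF that \<delta>(3)] compact_cball]]
    unfolding bounded_iff by auto
  obtain P1 where P1: "\<And>x. x \<in> cball y0 \<delta> \<Longrightarrow> norm (p x) \<le> P1" using bdd[OF weing_solD(4)[OF u(2)]] by blast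
  obtain P2 where P2: "\<And>x. x \<in> cball y0 \<delta> \<Longrightarrow> norm (q x) \<le> P2" using bdd[OF weing_solD(4)[OF v(2)]] by blast
  obtain A where A: "\<And>x. x \<in> cball y0 \<delta> \<Longrightarrow> norm (N x) \<le> A" using bdd[OF weing_solD(5)[OF v(2)]] by blast
  define P where "P = max P1 P2"
  obtain C where C: "shape_bound P C" using ex_shape_bound by blast
  have C0: "C > 0" by (rule shape_boundD[OF C])
  have P0: "P \<ge> 0" using order_trans[OF norm_ge_zero P1[of y0]] \<delta> by (simp add: P_def le_max_iff_disj)
  have A0: "A \<ge> 0" using order_trans[OF norm_ge_zero A[of y0]] \<delta> by simp
  define t0 where "t0 = (1 - contr) * ((\<rho> / 2)\<^sup>2 / (1 + P\<^sup>2)\<^sup>2)"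
  have "1 + P\<^sup>2 > 0" by (simp add: add_pos_nonneg)
  then have t0: "t0 > 0" using contr \<rho> unfolding t0_def by (intro mult_pos_pos divide_pos_pos zero_less_power) auto
  \<comment> \<open>Exceeds by \<open>1 / t0\<close> what \<open>hopf_pointwise\<close> would allow
    at any point of the small ball.\<close>
  define \<gamma> where "\<gamma> = (2 * C + 2 * C * P * A * (2 * \<rho>) + 1) / t0"
  have num: "2 * C + 2 * C * P * A * (2 * \<rho>) + 1 > 0" using C0 P0 A0 \<rho> by (simp add: add_pos_nonneg add_nonneg_pos)
  have \<gamma>: "\<gamma> > 0" unfolding \<gamma>_def using num t0 by simp
  \<comment> \<open>The part of the small sphere where the barrier can be positive. It is compact
    and does not contain \<open>y0\<close>, so \<open>w\<close> is bounded below on it by some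
    positive \<open>\<mu>\<close>.\<close>
  define S where "S = sphere y0 \<delta> \<inter> cball c \<rho>"
  have "\<exists>\<mu>>0. \<forall>x\<in>S. \<mu> \<le> w x"
  proof (cases "S = {}")
    case False
    have "compact S" unfolding S_def by (intro compact_Int compact_sphere compact_cball)
    moreover have "continuous_on S w" by (rule continuous_on_subset[OF cw]) (use \<delta>(3) in \<open>auto simp: S_def\<close>)
    ultimately obtain s where s: "s \<in> S" "\<And>x. x \<in> S \<Longrightarrow> w s \<le> w x" using False continuous_attains_inf by metis
    have "w s > 0" by (rule touch) (use s \<delta> in \<open>auto simp: S_def dist_norm norm_minus_commute\<close>)
    then show ?thesis using s by blast
  next
    case True
    then show ?thesis by (auto intro!: exI[of _ 1])
  qed
  then obtain \<mu> where \<mu>: "\<mu> > 0" "\<And>x. x \<in> S \<Longrightarrow> \<mu> \<le> w x" by blast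
  \<comment> \<open>Zero on the sphere of radius \<open>\<rho>\<close> around \<open>c\<close>,
    negative outside it and less than \<open>\<mu>\<close> everywhere. So \<open>F\<close> is
    positive on the small sphere while \<open>F y0 = 0\<close>, and its minimum is interior.\<close>
  define G where "G s = \<mu> * (exp (- \<gamma> * s) - exp (- \<gamma> * \<rho>\<^sup>2))" for s
  define G1 where "G1 s = - \<gamma> * (\<mu> * exp (- \<gamma> * s))" for s
  define G2 where "G2 s = \<gamma>\<^sup>2 * (\<mu> * exp (- \<gamma> * s))" for s
  have dG: "(G has_real_derivative G1 s) (at s)" "(G1 has_real_derivative G2 s) (at s)" for s
    unfolding G_def[abs_def] G1_def[abs_def] G2_def by (auto intro!: derivative_eq_intros simp: power2_eq_square)
  have cG2: "continuous_on U (\<lambda>x. G2 ((norm (x - c))\<^sup>2))" for U unfolding G2_def by (intro continuous_intros)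
  define F where "F x = u x - v x - G ((norm (x - c))\<^sup>2)" for x
  have cF: "continuous_on (cball y0 \<delta>) F"
    unfolding F_def G_def
    by (intro continuous_intros continuous_on_subset[OF C1_grad_continuous[OF u(1)] \<delta>(3)] continuous_on_subset[OF C1_grad_continuous[OF v(1)] \<delta>(3)])
  then obtain x0 where x0: "x0 \<in> cball y0 \<delta>" "\<And>x. x \<in> cball y0 \<delta> \<Longrightarrow> F x0 \<le> F x"
    using continuous_attains_inf[OF compact_cball _ cF] \<delta>(1) by auto
  have "F y0 = 0" using y0\<Omega> ny0 by (simp add: F_def G_def w_def)
  then have Fx0: "F x0 \<le> 0" using x0(2)[of y0] \<delta> by simp
  have "dist y0 x0 \<noteq> \<delta>"
  proof
    assume sp: "dist y0 x0 = \<delta>"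
    have x0\<Omega>: "x0 \<in> \<Omega>" using x0 \<delta> by blast
    show False
    proof (cases "norm (x0 - c) \<le> \<rho>")
      case True
      then have "\<mu> \<le> w x0" using sp by (intro \<mu>(2)) (simp add: S_def dist_norm norm_minus_commute)
      moreover have "exp (- \<gamma> * (norm (x0 - c))\<^sup>2) - exp (- \<gamma> * \<rho>\<^sup>2) < 1"
      proof -
        have "exp (- \<gamma> * (norm (x0 - c))\<^sup>2) \<le> exp 0" using \<gamma> by (subst exp_le_cancel_iff) simp
        then show ?thesis unfolding exp_zero using exp_gt_zero[of "- \<gamma> * \<rho>\<^sup>2"] by linarith
      qed
      then have "G ((norm (x0 - c))\<^sup>2) < \<mu> * 1" unfolding G_def using \<mu>(1) by (intro mult_strict_left_mono)
      ultimately show False using Fx0 by (simp add: F_def w_def)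
    next
      case False
      then have "\<rho>\<^sup>2 < (norm (x0 - c))\<^sup>2" using \<rho> by (intro power_strict_mono) auto
      then have "exp (- \<gamma> * (norm (x0 - c))\<^sup>2) < exp (- \<gamma> * \<rho>\<^sup>2)" using \<gamma> by simp
      then have "G ((norm (x0 - c))\<^sup>2) < 0" unfolding G_def using \<mu>(1) by (intro mult_pos_neg) auto
      then show False using Fx0 w0[OF x0\<Omega>] by (simp add: F_def w_def)
    qed
  qed
  then have x0b: "x0 \<in> ball y0 \<delta>" using x0 by simp
  have bsub: "ball y0 \<delta> \<subseteq> \<Omega>" using \<delta>(3) ball_subset_cball by blast
  have x0c: "x0 \<in> cball y0 \<delta>" "x0 \<in> \<Omega>" using x0b bsub by auto
  note T = touching[OF open_ball x0b C1_grad_subset[OF u(1) bsub] weing_sol_subset[OF u(2) bsub]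
      C1_grad_subset[OF v(1) bsub] weing_sol_subset[OF v(2) bsub] dG cG2]
  have min: "u x0 - v x0 - G ((norm (x0 - c))\<^sup>2) \<le> u x - v x - G ((norm (x - c))\<^sup>2)" if "x \<in> ball y0 \<delta>" for x
    using x0(2)[of x] that by (simp add: F_def)
  define e where "e = \<mu> * exp (- \<gamma> * (norm (x0 - c))\<^sup>2)"
  have e: "e > 0" using \<mu> by (simp add: e_def)
  have "\<gamma> * ((1 - contr) * ((norm (x0 - c))\<^sup>2 / (1 + P\<^sup>2)\<^sup>2)) \<le> 2 * C + 2 * C * P * A * norm (x0 - c)"
  proof (rule hopf_pointwise[OF weing_solD(3)[OF u(2) x0c(2)] weing_solD(3)[OF v(2) x0c(2)]
        weing_solD(2)[OF u(2) x0c(2)] weing_solD(2)[OF v(2) x0c(2)] _ _ A[OF x0c(1)] C e \<gamma>])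
    show "norm (p x0) \<le> P" "norm (q x0) \<le> P" using P1[OF x0c(1)] P2[OF x0c(1)] by (auto simp: P_def)
    show "p x0 - q x0 = (2 * (- \<gamma> * e)) *\<^sub>R (x0 - c)" using T(1)[OF min] by (simp add: G1_def e_def)
    show "0 \<le> h \<bullet> ((M x0 - N x0 - rad_hess (2 * (- \<gamma> * e)) (4 * (\<gamma>\<^sup>2 * e)) (x0 - c)) *v h)" for h
      using T(2)[OF min, of h] by (simp add: G1_def G2_def e_def)
  qed
  moreover have "norm (x0 - c) \<le> 2 * \<rho>" "\<rho> / 2 \<le> norm (x0 - c)"
  proof -
    have "norm (x0 - y0) \<le> \<rho> / 2" using x0c(1) \<delta> by (simp add: dist_norm norm_minus_commute)
    moreover have "x0 - c = (x0 - y0) + (y0 - c)" by simp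
    ultimately show "norm (x0 - c) \<le> 2 * \<rho>" "\<rho> / 2 \<le> norm (x0 - c)"
      using norm_triangle_ineq[of "x0 - y0" "y0 - c"] norm_triangle_ineq2[of "y0 - c" "- (x0 - y0)"] ny0 \<rho>
      by (simp_all add: algebra_simps norm_minus_commute)
  qed
  then have "2 * C + 2 * C * P * A * norm (x0 - c) \<le> 2 * C + 2 * C * P * A * (2 * \<rho>)"
    and "t0 \<le> (1 - contr) * ((norm (x0 - c))\<^sup>2 / (1 + P\<^sup>2)\<^sup>2)"
    unfolding t0_def using C0 P0 A0 contr \<rho> by (intro add_left_mono mult_left_mono divide_right_mono power_mono; simp)+
  moreover have "\<gamma> * t0 = 2 * C + 2 * C * P * A * (2 * \<rho>) + 1" using t0 by (simp add: \<gamma>_def)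
  ultimately show False using mult_left_mono[of t0 "(1 - contr) * ((norm (x0 - c))\<^sup>2 / (1 + P\<^sup>2)\<^sup>2)" \<gamma>] \<gamma> by linarith
qed

end

lemma connected_exterior:
  assumes "R > 0" shows "connected {x::real^2. norm x > R}"
proof -
  have "{x::real^2. norm x > R} = (\<lambda>(r, t). circ 0 r t) ` ({R<..} \<times> {0..2*pi})"
  proof (intro equalityI subsetI)
    fix x :: "real^2" assume x: "x \<in> {x. norm x > R}"
    obtain t where "t \<in> {0..2*pi}" "x = circ 0 (norm x) t" using polar_R2[of x 0] by auto
    then show "x \<in> (\<lambda>(r, t). circ 0 r t) ` ({R<..} \<times> {0..2*pi})" using x by force
  qed (use assms in auto)
  moreover have "connected ((\<lambda>(r, t). circ 0 r t) ` ({R<..} \<times> {0..2*pi}))"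
    unfolding case_prod_unfold
    by (intro connected_continuous_image continuous_intros convex_connected convex_Times convex_real_interval)
  ultimately show ?thesis by simp
qed

section \<open>A logarithmic barrier at infinity\<close>

context curvature_relation
begin

text \<open>On the exterior of a large disc \<open>ln s - s powr (- a)\<close>, with \<open>s = |x|\<^sup>2\<close>, is a supersolution that
  tends to infinity: the Laplacian of the second term beats the deviation of the linearised
  operator from the Laplacian, which decays like a power by \<open>solution_decay\<close>.\<close>

lemma exterior_lower_bound:
  assumes u: "C1_grad u p {x. norm x > R}" "weing_sol f {x. norm x > R} p M" "(p \<longlongrightarrow> 0) at_infinity"
    and v: "C1_grad v q {x. norm x > R}" "weing_sol f {x. norm x > R} q N" "(q \<longlongrightarrow> 0) at_infinity"
    and ge: "\<And>x. norm x > R \<Longrightarrow> v x \<le> u x"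
  shows "\<exists>R1>max R 0. \<forall>c. (\<forall>x. norm x = R1 \<longrightarrow> c \<le> u x - v x) \<longrightarrow> (\<forall>x. norm x \<ge> R1 \<longrightarrow> c \<le> u x - v x)"
proof -
  obtain \<gamma> where \<gamma>: "\<gamma> > 0" and dec:
    "\<And>p H R0. weing_sol f {x. norm x > R0} p H \<Longrightarrow> (p \<longlongrightarrow> 0) at_infinity \<Longrightarrow>
       \<exists>C>0. \<exists>R>0. \<forall>x. norm x \<ge> R \<longrightarrow> norm (p x) \<le> C * norm x powr (- \<gamma>) \<and> norm (H x) \<le> C * (norm x powr (- \<gamma>) / norm x)"
    using solution_decay by blast
  obtain Cu Ru where Cu: "Cu > 0" "Ru > 0" "\<And>x. norm x \<ge> Ru \<Longrightarrow> norm (p x) \<le> Cu * norm x powr (- \<gamma>) \<and> norm (M x) \<le> Cu * (norm x powr (- \<gamma>) / norm x)"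
    using dec[OF u(2,3)] by blast
  obtain Cv Rv where Cv: "Cv > 0" "Rv > 0" "\<And>x. norm x \<ge> Rv \<Longrightarrow> norm (q x) \<le> Cv * norm x powr (- \<gamma>) \<and> norm (N x) \<le> Cv * (norm x powr (- \<gamma>) / norm x)"
    using dec[OF v(2,3)] by blast
  obtain K where K: "K > 0" "\<And>p q M N d. weing f p M \<Longrightarrow> weing f q N \<Longrightarrow> cmod (shape_dev p M) \<le> d \<Longrightarrow>
     cmod (shape_dev q N) \<le> d \<Longrightarrow> d \<le> 1 \<Longrightarrow>
     \<bar>shape_trace p M - shape_trace q N\<bar> \<le> K * d * cmod (shape_dev p M - shape_dev q N)"
    using weing_diff_small by blast
  obtain C where C: "shape_bound 1 C" using ex_shape_bound by blast
  have C0: "C > 0" by (rule shape_boundD[OF C])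
  define C1 where "C1 = Cu + Cv"
  have C1: "C1 > 0" "Cu \<le> C1" "Cv \<le> C1" using Cu Cv by (auto simp: C1_def)
  \<comment> \<open>\<open>2 * a < \<gamma>\<close> lets the excess of the barrier, of order
    \<open>r powr (- 2 * a)\<close>, win over the errors of order
    \<open>r powr (- \<gamma>)\<close>; \<open>a \<le> 1\<close> serves the numerical bounds for
    \<open>g1\<close> and \<open>g2\<close>.\<close>
  define a where "a = min 1 (\<gamma> / 4)"
  have a: "0 < a" "a \<le> 1" "2 * a - \<gamma> < 0" using \<gamma> by (auto simp: a_def)
  define Z where "Z = 36 * C * C1\<^sup>2 + 20 * K * C\<^sup>2 * C1"
  have null: "\<forall>\<^sub>F r in at_top. X * r powr e < d" if "e < 0" "d > 0" for X e d :: real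
  proof -
    have "((\<lambda>r. X * r powr e) \<longlongrightarrow> 0) at_top"
      using tendsto_mult_right_zero[OF tendsto_neg_powr[OF that(1) filterlim_ident]] by simp
    from order_tendstoD(2)[OF this that(2)] show ?thesis .
  qed
  have "\<forall>\<^sub>F r in at_top. C1 * r powr (- \<gamma>) < 1 \<and> (C * C1) * r powr (- \<gamma>) < 1 \<and> (K * (C * C1)) * r powr (- \<gamma>) < 1
      \<and> Z * r powr (2 * a - \<gamma>) < 4 * a\<^sup>2"
    by (intro eventually_conj null) (use \<gamma> a in auto)
  then obtain R0 where R0: "\<And>r. r \<ge> R0 \<Longrightarrow> C1 * r powr (- \<gamma>) < 1 \<and> (C * C1) * r powr (- \<gamma>) < 1 \<and> (K * (C * C1)) * r powr (- \<gamma>) < 1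
      \<and> Z * r powr (2 * a - \<gamma>) < 4 * a\<^sup>2"
    unfolding eventually_at_top_linorder by blast
  \<comment> \<open>Besides the thresholds of the estimates, \<open>exp 1\<close> is included so
    that \<open>ln (norm y) - 1\<close>, and with it the barrier, is nonnegative from this circle
    outwards.\<close>
  define R1 where "R1 = Max {R0, R + 1, Ru, Rv, exp 1}"
  have R1: "R1 \<ge> R0" "R1 \<ge> R + 1" "R1 \<ge> Ru" "R1 \<ge> Rv" "R1 \<ge> exp 1" by (simp_all add: R1_def)
  have R11: "R1 \<ge> 1" using R1(5) exp_ge_add_one_self[of 1] by linarith
  define g1 where "g1 s = 1 / s + a * s powr (- a - 1)" for s
  define g2 where "g2 s = - (1 / s\<^sup>2) - a * (a + 1) * s powr (- a - 2)" for s
  define \<psi> where "\<psi> s = ln s - s powr (- a)" for s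
  have \<psi>_ge: "\<psi> s \<ge> ln s - 1" if "s \<ge> 1" for s
    using powr_mono[of "- a" 0 s] a that by (simp add: \<psi>_def)
  have d\<psi>: "(\<psi> has_real_derivative g1 s) (at s)" "(g1 has_real_derivative g2 s) (at s)" if "s > 0" for s
  proof -
    show "(\<psi> has_real_derivative g1 s) (at s)"
      unfolding \<psi>_def[abs_def] g1_def using that by (auto intro!: derivative_eq_intros)
    show "(g1 has_real_derivative g2 s) (at s)"
      unfolding g1_def[abs_def] g2_def using that
      by (auto intro!: derivative_eq_intros simp: power2_eq_square field_simps)
  qed
  \<comment> \<open>Touching beyond \<open>R1\<close> is excluded for every positive
    \<open>\<epsilon>\<close>, so \<open>\<epsilon>\<close> may be chosen later, depending on the
    point under consideration.\<close>
  have far: False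
    if x0: "norm x0 > R1" and \<epsilon>: "\<epsilon> > 0"
      and D: "p x0 - q x0 = (2 * (- \<epsilon> * g1 ((norm x0)\<^sup>2))) *\<^sub>R x0"
      and psd: "\<And>h. h \<bullet> ((M x0 - N x0 - rad_hess (2 * (- \<epsilon> * g1 ((norm x0)\<^sup>2))) (4 * (- \<epsilon> * g2 ((norm x0)\<^sup>2))) x0) *v h) \<ge> 0"
    for x0 \<epsilon>
  proof -
    define r s \<tau> where "r = norm x0" and "s = r\<^sup>2" and "\<tau> = r powr (- \<gamma>)"
    have r: "r \<ge> 1" "r \<ge> R0" "r \<ge> Ru" "r \<ge> Rv" "r > R" using x0 R1 R11 by (auto simp: r_def)
    have s: "s \<ge> 1" using r by (simp add: s_def one_le_power)
    have spow: "s powr e = r powr (2 * e)" for e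
    proof -
      have "s = r powr 2" using r by (simp add: s_def)
      then show ?thesis by (simp add: powr_powr)
    qed
    have \<tau>: "0 < \<tau>" "\<tau> \<le> 1" using r \<gamma> powr_mono[of "- \<gamma>" 0 r] by (auto simp: \<tau>_def)
    have x\<Omega>: "x0 \<in> {x. norm x > R}" using r by (simp add: r_def)
    have sm: "C1 * \<tau> \<le> 1" "C * C1 * \<tau> \<le> 1" "K * (C * C1 * \<tau>) \<le> 1"
      using R0[OF r(2)] unfolding \<tau>_def mult.assoc by linarith+
    have bd: "norm (p x0) \<le> C1 * \<tau>" "norm (q x0) \<le> C1 * \<tau>" "norm (M x0) \<le> C1 * \<tau> / r" "norm (N x0) \<le> C1 * \<tau> / r"
    proof -
      have "Cu * \<tau> \<le> C1 * \<tau>" "Cv * \<tau> \<le> C1 * \<tau>" using C1 \<tau> by (auto intro: mult_right_mono)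
      moreover from this have "Cu * \<tau> / r \<le> C1 * \<tau> / r" "Cv * \<tau> / r \<le> C1 * \<tau> / r"
        using r by (auto intro: divide_right_mono)
      ultimately show "norm (p x0) \<le> C1 * \<tau>" "norm (q x0) \<le> C1 * \<tau>" "norm (M x0) \<le> C1 * \<tau> / r" "norm (N x0) \<le> C1 * \<tau> / r"
        using Cu(3)[of x0] Cv(3)[of x0] r unfolding r_def[symmetric] \<tau>_def[symmetric] times_divide_eq_right by auto
    qed
    have g: "0 \<le> g1 s" "g1 s \<le> 2 / r\<^sup>2" "\<bar>g2 s\<bar> \<le> 3 / r^4" "g1 s + r\<^sup>2 * g2 s = - (a\<^sup>2 * s powr (- a - 1))"
    proof -
      show "0 \<le> g1 s" using s a by (simp add: g1_def)
      have "s powr (- a - 1) \<le> s powr (- 1)" using s a by (intro powr_mono) auto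
      then have "a * s powr (- a - 1) \<le> 1 * (1 / s)" using a s by (intro mult_mono) (auto simp: powr_minus_divide)
      then show "g1 s \<le> 2 / r\<^sup>2" by (simp add: g1_def s_def)
      have s2: "s powr (- 2) = 1 / s\<^sup>2" using s by (simp add: powr_minus_divide)
      have "s powr (- a - 2) \<le> s powr (- 2)" using s a by (intro powr_mono) auto
      moreover have "a * (a + 1) \<le> 1 * (1 + 1)" using a by (intro mult_mono) auto
      ultimately have "a * (a + 1) * s powr (- a - 2) \<le> 2 * (1 / s\<^sup>2)"
        using a s2 by (intro mult_mono) auto
      moreover have "0 \<le> a * (a + 1) * s powr (- a - 2)" using a by simp
      moreover have "0 \<le> 1 / s\<^sup>2" by simp
      ultimately have "\<bar>g2 s\<bar> \<le> 1 / s\<^sup>2 + 2 * (1 / s\<^sup>2)" unfolding g2_def by linarith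
      then show "\<bar>g2 s\<bar> \<le> 3 / r^4" by (simp add: s_def)
      have "s * s powr (- a - 2) = s powr 1 * s powr (- a - 2)" using s by simp
      also have "\<dots> = s powr (- a - 1)"
        unfolding powr_add[symmetric] by (rule arg_cong[where f = "\<lambda>e. s powr e"]) simp
      finally have "s * s powr (- a - 2) = s powr (- a - 1)" .
      then have "s * g2 s = - (1 / s) - a * (a + 1) * s powr (- a - 1)"
        using s by (simp add: g2_def right_diff_distrib power2_eq_square)
      then show "g1 s + r\<^sup>2 * g2 s = - (a\<^sup>2 * s powr (- a - 1))"
        unfolding s_def[symmetric] by (simp add: g1_def power2_eq_square algebra_simps)
    qed
    have "4 * (a\<^sup>2 * s powr (- a - 1)) * r\<^sup>2 \<le> Z * \<tau>"
      unfolding Z_def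
      by (rule barrier_pointwise[OF K(2,1) C weing_solD(3)[OF u(2) x\<Omega>] weing_solD(3)[OF v(2) x\<Omega>]
            weing_solD(2)[OF u(2) x\<Omega>] weing_solD(2)[OF v(2) x\<Omega>] \<tau> C1(1) r(1) r_def[symmetric] bd sm \<epsilon> g])
        (use D psd in \<open>simp_all add: r_def s_def\<close>)
    also have "4 * (a\<^sup>2 * s powr (- a - 1)) * r\<^sup>2 = 4 * a\<^sup>2 * r powr (- 2 * a)"
    proof -
      have "s powr (- a - 1) * r\<^sup>2 = s powr (- a - 1) * s powr 1" using s by (simp add: s_def)
      also have "\<dots> = s powr (- a)" unfolding powr_add[symmetric] by simp
      finally show ?thesis by (simp add: spow mult.assoc)
    qed
    finally have "4 * a\<^sup>2 * r powr (- 2 * a) * r powr (2 * a) \<le> Z * \<tau> * r powr (2 * a)"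
      by (intro mult_right_mono) auto
    moreover have "r powr (- 2 * a) * r powr (2 * a) = 1" using r by (simp flip: powr_add)
    moreover have "\<tau> * r powr (2 * a) = r powr (2 * a - \<gamma>)" by (simp add: \<tau>_def flip: powr_add)
    ultimately have "4 * a\<^sup>2 \<le> Z * r powr (2 * a - \<gamma>)" by (simp add: mult.assoc)
    then show False using R0[OF r(2)] by linarith
  qed
  have main: "c \<le> u x - v x" if c: "\<And>x. norm x = R1 \<Longrightarrow> c \<le> u x - v x" and x: "norm x \<ge> R1" for c x
  proof (rule ccontr)
    assume less: "\<not> c \<le> u x - v x"
    define \<Psi> where "\<Psi> y = \<psi> ((norm y)\<^sup>2)" for y :: "real^2"
    have sq: "(norm y)\<^sup>2 \<ge> norm y" if "norm y \<ge> 1" for y :: "real^2"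
      using that by (simp add: power2_eq_square mult_le_cancel_left1)
    have \<Psi>: "\<Psi> y \<ge> ln (norm y) - 1" if "norm y \<ge> 1" for y
    proof -
      have "ln (norm y) \<le> ln ((norm y)\<^sup>2)" using sq[OF that] that by (subst ln_le_cancel_iff) auto
      then show ?thesis using \<psi>_ge[of "(norm y)\<^sup>2"] sq[OF that] that unfolding \<Psi>_def by linarith
    qed
    have \<Psi>0: "\<Psi> y \<ge> 0" if "norm y \<ge> R1" for y
    proof -
      have "ln (exp 1) \<le> ln (norm y)" using that R1(5) R11 by (subst ln_le_cancel_iff) auto
      then show ?thesis using \<Psi>[of y] that R11 by simp
    qed
    \<comment> \<open>So small that the barrier uses at most half of the gap at \<open>x\<close>;
      the added 1 keeps the denominator positive.\<close>
    define \<epsilon> where "\<epsilon> = (c - (u x - v x)) / (2 * (\<Psi> x + 1))"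
    have \<epsilon>: "\<epsilon> > 0" using less \<Psi>0[OF x] by (simp add: \<epsilon>_def)
    have "\<epsilon> * \<Psi> x < c - (u x - v x)"
    proof -
      have "\<epsilon> * \<Psi> x \<le> \<epsilon> * (\<Psi> x + 1)" using \<epsilon> by simp
      also have "\<dots> = (c - (u x - v x)) / 2"
      proof -
        have "D / (2 * h) * h = D / 2" if "h \<noteq> 0" for D h :: real using that by simp
        then show ?thesis unfolding \<epsilon>_def using \<Psi>0[OF x] by (metis add.commute add_nonneg_pos less_irrefl zero_less_one)
      qed
      also have "\<dots> < c - (u x - v x)" using less by simp
      finally show ?thesis .
    qed
    define F where "F y = u y - v y - (- \<epsilon> * \<psi> ((norm (y - 0))\<^sup>2))" for y
    have Fx: "F x < c" using \<open>\<epsilon> * \<Psi> x < _\<close> by (simp add: F_def \<Psi>_def)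
    \<comment> \<open>On the outer circle \<open>\<epsilon> * \<psi>\<close> is at least
      \<open>\<bar>c\<bar>\<close>, so \<open>F \<ge> c\<close> there because
      \<open>u \<ge> v\<close>. As \<open>F x < c\<close>, the minimum lies on neither
      circle.\<close>
    define R2 where "R2 = max (norm x + 1) (exp (1 + \<bar>c\<bar> / \<epsilon>))"
    have R2: "R2 > norm x" "R2 \<ge> exp (1 + \<bar>c\<bar> / \<epsilon>)" by (auto simp: R2_def)
    define A where "A = cball 0 R2 - ball (0::real^2) R1"
    have A: "y \<in> A \<longleftrightarrow> R1 \<le> norm y \<and> norm y \<le> R2" for y by (auto simp: A_def)
    have "compact A" unfolding A_def by (intro compact_diff) auto
    moreover have "continuous_on A F"
    proof -
      have "continuous_on {0<..} \<psi>" using d\<psi>(1) DERIV_isCont by (intro continuous_at_imp_continuous_on) auto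
      then have "continuous_on A (\<lambda>y. \<psi> ((norm (y - 0))\<^sup>2))"
        by (rule continuous_on_compose2) (use A R11 in \<open>auto intro!: continuous_intros\<close>)
      moreover have "A \<subseteq> {x. norm x > R}" using A R1 by auto
      ultimately show ?thesis unfolding F_def
        by (intro continuous_intros continuous_on_subset[OF C1_grad_continuous[OF u(1)]] continuous_on_subset[OF C1_grad_continuous[OF v(1)]])
    qed
    moreover have "x \<in> A" using x R2 by (simp add: A)
    ultimately obtain x0 where x0: "x0 \<in> A" "\<And>y. y \<in> A \<Longrightarrow> F x0 \<le> F y" using continuous_attains_inf[of A F] by blast
    have Fx0: "F x0 < c" using x0(2)[OF \<open>x \<in> A\<close>] Fx by linarith
    have x0R: "norm x0 \<ge> R1" "norm x0 \<le> R2" using x0(1) A by auto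
    have "norm x0 \<noteq> R1"
    proof
      assume "norm x0 = R1"
      then have "c \<le> u x0 - v x0" by (rule c)
      moreover have "0 \<le> \<epsilon> * \<psi> ((norm x0)\<^sup>2)" using \<Psi>0[OF x0R(1)] \<epsilon> by (simp add: \<Psi>_def)
      ultimately show False using Fx0 by (simp add: F_def)
    qed
    moreover have "norm x0 \<noteq> R2"
    proof
      assume eq: "norm x0 = R2"
      have "ln (exp (1 + \<bar>c\<bar> / \<epsilon>)) \<le> ln (norm x0)" unfolding eq using R2(2) by (subst ln_le_cancel_iff) (auto intro: less_le_trans[OF exp_gt_zero])
      then have "\<bar>c\<bar> / \<epsilon> \<le> \<Psi> x0" using \<Psi>[of x0] x0R R11 by simp
      then have "\<bar>c\<bar> \<le> \<epsilon> * \<psi> ((norm x0)\<^sup>2)" using \<epsilon> by (simp add: \<Psi>_def pos_divide_le_eq mult.commute)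
      moreover have "v x0 \<le> u x0" using x0R R1 by (intro ge) auto
      ultimately show False using Fx0 by (simp add: F_def)
    qed
    ultimately have x0': "R1 < norm x0" "norm x0 < R2" using x0R by auto
    define \<Omega> where "\<Omega> = {y::real^2. R1 < norm y} \<inter> {y. norm y < R2}"
    have op: "open \<Omega>" unfolding \<Omega>_def by (intro open_Int open_Collect_less continuous_intros)
    have x0\<Omega>: "x0 \<in> \<Omega>" using x0' by (simp add: \<Omega>_def)
    have sub: "\<Omega> \<subseteq> {x. norm x > R}" using R1 by (auto simp: \<Omega>_def)
    have pos: "(norm (y - 0))\<^sup>2 > 0" if "y \<in> \<Omega>" for y using that R11 by (auto simp: \<Omega>_def)
    have dG: "((\<lambda>s. - \<epsilon> * \<psi> s) has_real_derivative - \<epsilon> * g1 ((norm (y - 0))\<^sup>2)) (at ((norm (y - 0))\<^sup>2))"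
      "((\<lambda>s. - \<epsilon> * g1 s) has_real_derivative - \<epsilon> * g2 ((norm (y - 0))\<^sup>2)) (at ((norm (y - 0))\<^sup>2))" if "y \<in> \<Omega>" for y
      by (intro DERIV_cmult d\<psi> pos that)+
    have cG: "continuous_on \<Omega> (\<lambda>y. - \<epsilon> * g2 ((norm (y - 0))\<^sup>2))"
      unfolding g2_def using pos by (intro continuous_intros) (auto simp: \<Omega>_def)
    have min: "u x0 - v x0 - (- \<epsilon> * \<psi> ((norm (x0 - 0))\<^sup>2)) \<le> u y - v y - (- \<epsilon> * \<psi> ((norm (y - 0))\<^sup>2))" if "y \<in> \<Omega>" for y
      using x0(2)[of y] that by (simp add: F_def A \<Omega>_def)
    note T = touching[OF op x0\<Omega> C1_grad_subset[OF u(1) sub] weing_sol_subset[OF u(2) sub]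
      C1_grad_subset[OF v(1) sub] weing_sol_subset[OF v(2) sub] dG cG min]
    show False by (rule far[OF x0'(1) \<epsilon>]) (use T in simp_all)
  qed
  show ?thesis
  proof (intro exI[of _ R1] conjI allI impI)
    show "max R 0 < R1" using R1 R11 by auto
  qed (use main in blast)
qed

end

section \<open>Equality on the closed exterior\<close>

theorem corollary1p5:
  fixes f f' :: "real \<Rightarrow> real" and u v :: "real^2 \<Rightarrow> real"
    and x :: "nat \<Rightarrow> real^2" and \<Lambda> R :: real
  assumes "0 < \<Lambda>" and "\<Lambda> < 1"
    and "\<And>t. t \<ge> 0 \<Longrightarrow> (f has_real_derivative f' t) (at t within {0..})"
    and "\<And>b. \<exists>L. L-lipschitz_on {0..b} f'"
    and "f 0 = 0"
    and "\<And>t. t \<ge> 0 \<Longrightarrow> - (1 / \<Lambda>) \<le> f' t \<and> f' t \<le> - \<Lambda>"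
    and "f' 0 = -1"
    and "R > 0"
    and "C2_on (ball_compl R) u" and "C2_on (ball_compl R) v"
    and "\<And>y. y \<in> ball_compl R \<Longrightarrow> u y > 0" and "\<And>y. y \<in> ball_compl R \<Longrightarrow> v y > 0"
    and "weingarten_graph f (ball_compl R) u" and "weingarten_graph f (ball_compl R) v"
    and "(upward_normal (ball_compl R) u \<longlongrightarrow> vector [0, 0, 1]) at_infinity"
    and "(upward_normal (ball_compl R) v \<longlongrightarrow> vector [0, 0, 1]) at_infinity"
    and "\<And>y. y \<in> ball_compl R \<Longrightarrow> u y \<ge> v y"
    and "\<And>n. x n \<in> ball_compl R"
    and "filterlim x at_infinity sequentially"
    and "(\<lambda>n. u (x n) - v (x n)) \<longlonglongrightarrow> 0"
  shows "\<forall>y \<in> ball_compl R. u y = v y"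
proof -
  interpret curvature_relation f f' \<Lambda> by unfold_locales (use assms in auto)
  define \<Omega> where "\<Omega> = {y::real^2. norm y > R}"
  note u = C2_on_C1_grad(1)[OF assms(9)] C2_on_weing_sol[OF assms(9,13)] grad_tendsto_0[OF assms(15)]
  note v = C2_on_C1_grad(1)[OF assms(10)] C2_on_weing_sol[OF assms(10,14)] grad_tendsto_0[OF assms(16)]
  have ge: "v y \<le> u y" if "norm y > R" for y using assms(17)[of y] that by simp
  \<comment> \<open>The radius does not depend on \<open>c\<close>, which is afterwards taken to be
    the minimum of \<open>u - v\<close> on this very circle.\<close>
  obtain R1 where R1: "R1 > max R 0" "\<And>c y. (\<And>y. norm y = R1 \<Longrightarrow> c \<le> u y - v y) \<Longrightarrow> norm y \<ge> R1 \<Longrightarrow> c \<le> u y - v y"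
    using exterior_lower_bound[OF u v ge] by blast
  have cw: "continuous_on \<Omega> (\<lambda>y. u y - v y)"
    unfolding \<Omega>_def by (intro continuous_intros C1_grad_continuous[OF u(1)] C1_grad_continuous[OF v(1)])
  have sph: "sphere 0 R1 \<subseteq> \<Omega>" using R1 by (auto simp: \<Omega>_def)
  have "R1 *\<^sub>R dir 0 \<in> sphere 0 R1" using R1 by simp
  then have "sphere (0::real^2) R1 \<noteq> {}" by blast
  then obtain z where z: "z \<in> sphere 0 R1" "\<And>y. y \<in> sphere 0 R1 \<Longrightarrow> u z - v z \<le> u y - v y"
    using continuous_attains_inf[OF compact_sphere _ continuous_on_subset[OF cw sph]] by blast
  have low: "u z - v z \<le> u y - v y" if "norm y \<ge> R1" for y
    by (rule R1(2)) (use z that in auto)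
  have "\<forall>\<^sub>F n in sequentially. norm (x n) \<ge> R1"
    using assms(19) unfolding filterlim_at_infinity[OF order_refl] using R1 by auto
  then have "\<forall>\<^sub>F n in sequentially. u z - v z \<le> u (x n) - v (x n)"
    by eventually_elim (rule low)
  then have "u z - v z \<le> 0"
    by (intro tendsto_lowerbound[OF assms(20)]) auto
  moreover have z\<Omega>: "z \<in> \<Omega>" using z sph by blast
  ultimately have z0: "u z = v z" using ge[of z] by (simp add: \<Omega>_def)
  have op: "open \<Omega>" "connected \<Omega>"
    using connected_exterior[OF assms(8)] unfolding \<Omega>_def by (auto intro!: open_Collect_less continuous_intros)
  have eq: "u y - v y = 0" if "y \<in> \<Omega>" for y
    using strong_maximum_principle[OF op u(1,2)[folded \<Omega>_def] v(1,2)[folded \<Omega>_def] _ z\<Omega> z0 that] ge by (simp add: \<Omega>_def)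
  show ?thesis
  proof
    fix y assume y: "y \<in> ball_compl R"
    have cS: "continuous_on (ball_compl R) (\<lambda>y. u y - v y)"
      using assms(9,10) unfolding C2_on_def by (intro continuous_intros differentiable_imp_continuous_on) auto
    have y0: "norm y > 0" "norm y \<ge> R" using y assms(8) by auto
    \<comment> \<open>The maximum principle holds on the open exterior. A point of the boundary
      circle is approached radially from outside, using continuity of \<open>u - v\<close> up to the
      boundary.\<close>
    define yn where "yn n = (1 + 1 / real (Suc n)) *\<^sub>R y" for n
    have nyn: "norm (yn n) = (1 + 1 / real (Suc n)) * norm y" for n by (simp add: yn_def)
    have "norm y < norm (yn n)" for n unfolding nyn using y0 by simp
    then have yn: "yn n \<in> \<Omega>" for n using y0 by (auto simp: \<Omega>_def intro: le_less_trans)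
    have "yn \<longlonglongrightarrow> (1 + 0) *\<^sub>R y"
      unfolding yn_def by (intro tendsto_intros LIMSEQ_inverse_real_of_nat[unfolded inverse_eq_divide])
    then have "(\<lambda>n. u (yn n) - v (yn n)) \<longlonglongrightarrow> u y - v y"
      using yn by (intro continuous_on_tendsto_compose[OF cS _ y]) (auto simp: \<Omega>_def not_less less_imp_le intro!: always_eventually)
    then have "(\<lambda>n. 0) \<longlonglongrightarrow> u y - v y" using eq[OF yn] by simp
    then have "u y - v y = 0" using LIMSEQ_unique[OF tendsto_const] by metis
    then show "u y = v y" by simp
  qed
qed

end
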